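(* Let $W$ be a Brownian motion, let $\alpha(t),\beta(t),\sigma(t)$ be deterministic integrable functions, and consider, for an initial time $s\ge 0$ and an initial condition $\lambda_s$ known at time $s$, the stochastic differential equation $$d\lambda_t=(\alpha(t)-\beta(t)\lambda_t)\,dt+\sigma(t)\,dW_t,\qquad t\ge s .$$ Assume that the coefficients are such that existence and uniqueness conditions for the (strong) solution are met. Define $$G(s,t):=e^{-\int_s^t\beta(u)du},\qquad I(s,t):=\int_s^t\alpha(u)G(u,s)\,du,$$ $$J(s,t):=\int_s^t\sigma(u)G(u,s)\,dW_u,\qquad K(s,t):=\int_s^t\sigma(s)G(s,u)\,du .$$ Then, for any $t\ge s$, conditional upon $\lambda_s$: (i) the solution of the equation is $$\lambda_t=m(s,t)+G(s,t)J(s,t),$$ and it is normally distributed with mean and variance respectively $$m(s,t):=G(s,t)\bigl(\lambda_s+I(s,t)\bigr),$$ $$v(s,t):=G^2(s,t)\int_s^t\sigma^2(u)G^2(u,s)\,du=\int_s^t\sigma^2(u)G^2(u,t)\,du ;$$ (ii) the integral $\Lambda_{s,t}:=\int_s^t\lambda_u\,du$ is the shifted Itô integral $$\Lambda_{s,t}=M(s,t)+\int_s^tK(u,t)\,dW_u,$$ and it is normally distributed with mean and variance respectively $$M(s,t):=(t-s)\lambda_s+\int_s^t(t-u)\Bigl(\alpha(u)-\beta(u)G(s,u)\bigl(\lambda_s+I(s,u)\bigr)\Bigr)du,\qquad V(s,t):=\int_s^tK^2(u,t)\,du .$$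
   Context: All processes live on a filtered probability space $(\Omega,\mathbb{F},\mathcal{F}_t,\mathbb{Q})$, with $W$ a Brownian motion for the filtration and $\lambda_s$ being $\mathcal{F}_s$-measurable. For $u\ge s$, $G(u,s)$ is understood with the usual convention for oriented integrals, i.e. $G(u,s)=e^{-\int_u^s\beta(v)dv}=e^{\int_s^u\beta(v)dv}=1/G(s,u)$. A normal distribution with zero variance is a point mass. The assumption that existence and uniqueness conditions are met includes that the stochastic integrals with respect to $W$ appearing in the equation are well defined. *)

theory Defs
  imports "HOL-Probability.Probability"
begin

text \<open>Time is \<open>[0, \<infinity>)\<close>; the values of \<open>F\<close> and of processes at negative indices are irrelevant.
  Neither completeness nor right-continuity of the filtration is required.\<close>

locale filtered_prob_space = prob_space M for M :: "'a measure" +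
  fixes F :: "real \<Rightarrow> 'a measure"
  assumes subalgebra_F: "0 \<le> t \<Longrightarrow> subalgebra M (F t)"
    and F_mono: "0 \<le> s \<Longrightarrow> s \<le> t \<Longrightarrow> subalgebra (F t) (F s)"

locale brownian_motion = filtered_prob_space M F for M :: "'a measure" and F +
  fixes W :: "real \<Rightarrow> 'a \<Rightarrow> real"
  assumes adapted: "0 \<le> t \<Longrightarrow> W t \<in> borel_measurable (F t)"
    and start: "AE \<omega> in M. W 0 \<omega> = 0"
    and continuous_paths: "AE \<omega> in M. continuous_on {0..} (\<lambda>t. W t \<omega>)"
    and normal_increments: "0 \<le> s \<Longrightarrow> s < t \<Longrightarrow>
      distributed M lborel (\<lambda>\<omega>. W t \<omega> - W s \<omega>) (\<lambda>x. ennreal (normal_density 0 (sqrt (t - s)) x))"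
    and indep_increments: "0 \<le> s \<Longrightarrow> s < t \<Longrightarrow>
      indep_set (sets (F s)) {(\<lambda>\<omega>. W t \<omega> - W s \<omega>) -` B \<inter> space M |B. B \<in> sets borel}"

text \<open>An elementary process on \<open>[s, t]\<close> is
  \<open>\<Sum>i<n. \<xi> i * indicator {\<tau> i<..\<tau> (i + 1)}\<close> with \<open>s = \<tau> 0 \<le> \<dots> \<le> \<tau> n = t\<close> and each \<open>\<xi> i\<close> bounded
  and \<open>F (\<tau> i)\<close>-measurable.\<close>

definition elementary :: "(real \<Rightarrow> 'a measure) \<Rightarrow> real \<Rightarrow> real \<Rightarrow>
    nat \<Rightarrow> (nat \<Rightarrow> real) \<Rightarrow> (nat \<Rightarrow> 'a \<Rightarrow> real) \<Rightarrow> bool" where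
  "elementary F s t n \<tau> \<xi> \<longleftrightarrow>
     \<tau> 0 = s \<and> \<tau> n = t \<and> (\<forall>i<n. \<tau> i \<le> \<tau> (Suc i)) \<and>
     (\<forall>i<n. \<xi> i \<in> borel_measurable (F (\<tau> i)) \<and>
            (\<exists>C. \<forall>\<omega>\<in>space (F (\<tau> i)). \<bar>\<xi> i \<omega>\<bar> \<le> C))"

definition elementary_process :: "nat \<Rightarrow> (nat \<Rightarrow> real) \<Rightarrow> (nat \<Rightarrow> 'a \<Rightarrow> real) \<Rightarrow>
    real \<Rightarrow> 'a \<Rightarrow> real" where
  "elementary_process n \<tau> \<xi> u \<omega> = (\<Sum>i<n. \<xi> i \<omega> * indicat_real {\<tau> i<..\<tau> (Suc i)} u)"

definition elementary_integral :: "(real \<Rightarrow> 'a \<Rightarrow> real) \<Rightarrow>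
    nat \<Rightarrow> (nat \<Rightarrow> real) \<Rightarrow> (nat \<Rightarrow> 'a \<Rightarrow> real) \<Rightarrow> 'a \<Rightarrow> real" where
  "elementary_integral W n \<tau> \<xi> \<omega> = (\<Sum>i<n. \<xi> i \<omega> * (W (\<tau> (Suc i)) \<omega> - W (\<tau> i) \<omega>))"

text \<open>\<open>Y\<close> is a version of the Ito integral \<open>\<integral>_s^t X_u dW_u\<close>: the integrands are approximated by
  elementary processes in \<open>L2(du \<otimes> M)\<close>, and \<open>Y\<close> is the \<open>L2(M)\<close> limit of their integrals.  Such a
  \<open>Y\<close> is determined up to null sets by \<open>X\<close>.\<close>

definition has_ito_integral :: "'a measure \<Rightarrow> (real \<Rightarrow> 'a measure) \<Rightarrow> (real \<Rightarrow> 'a \<Rightarrow> real) \<Rightarrow>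
    real \<Rightarrow> real \<Rightarrow> (real \<Rightarrow> 'a \<Rightarrow> real) \<Rightarrow> ('a \<Rightarrow> real) \<Rightarrow> bool" where
  "has_ito_integral M F W s t X Y \<longleftrightarrow>
     (\<lambda>(u, \<omega>). X u \<omega>) \<in> borel_measurable (restrict_space lborel {s..t} \<Otimes>\<^sub>M M) \<and>
     Y \<in> borel_measurable M \<and>
     (\<exists>n \<tau> \<xi>. (\<forall>k. elementary F s t (n k) (\<tau> k) (\<xi> k)) \<and>
       (\<lambda>k. \<integral>\<^sup>+\<omega>. (\<integral>\<^sup>+u\<in>{s..t}. ennreal ((elementary_process (n k) (\<tau> k) (\<xi> k) u \<omega> - X u \<omega>)\<^sup>2) \<partial>lborel) \<partial>M)
         \<longlonglongrightarrow> 0 \<and>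
       (\<lambda>k. \<integral>\<^sup>+\<omega>. ennreal ((elementary_integral W (n k) (\<tau> k) (\<xi> k) \<omega> - Y \<omega>)\<^sup>2) \<partial>M)
         \<longlonglongrightarrow> 0)"

definition ito_integrable :: "'a measure \<Rightarrow> (real \<Rightarrow> 'a measure) \<Rightarrow> (real \<Rightarrow> 'a \<Rightarrow> real) \<Rightarrow>
    real \<Rightarrow> real \<Rightarrow> (real \<Rightarrow> 'a \<Rightarrow> real) \<Rightarrow> bool" where
  "ito_integrable M F W s t X \<longleftrightarrow> (\<exists>Y. has_ito_integral M F W s t X Y)"

definition ito_integral :: "'a measure \<Rightarrow> (real \<Rightarrow> 'a measure) \<Rightarrow> (real \<Rightarrow> 'a \<Rightarrow> real) \<Rightarrow>
    real \<Rightarrow> real \<Rightarrow> (real \<Rightarrow> 'a \<Rightarrow> real) \<Rightarrow> 'a \<Rightarrow> real" where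
  "ito_integral M F W s t X = (SOME Y. has_ito_integral M F W s t X Y)"

text \<open>A strong solution, started at time \<open>s\<close>, on the given filtered space and for the given Brownian
  motion: a continuous adapted process satisfying the integral equation.  As \<open>ito_integral\<close> is only
  determined up to null sets, the equation is required almost surely for each \<open>t\<close>.
  The initial condition is \<open>lam s\<close>, which is \<open>F s\<close>-measurable by adaptedness and otherwise arbitrary.\<close>

definition strong_solution :: "'a measure \<Rightarrow> (real \<Rightarrow> 'a measure) \<Rightarrow> (real \<Rightarrow> 'a \<Rightarrow> real) \<Rightarrow>
    (real \<Rightarrow> real) \<Rightarrow> (real \<Rightarrow> real) \<Rightarrow> (real \<Rightarrow> real) \<Rightarrow> real \<Rightarrow> (real \<Rightarrow> 'a \<Rightarrow> real) \<Rightarrow> bool" where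
  "strong_solution M F W \<alpha> \<beta> \<sigma> s lam \<longleftrightarrow>
     (\<forall>t\<ge>s. lam t \<in> borel_measurable (F t)) \<and>
     (\<forall>\<omega>\<in>space M. continuous_on {s..} (\<lambda>t. lam t \<omega>)) \<and>
     (\<forall>t\<ge>s. ito_integrable M F W s t (\<lambda>u _. \<sigma> u) \<and>
       (AE \<omega> in M. interval_lebesgue_integrable lborel s t (\<lambda>u. \<alpha> u - \<beta> u * lam u \<omega>) \<and>
         lam t \<omega> = lam s \<omega> + (LBINT u=s..t. \<alpha> u - \<beta> u * lam u \<omega>)
                   + ito_integral M F W s t (\<lambda>u _. \<sigma> u) \<omega>))"

text \<open>The interval integral is oriented, so \<open>sde_G \<beta> u s = 1 / sde_G \<beta> s u\<close>.\<close>

definition sde_G :: "(real \<Rightarrow> real) \<Rightarrow> real \<Rightarrow> real \<Rightarrow> real" where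
  "sde_G \<beta> s t = exp (- (LBINT u=s..t. \<beta> u))"

definition sde_I :: "(real \<Rightarrow> real) \<Rightarrow> (real \<Rightarrow> real) \<Rightarrow> real \<Rightarrow> real \<Rightarrow> real" where
  "sde_I \<alpha> \<beta> s t = (LBINT u=s..t. \<alpha> u * sde_G \<beta> u s)"

definition sde_J :: "'a measure \<Rightarrow> (real \<Rightarrow> 'a measure) \<Rightarrow> (real \<Rightarrow> 'a \<Rightarrow> real) \<Rightarrow>
    (real \<Rightarrow> real) \<Rightarrow> (real \<Rightarrow> real) \<Rightarrow> real \<Rightarrow> real \<Rightarrow> 'a \<Rightarrow> real" where
  "sde_J M F W \<beta> \<sigma> s t = ito_integral M F W s t (\<lambda>u _. \<sigma> u * sde_G \<beta> u s)"

definition sde_K :: "(real \<Rightarrow> real) \<Rightarrow> (real \<Rightarrow> real) \<Rightarrow> real \<Rightarrow> real \<Rightarrow> real" where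
  "sde_K \<beta> \<sigma> s t = (LBINT u=s..t. \<sigma> s * sde_G \<beta> s u)"

text \<open>The conditional means are functions of the value \<open>x\<close> of the initial condition.\<close>

definition sde_m :: "(real \<Rightarrow> real) \<Rightarrow> (real \<Rightarrow> real) \<Rightarrow> real \<Rightarrow> real \<Rightarrow> real \<Rightarrow> real" where
  "sde_m \<alpha> \<beta> s t x = sde_G \<beta> s t * (x + sde_I \<alpha> \<beta> s t)"

definition sde_v :: "(real \<Rightarrow> real) \<Rightarrow> (real \<Rightarrow> real) \<Rightarrow> real \<Rightarrow> real \<Rightarrow> real" where
  "sde_v \<beta> \<sigma> s t = (sde_G \<beta> s t)\<^sup>2 * (LBINT u=s..t. (\<sigma> u)\<^sup>2 * (sde_G \<beta> u s)\<^sup>2)"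

definition sde_M :: "(real \<Rightarrow> real) \<Rightarrow> (real \<Rightarrow> real) \<Rightarrow> real \<Rightarrow> real \<Rightarrow> real \<Rightarrow> real" where
  "sde_M \<alpha> \<beta> s t x = (t - s) * x
     + (LBINT u=s..t. (t - u) * (\<alpha> u - \<beta> u * sde_G \<beta> s u * (x + sde_I \<alpha> \<beta> s u)))"

definition sde_V :: "(real \<Rightarrow> real) \<Rightarrow> (real \<Rightarrow> real) \<Rightarrow> real \<Rightarrow> real \<Rightarrow> real" where
  "sde_V \<beta> \<sigma> s t = (LBINT u=s..t. (sde_K \<beta> \<sigma> u t)\<^sup>2)"

text \<open>The second parameter is the variance; \<open>normal_density\<close> takes the standard deviation.\<close>

definition normal_law :: "real \<Rightarrow> real \<Rightarrow> real measure" where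
  "normal_law \<mu> v =
     (if v = 0 then return borel \<mu> else density lborel (\<lambda>x. ennreal (normal_density \<mu> (sqrt v) x)))"

text \<open>The probability kernel \<open>\<kappa>\<close> is a regular conditional distribution of \<open>Z\<close> given \<open>X\<close>.\<close>

definition cond_law :: "'a measure \<Rightarrow> ('a \<Rightarrow> real) \<Rightarrow> ('a \<Rightarrow> real) \<Rightarrow> (real \<Rightarrow> real measure) \<Rightarrow> bool" where
  "cond_law M X Z \<kappa> \<longleftrightarrow>
     X \<in> borel_measurable M \<and> Z \<in> borel_measurable M \<and> \<kappa> \<in> borel \<rightarrow>\<^sub>M prob_algebra borel \<and>
     (\<forall>B\<in>sets borel. AE \<omega> in M.
        real_cond_exp M (vimage_algebra (space M) X borel) (indicat_real (Z -` B \<inter> space M)) \<omega>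
          = measure (\<kappa> (X \<omega>)) B)"

end

theory Submission
  imports Defs
begin

text \<open>Ito integrals of deterministic functions form a Hilbert space isometric to \<open>L2\<close> of the time
  interval, so every identity between them can be checked by computing inner products.  Pathwise,
  \<open>N t = lam t - lam s - \<integral>(\<alpha> - \<beta> lam) du\<close> is a continuous version of \<open>\<integral> \<sigma> dW\<close>.  Since \<open>lam - N\<close>
  is absolutely continuous, the integrating factor \<open>1 / G(s, u)\<close> applies to it without any Ito
  calculus and expresses \<open>lam t\<close> through \<open>N t\<close> and \<open>\<integral> g N du\<close> with a deterministic \<open>g\<close>.  A stochastic
  Fubini theorem, which is again an inner product computation, rewrites such integrals as Ito
  integrals; it is used once for \<open>lam t\<close> and once more for \<open>\<integral> lam du\<close>.  The law follows from the
  characteristic function of step integrals restricted to events of \<open>F s\<close>.\<close>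

section \<open>Square-integrable functions\<close>

text \<open>Two obstacles shape the proof. \<open>has_ito_integral\<close> leaves the approximating
  elementary processes open, so even the integral of a deterministic function may be witnessed by
  random coefficients. The isometry is therefore proved for random elementary processes, while the
  law is computed on a version built from step functions and carried over by uniqueness. Moreover,
  \<open>ito_integral\<close> picks an arbitrary version for each time: nothing makes it jointly
  measurable in time and \<omega>, and the null set in \<open>strong_solution\<close> depends on the
  time. Fubini needs joint measurability, and the noise read off the continuous paths of
  \<open>lam\<close> has it. The coefficients \<alpha> and \<beta> are merely integrable, so 1 /
  G(s, u) = \<open>sde_G \<beta> u s\<close> need not be differentiable everywhere; its product rule
  comes from Fubini and the exponential from its power series. The weight g is \<beta> u / G(s, u)
  in the first use of stochastic Fubini and 1 in the second. Arbitrary events of \<open>F s\<close>,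
  rather than the whole space alone, are what yields the joint law with \<open>lam s\<close> and
  thus a conditional statement.\<close>

lemmas lint_cong = Bochner_Integration.integral_cong
lemmas lint_add = Bochner_Integration.integral_add
lemmas lint_diff = Bochner_Integration.integral_diff
lemmas lint_sum = Bochner_Integration.integral_sum
lemmas lintegrable_add = Bochner_Integration.integrable_add
lemmas lintegrable_diff = Bochner_Integration.integrable_diff
lemmas lintegrable_bound = Bochner_Integration.integrable_bound
lemmas lintegrable_cong = Bochner_Integration.integrable_cong

text \<open>Measurability is listed separately because it does not follow from integrability of the
  square.\<close>

definition in_L2 :: "'b measure \<Rightarrow> ('b \<Rightarrow> real) \<Rightarrow> bool" where
  "in_L2 M f \<longleftrightarrow> f \<in> borel_measurable M \<and> integrable M (\<lambda>x. (f x)^2)"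

lemma in_L2D:
  assumes "in_L2 M f"
  shows in_L2_measurable: "f \<in> borel_measurable M"
    and in_L2_square: "integrable M (\<lambda>x. (f x)^2)"
  using assms by (auto simp: in_L2_def)

lemma abs_mult_le_sum_squares: "\<bar>a * b\<bar> \<le> a^2 + b^2" for a b :: real
proof -
  have "2 * \<bar>a\<bar> * \<bar>b\<bar> \<le> \<bar>a\<bar>^2 + \<bar>b\<bar>^2"
    by (rule sum_squares_bound)
  moreover have "0 \<le> \<bar>a\<bar> * \<bar>b\<bar>" by simp
  ultimately show ?thesis unfolding abs_mult power2_abs by linarith
qed

lemma in_L2_mult:
  assumes "in_L2 M f" "in_L2 M g"
  shows "integrable M (\<lambda>x. f x * g x)"
proof (rule lintegrable_bound)
  show "integrable M (\<lambda>x. (f x)^2 + (g x)^2)"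
    using assms by (auto simp: in_L2_def)
  show "(\<lambda>x. f x * g x) \<in> borel_measurable M"
    using assms by (auto simp: in_L2_def)
  show "AE x in M. norm (f x * g x) \<le> norm ((f x)^2 + (g x)^2)"
    using abs_mult_le_sum_squares by (intro AE_I2) simp
qed

lemma in_L2_cmult:
  assumes "in_L2 M f"
  shows "in_L2 M (\<lambda>x. c * f x)"
  using assms by (auto simp: in_L2_def power_mult_distrib)

lemma in_L2_add:
  assumes "in_L2 M f" "in_L2 M g"
  shows "in_L2 M (\<lambda>x. f x + g x)"
proof -
  have "integrable M (\<lambda>x. (f x)^2 + (g x)^2 + 2 * (f x * g x))"
    using assms in_L2_mult[OF assms]
    by (auto simp: in_L2_def simp del: integrable_mult_right_iff)
  then show ?thesis
    using assms by (auto simp: in_L2_def power2_sum mult.assoc)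
qed

lemma in_L2_diff:
  assumes "in_L2 M f" "in_L2 M g"
  shows "in_L2 M (\<lambda>x. f x - g x)"
  using in_L2_add[OF assms(1) in_L2_cmult[OF assms(2), of "-1"]] by simp

lemma in_L2_bounded:
  assumes "finite_measure M" "f \<in> borel_measurable M" "\<And>x. x \<in> space M \<Longrightarrow> \<bar>f x\<bar> \<le> C"
  shows "in_L2 M f"
proof -
  interpret finite_measure M by fact
  have "\<And>x. x \<in> space M \<Longrightarrow> norm ((f x)^2) \<le> C^2"
    using assms(3) by (metis abs_ge_zero power2_abs power_mono real_norm_def abs_power2)
  then show ?thesis
    unfolding in_L2_def using assms(2)
    by (auto intro!: integrable_const_bound[where B="C^2"])
qed

lemma in_L2_nn_finite:
  assumes "f \<in> borel_measurable M" "(\<integral>\<^sup>+x. ennreal ((f x)^2) \<partial>M) < \<infinity>"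
  shows "in_L2 M f"
  using assms by (auto simp: in_L2_def integrable_iff_bounded)

lemma in_L2_nn_eq:
  assumes "in_L2 M f"
  shows "(\<integral>\<^sup>+x. ennreal ((f x)^2) \<partial>M) = ennreal (\<integral>x. (f x)^2 \<partial>M)"
  using assms by (intro nn_integral_eq_integral) (auto simp: in_L2_def)

text \<open>Transferred from the inequality for nonnegative integrals, applied to \<bar>f\<bar> and
  \<bar>g\<bar>; square integrability makes every term finite.\<close>

lemma Cauchy_Schwarz_integral:
  assumes f: "in_L2 M f" and g: "in_L2 M g"
  shows "\<bar>\<integral>x. f x * g x \<partial>M\<bar> \<le> sqrt (\<integral>x. (f x)^2 \<partial>M) * sqrt (\<integral>x. (g x)^2 \<partial>M)"
proof -
  have [measurable]: "f \<in> borel_measurable M" "g \<in> borel_measurable M"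
    using assms by (auto simp: in_L2_def)
  have i: "integrable M (\<lambda>x. \<bar>f x * g x\<bar>)"
    using in_L2_mult[OF assms] by simp
  have "ennreal ((\<integral>x. \<bar>f x * g x\<bar> \<partial>M)^2) = (\<integral>\<^sup>+x. ennreal \<bar>f x\<bar> * ennreal \<bar>g x\<bar> \<partial>M)^2"
    using i by (subst ennreal_power[symmetric])
      (auto simp: nn_integral_eq_integral[symmetric] ennreal_mult[symmetric] abs_mult)
  also have "\<dots> \<le> (\<integral>\<^sup>+x. (ennreal \<bar>f x\<bar>)^2 \<partial>M) * (\<integral>\<^sup>+x. (ennreal \<bar>g x\<bar>)^2 \<partial>M)"
    by (rule Cauchy_Schwarz_nn_integral) auto
  also have "\<dots> = ennreal ((\<integral>x. (f x)^2 \<partial>M) * (\<integral>x. (g x)^2 \<partial>M))"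
    by (simp add: ennreal_power in_L2_nn_eq[OF f] in_L2_nn_eq[OF g] ennreal_mult)
  finally have "(\<integral>x. \<bar>f x * g x\<bar> \<partial>M)^2 \<le> (\<integral>x. (f x)^2 \<partial>M) * (\<integral>x. (g x)^2 \<partial>M)"
    by (subst (asm) ennreal_le_iff) auto
  then have "(\<integral>x. \<bar>f x * g x\<bar> \<partial>M) \<le> sqrt ((\<integral>x. (f x)^2 \<partial>M) * (\<integral>x. (g x)^2 \<partial>M))"
    by (rule real_le_rsqrt)
  moreover have "\<bar>\<integral>x. f x * g x \<partial>M\<bar> \<le> (\<integral>x. \<bar>f x * g x\<bar> \<partial>M)"
    by (rule integral_abs_bound)
  ultimately show ?thesis unfolding real_sqrt_mult by (rule order_trans[rotated])
qed

text \<open>A nonnegative integral keeps its meaning when the square is not integrable, where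
  \<open>integral\<close> would be 0; so the convergence can be assumed before \<open>A\<close> is
  known to be in L2.\<close>

abbreviation L2_lim :: "'b measure \<Rightarrow> (nat \<Rightarrow> 'b \<Rightarrow> real) \<Rightarrow> ('b \<Rightarrow> real) \<Rightarrow> bool" where
  "L2_lim M a A \<equiv> (\<lambda>n. \<integral>\<^sup>+x. ennreal ((a n x - A x)^2) \<partial>M) \<longlonglongrightarrow> 0"

text \<open>Some distance is below 1, hence finite, so \<open>A\<close> is the difference of
  \<open>a n\<close> and \<open>a n - A\<close>, both square integrable.\<close>

lemma L2_limit:
  assumes a: "\<And>n. in_L2 M (a n)" and A: "A \<in> borel_measurable M"
    and lim: "L2_lim M a A"
  shows L2_limit_in_L2: "in_L2 M A"
    and L2_limit_tendsto: "(\<lambda>n. \<integral>x. (a n x - A x)^2 \<partial>M) \<longlonglongrightarrow> 0"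
proof -
  have "\<forall>\<^sub>F n in sequentially. (\<integral>\<^sup>+x. ennreal ((a n x - A x)^2) \<partial>M) < 1"
    using lim by (rule order_tendstoD) simp
  then obtain n where n: "(\<integral>\<^sup>+x. ennreal ((a n x - A x)^2) \<partial>M) < 1"
    by (auto simp: eventually_sequentially)
  have "in_L2 M (\<lambda>x. a n x - A x)"
    using a[of n] A n by (intro in_L2_nn_finite)
      (auto simp: in_L2_def intro: less_trans)
  from in_L2_diff[OF a[of n] this] show sA: "in_L2 M A"
    by simp
  have "ennreal (\<integral>x. (a n x - A x)^2 \<partial>M) = (\<integral>\<^sup>+x. ennreal ((a n x - A x)^2) \<partial>M)" for n
    by (rule in_L2_nn_eq[symmetric], rule in_L2_diff[OF a sA])
  then have "(\<lambda>n. ennreal (\<integral>x. (a n x - A x)^2 \<partial>M)) \<longlonglongrightarrow> ennreal 0"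
    using lim by simp
  then show "(\<lambda>n. \<integral>x. (a n x - A x)^2 \<partial>M) \<longlonglongrightarrow> 0"
    by (subst (asm) tendsto_ennreal_iff) auto
qed

text \<open>Continuity of the inner product, from a b - A B = (a - A)(b - B) + (a - A) B + A (b - B)
  and Cauchy-Schwarz for each term. It carries the isometry from elementary integrals to their
  limits.\<close>

lemma L2_limit_mult:
  assumes a: "\<And>n. in_L2 M (a n)" and A: "A \<in> borel_measurable M"
    and alim: "L2_lim M a A"
  assumes b: "\<And>n. in_L2 M (b n)" and B: "B \<in> borel_measurable M"
    and blim: "L2_lim M b B"
  shows "(\<lambda>n. \<integral>x. a n x * b n x \<partial>M) \<longlonglongrightarrow> (\<integral>x. A x * B x \<partial>M)"
proof -
  note sA = L2_limit_in_L2[OF a A alim] and sB = L2_limit_in_L2[OF b B blim]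
  note ta = L2_limit_tendsto[OF a A alim] and tb = L2_limit_tendsto[OF b B blim]
  note da = in_L2_diff[OF a sA] and db = in_L2_diff[OF b sB]
  have sqa: "(\<lambda>n. sqrt (\<integral>x. (a n x - A x)^2 \<partial>M)) \<longlonglongrightarrow> 0"
    and sqb: "(\<lambda>n. sqrt (\<integral>x. (b n x - B x)^2 \<partial>M)) \<longlonglongrightarrow> 0"
    using tendsto_real_sqrt[OF ta] tendsto_real_sqrt[OF tb] by simp_all
  have "(\<lambda>n. \<integral>x. (a n x - A x) * (b n x - B x) \<partial>M) \<longlonglongrightarrow> 0"
    by (rule Lim_null_comparison[OF always_eventually[OF allI] tendsto_mult_zero[OF sqa sqb]])
      (unfold real_norm_def, rule Cauchy_Schwarz_integral[OF da db])
  moreover have "(\<lambda>n. \<integral>x. (a n x - A x) * B x \<partial>M) \<longlonglongrightarrow> 0"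
    by (rule Lim_null_comparison[OF always_eventually[OF allI] tendsto_mult_left_zero[OF sqa]])
      (unfold real_norm_def, rule Cauchy_Schwarz_integral[OF da sB])
  moreover have "(\<lambda>n. \<integral>x. A x * (b n x - B x) \<partial>M) \<longlonglongrightarrow> 0"
    by (rule Lim_null_comparison[OF always_eventually[OF allI] tendsto_mult_right_zero[OF sqb]])
      (unfold real_norm_def, rule Cauchy_Schwarz_integral[OF sA db])
  ultimately have "(\<lambda>n. (\<integral>x. (a n x - A x) * (b n x - B x) \<partial>M) + (\<integral>x. (a n x - A x) * B x \<partial>M)
      + (\<integral>x. A x * (b n x - B x) \<partial>M) + (\<integral>x. A x * B x \<partial>M)) \<longlonglongrightarrow> 0 + 0 + 0 + (\<integral>x. A x * B x \<partial>M)"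
    by (intro tendsto_add tendsto_const)
  moreover have "(\<integral>x. (a n x - A x) * (b n x - B x) \<partial>M) + (\<integral>x. (a n x - A x) * B x \<partial>M)
      + (\<integral>x. A x * (b n x - B x) \<partial>M) + (\<integral>x. A x * B x \<partial>M) = (\<integral>x. a n x * b n x \<partial>M)" for n
  proof -
    have 1: "integrable M (\<lambda>x. (a n x - A x) * (b n x - B x))" "integrable M (\<lambda>x. (a n x - A x) * B x)"
      "integrable M (\<lambda>x. A x * (b n x - B x))" "integrable M (\<lambda>x. A x * B x)"
      using in_L2_mult[OF da db] in_L2_mult[OF da sB]
        in_L2_mult[OF sA db] in_L2_mult[OF sA sB] by auto
    have "(\<integral>x. a n x * b n x \<partial>M)
        = (\<integral>x. ((a n x - A x) * (b n x - B x) + (a n x - A x) * B x) + A x * (b n x - B x) + A x * B x \<partial>M)"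
      by (intro lint_cong) (auto simp: algebra_simps)
    also have "\<dots> = (\<integral>x. (a n x - A x) * (b n x - B x) \<partial>M) + (\<integral>x. (a n x - A x) * B x \<partial>M)
      + (\<integral>x. A x * (b n x - B x) \<partial>M) + (\<integral>x. A x * B x \<partial>M)"
      by (simp only: 1 lint_add lintegrable_add)
    finally show ?thesis by simp
  qed
  ultimately show ?thesis by simp
qed

text \<open>Cauchy-Schwarz against the constant 1, which has norm 1 in a probability space.\<close>

lemma (in prob_space) L1_le_L2:
  assumes "in_L2 M f"
  shows "integrable M f" "(\<integral>x. \<bar>f x\<bar> \<partial>M) \<le> sqrt (\<integral>x. (f x)^2 \<partial>M)"
proof -
  show "integrable M f"
    by (rule square_integrable_imp_integrable) (use assms in \<open>simp_all add: in_L2_def\<close>)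
  have "in_L2 M (\<lambda>x. \<bar>f x\<bar>)"
    using assms by (auto simp: in_L2_def)
  moreover have "in_L2 M (\<lambda>_. 1)"
    by (simp add: in_L2_def)
  ultimately have "\<bar>\<integral>x. \<bar>f x\<bar> * 1 \<partial>M\<bar> \<le> sqrt (\<integral>x. \<bar>f x\<bar>^2 \<partial>M) * sqrt (\<integral>x. 1^2 \<partial>M)"
    by (rule Cauchy_Schwarz_integral)
  then show "(\<integral>x. \<bar>f x\<bar> \<partial>M) \<le> sqrt (\<integral>x. (f x)^2 \<partial>M)"
    by (simp add: prob_space)
qed

text \<open>The Riesz-Fischer argument: an L2 Cauchy sequence is L1 Cauchy, an almost everywhere
  convergent subsequence supplies the limit, and Fatou's lemma upgrades this to L2 convergence of
  the full sequence.\<close>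

lemma (in prob_space) L2_complete:
  fixes a :: "nat \<Rightarrow> 'a \<Rightarrow> real"
  assumes a: "\<And>n. in_L2 M (a n)"
    and cau: "\<And>e. 0 < e \<Longrightarrow> \<exists>N. \<forall>i\<ge>N. \<forall>j\<ge>N. (\<integral>x. (a i x - a j x)^2 \<partial>M) \<le> e"
  obtains A where "A \<in> borel_measurable M" "L2_lim M a A"
proof -
  have [measurable]: "a n \<in> borel_measurable M" for n
    using a by (auto simp: in_L2_def)
  have "\<exists>N. \<forall>i\<ge>N. \<forall>j\<ge>N. (\<integral>x. norm (a i x - a j x) \<partial>M) < e" if "0 < e" for e
  proof -
    \<comment> \<open>The square becomes e/2 under the root, which is strictly below e.\<close>
    obtain N where N: "\<And>i j. i \<ge> N \<Longrightarrow> j \<ge> N \<Longrightarrow> (\<integral>x. (a i x - a j x)^2 \<partial>M) \<le> (e/2)^2"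
      using cau[of "(e/2)^2"] \<open>0 < e\<close> by auto
    have "(\<integral>x. \<bar>a i x - a j x\<bar> \<partial>M) < e" if "i \<ge> N" "j \<ge> N" for i j
    proof -
      have "(\<integral>x. \<bar>a i x - a j x\<bar> \<partial>M) \<le> sqrt (\<integral>x. (a i x - a j x)^2 \<partial>M)"
        by (rule L1_le_L2(2)[OF in_L2_diff[OF a a]])
      also have "\<dots> \<le> e/2"
        using N[OF that] \<open>0 < e\<close> by (intro real_le_lsqrt) auto
      finally show ?thesis using \<open>0 < e\<close> by simp
    qed
    then show ?thesis by auto
  qed
  from cauchy_L1_AE_cauchy_subseq[OF L1_le_L2(1)[OF a] this]
  obtain r where r: "strict_mono r" "AE x in M. Cauchy (\<lambda>i. a (r i) x)" by blast
  define A where "A x = (if Cauchy (\<lambda>i. a (r i) x) then lim (\<lambda>i. a (r i) x) else 0)" for x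
  have A[measurable]: "A \<in> borel_measurable M"
    unfolding A_def by measurable
  have lim: "AE x in M. (\<lambda>i. a (r i) x) \<longlonglongrightarrow> A x"
    using r(2) by eventually_elim (auto simp: A_def Cauchy_convergent_iff convergent_LIMSEQ_iff)
  have "L2_lim M a A"
  proof (rule tendsto_0_if_Limsup_eq_0_ennreal, rule antisym)
    show "Limsup sequentially (\<lambda>n. \<integral>\<^sup>+x. ennreal ((a n x - A x)^2) \<partial>M) \<le> 0"
    proof (rule ennreal_le_epsilon)
      fix e :: real assume "0 < e"
      then obtain N where N: "\<And>i j. i \<ge> N \<Longrightarrow> j \<ge> N \<Longrightarrow> (\<integral>x. (a i x - a j x)^2 \<partial>M) \<le> e"
        using cau by blast
      have "(\<integral>\<^sup>+x. ennreal ((a n x - A x)^2) \<partial>M) \<le> ennreal e" if "n \<ge> N" for n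
      proof -
        have "(\<integral>\<^sup>+x. ennreal ((a n x - A x)^2) \<partial>M)
            = (\<integral>\<^sup>+x. liminf (\<lambda>i. ennreal ((a n x - a (r i) x)^2)) \<partial>M)"
        proof (rule nn_integral_cong_AE, use lim in eventually_elim)
          case (elim x)
          have "(\<lambda>i. ennreal ((a n x - a (r i) x)^2)) \<longlonglongrightarrow> ennreal ((a n x - A x)^2)"
            by (intro tendsto_intros elim)
          from lim_imp_Liminf[OF _ this] show ?case by simp
        qed
        \<comment> \<open>Fatou: \<open>n\<close> stays fixed while the second index runs to
          infinity along the subsequence.\<close>
        also have "\<dots> \<le> liminf (\<lambda>i. \<integral>\<^sup>+x. ennreal ((a n x - a (r i) x)^2) \<partial>M)"
          by (rule nn_integral_liminf) simp
        also have "\<dots> \<le> limsup (\<lambda>i. \<integral>\<^sup>+x. ennreal ((a n x - a (r i) x)^2) \<partial>M)"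
          by (rule Liminf_le_Limsup) simp
        also have "\<dots> \<le> ennreal e"
        proof (rule Limsup_bounded, rule eventually_sequentiallyI[of N])
          fix i assume "N \<le> i"
          then have "N \<le> r i" using seq_suble[OF r(1), of i] by simp
          then show "(\<integral>\<^sup>+x. ennreal ((a n x - a (r i) x)^2) \<partial>M) \<le> ennreal e"
            using N[OF that, of "r i"]
            by (simp add: in_L2_nn_eq[OF in_L2_diff[OF a a]] ennreal_leI)
        qed
        finally show ?thesis .
      qed
      then show "Limsup sequentially (\<lambda>n. \<integral>\<^sup>+x. ennreal ((a n x - A x)^2) \<partial>M) \<le> 0 + ennreal e"
        by (auto intro!: Limsup_bounded eventually_sequentiallyI[of N])
    qed
  qed simp
  with A show thesis by (rule that)
qed

section \<open>Increments of Brownian motion and the isometry for elementary processes\<close>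

text \<open>Lebesgue measure on [s, t] as a measure space of its own, the first factor in
  \<open>has_ito_integral\<close>; it is finite, and the zero measure when t < s.\<close>

abbreviation leb_Icc :: "real \<Rightarrow> real \<Rightarrow> real measure" where
  "leb_Icc s t \<equiv> restrict_space lborel {s..t}"

lemma finite_measure_leb_Icc: "finite_measure (leb_Icc s t)"
  by (rule finite_measureI) (auto simp: space_restrict_space emeasure_restrict_space emeasure_lborel_Icc_eq)

lemma measurable_leb_Icc: "f \<in> borel_measurable borel \<Longrightarrow> f \<in> borel_measurable (leb_Icc s t)"
  by (rule measurable_restrict_space1) simp

lemma in_L2_bounded_mult:
  assumes g: "in_L2 M g" and [measurable]: "f \<in> borel_measurable M"
    and bound: "\<And>x. x \<in> space M \<Longrightarrow> \<bar>f x\<bar> \<le> C"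
  shows "in_L2 M (\<lambda>x. f x * g x)"
  unfolding in_L2_def
proof
  have [measurable]: "g \<in> borel_measurable M"
    using g by (rule in_L2_measurable)
  show "(\<lambda>x. f x * g x) \<in> borel_measurable M" by simp
  show "integrable M (\<lambda>x. (f x * g x)^2)"
  proof (rule lintegrable_bound)
    show "integrable M (\<lambda>x. C^2 * (g x)^2)"
      using in_L2_square[OF g] by simp
    have "(f x)^2 \<le> C^2" if "x \<in> space M" for x
      using bound[OF that] by (metis abs_ge_zero power2_abs power_mono)
    then show "AE x in M. norm ((f x * g x)^2) \<le> norm (C^2 * (g x)^2)"
      by (intro AE_I2) (simp add: power_mult_distrib mult_right_mono)
  qed simp
qed

lemma Int_stable_vimage: "Int_stable {f -` A \<inter> S |A. A \<in> sets K}"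
proof (rule Int_stableI, clarify)
  fix A B assume "A \<in> sets K" "B \<in> sets K"
  then show "\<exists>D. f -` A \<inter> S \<inter> (f -` B \<inter> S) = f -` D \<inter> S \<and> D \<in> sets K"
    by (intro exI[of _ "A \<inter> B"]) auto
qed

lemma (in prob_space) in_L2_const: "in_L2 M (\<lambda>_. c)"
  by (simp add: in_L2_def)

lemma (in filtered_prob_space) F_measurable:
  "0 \<le> p \<Longrightarrow> f \<in> measurable (F p) N \<Longrightarrow> f \<in> measurable M N"
  by (rule measurable_from_subalg[OF subalgebra_F])

lemma (in filtered_prob_space) F_measurable_mono:
  "0 \<le> p \<Longrightarrow> p \<le> q \<Longrightarrow> f \<in> measurable (F p) N \<Longrightarrow> f \<in> measurable (F q) N"
  by (rule measurable_from_subalg[OF F_mono])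

lemma (in filtered_prob_space) space_F: "0 \<le> p \<Longrightarrow> space (F p) = space M"
  using subalgebra_F[of p] by (simp add: subalgebra_def)

lemma (in prob_space) indep_set_mono:
  "indep_set A B \<Longrightarrow> A' \<subseteq> A \<Longrightarrow> B' \<subseteq> B \<Longrightarrow> indep_set A' B'"
  unfolding indep_sets2_eq by blast

context brownian_motion
begin

lemma W_measurable: "0 \<le> p \<Longrightarrow> W p \<in> borel_measurable M"
  by (rule F_measurable[OF _ adapted])

lemma W_measurable_F: "0 \<le> p \<Longrightarrow> p \<le> q \<Longrightarrow> W p \<in> borel_measurable (F q)"
  by (rule F_measurable_mono[OF _ _ adapted])

lemma increment_measurable [measurable]:
  "0 \<le> p \<Longrightarrow> p \<le> q \<Longrightarrow> (\<lambda>w. W q w - W p w) \<in> borel_measurable M"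
  using W_measurable[of p] W_measurable[of q] by simp

text \<open>The target spaces \<open>N\<close> and \<open>K\<close> are arbitrary: real values serve
  the second moments, complex values the characteristic functions.\<close>

lemma indep_var_increment:
  assumes p0: "0 \<le> p" and "p < q" and Z: "Z \<in> measurable (F p) N" and g: "g \<in> measurable borel K"
  shows "indep_var N Z K (\<lambda>w. g (W q w - W p w))"
  unfolding indep_var_eq
proof (intro conjI indep_set_sigma_sets Int_stable_vimage)
  show "random_variable N Z"
    using F_measurable[OF p0 Z] .
  show "random_variable K (\<lambda>w. g (W q w - W p w))"
    using assms(1,2) by (intro measurable_compose[OF increment_measurable g]) auto
  have "{Z -` A \<inter> space M |A. A \<in> sets N} \<subseteq> sets (F p)"
    using measurable_sets[OF Z] by (auto simp: space_F[OF p0])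
  then have 1: "{Z -` A \<inter> space M |A. A \<in> sets N} \<subseteq> sets (F p)" .
  have 2: "{(\<lambda>w. g (W q w - W p w)) -` A \<inter> space M |A. A \<in> sets K}
    \<subseteq> {(\<lambda>w. W q w - W p w) -` A \<inter> space M |A. A \<in> sets borel}"
  proof clarify
    fix A assume "A \<in> sets K"
    then have "g -` A \<in> sets borel" using measurable_sets[OF g] by simp
    moreover have "(\<lambda>w. g (W q w - W p w)) -` A \<inter> space M = (\<lambda>w. W q w - W p w) -` (g -` A) \<inter> space M"
      by auto
    ultimately show "\<exists>B. (\<lambda>w. g (W q w - W p w)) -` A \<inter> space M = (\<lambda>w. W q w - W p w) -` B \<inter> space M \<and> B \<in> sets borel"
      by blast
  qed
  show "indep_set {Z -` A \<inter> space M |A. A \<in> sets N}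
     {(\<lambda>w. g (W q w - W p w)) -` A \<inter> space M |A. A \<in> sets K}"
    by (rule indep_set_mono[OF indep_increments[OF assms(1,2)] 1 2])
qed

lemma
  assumes "0 \<le> p" "p \<le> q"
  shows in_L2_increment: "in_L2 M (\<lambda>w. W q w - W p w)"
    and increment_mean: "expectation (\<lambda>w. W q w - W p w) = 0"
    and increment_square: "expectation (\<lambda>w. (W q w - W p w)^2) = q - p"
proof -
  let ?D = "\<lambda>w. W q w - W p w"
  have "in_L2 M ?D \<and> expectation ?D = 0 \<and> expectation (\<lambda>w. (?D w)^2) = q - p"
  \<comment> \<open>\<open>normal_increments\<close> and \<open>indep_increments\<close> speak of s
    < t only, so an empty increment is treated apart.\<close>
  proof (cases "p = q")
    case True
    then show ?thesis by (simp add: in_L2_const)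
  next
    case False
    with assms have lt: "p < q" by simp
    note D = normal_increments[OF assms(1) lt]
    have "integrable M (\<lambda>w. (W q w - W p w)^2)"
      by (subst distributed_integrable[OF D, of "\<lambda>x. x^2", symmetric])
        (use integrable_normal_moment[of "sqrt (q - p)" 0 2] lt in simp_all)
    moreover have m: "expectation (\<lambda>w. W q w - W p w) = 0"
      by (rule normal_distributed_expectation[OF _ D]) (use lt in simp)
    moreover have "expectation (\<lambda>w. (W q w - W p w)^2) = q - p"
      using normal_distributed_variance[OF _ D] lt m by simp
    ultimately show ?thesis
      using assms by (simp add: in_L2_def)
  qed
  then show "in_L2 M ?D" "expectation ?D = 0" "expectation (\<lambda>w. (?D w)^2) = q - p" by auto
qed

text \<open>One factorisation for both moments: \<open>g\<close> is the identity in
  \<open>increment_orthogonal\<close> and the square in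
  \<open>increment_square_factor\<close>.\<close>

lemma increment_factor:
  fixes Z :: "'a \<Rightarrow> real" and g :: "real \<Rightarrow> real"
  assumes "0 \<le> p" "p \<le> q" "Z \<in> borel_measurable (F p)" "integrable M Z"
    and g: "g \<in> borel_measurable borel" "integrable M (\<lambda>w. g (W q w - W p w))"
  shows "integrable M (\<lambda>w. Z w * g (W q w - W p w)) \<and>
    expectation (\<lambda>w. Z w * g (W q w - W p w)) = expectation Z * expectation (\<lambda>w. g (W q w - W p w))"
proof (cases "p = q")
  case True
  with assms show ?thesis by (simp add: prob_space)
next
  case False
  with assms have "p < q" by simp
  from indep_var_increment[OF assms(1) this assms(3) g(1)] show ?thesis
    using indep_var_lebesgue_integral[OF _ assms(4) g(2)] indep_var_integrable[OF _ assms(4) g(2)] by blast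
qed

lemma increment_orthogonal:
  fixes Z :: "'a \<Rightarrow> real"
  assumes "0 \<le> p" "p \<le> q" "Z \<in> borel_measurable (F p)" "integrable M Z"
  shows "integrable M (\<lambda>w. Z w * (W q w - W p w))"
    and "expectation (\<lambda>w. Z w * (W q w - W p w)) = 0"
  using increment_factor[OF assms, of "\<lambda>x. x"] L1_le_L2(1)[OF in_L2_increment[OF assms(1,2)]]
    increment_mean[OF assms(1,2)] by simp_all

lemma increment_square_factor:
  fixes Z :: "'a \<Rightarrow> real"
  assumes "0 \<le> p" "p \<le> q" "Z \<in> borel_measurable (F p)" "integrable M Z"
  shows "integrable M (\<lambda>w. Z w * (W q w - W p w)^2)"
    and "expectation (\<lambda>w. Z w * (W q w - W p w)^2) = expectation Z * (q - p)"
  using increment_factor[OF assms, of "\<lambda>x. x^2"] in_L2_square[OF in_L2_increment[OF assms(1,2)]]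
    increment_square[OF assms(1,2)] by simp_all

lemma bounded_mult_increments_integrable:
  assumes "0 \<le> a" "a \<le> b" "0 \<le> c" "c \<le> d"
    and Z: "Z \<in> borel_measurable M" "\<And>w. w \<in> space M \<Longrightarrow> \<bar>Z w\<bar> \<le> C"
  shows "integrable M (\<lambda>w. Z w * (W b w - W a w) * (W d w - W c w))"
  by (rule in_L2_mult[OF in_L2_bounded_mult[OF in_L2_increment]
      in_L2_increment]) (use assms in auto)

text \<open>For p \<le> q the increment up to q is the one up to p plus W q - W p. The extra part is
  orthogonal to everything known at p, so only Z (W p - W c)^2 contributes.\<close>

lemma increment_covariance_common_start:
  assumes "0 \<le> c" "c \<le> p" "c \<le> q"
    and Z: "Z \<in> borel_measurable (F c)" "\<And>w. w \<in> space M \<Longrightarrow> \<bar>Z w\<bar> \<le> C"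
  shows "expectation (\<lambda>w. Z w * (W p w - W c w) * (W q w - W c w)) = expectation Z * (min p q - c)"
proof -
  have ZM: "Z \<in> borel_measurable M"
    by (rule F_measurable[OF assms(1) Z(1)])
  have iZ: "integrable M Z"
    using L1_le_L2(1)[OF in_L2_bounded[OF finite_measure_axioms ZM Z(2)]] .
  have *: "expectation (\<lambda>w. Z w * (W p w - W c w) * (W q w - W c w)) = expectation Z * (p - c)"
    if "c \<le> p" "p \<le> q" for p q
  proof -
    have "0 \<le> p" using that assms by simp
    have Zp: "(\<lambda>w. Z w * (W p w - W c w)) \<in> borel_measurable (F p)"
      using F_measurable_mono[OF \<open>0 \<le> c\<close> \<open>c \<le> p\<close> Z(1)] W_measurable_F[of p p] W_measurable_F[of c p]
        \<open>0 \<le> c\<close> \<open>c \<le> p\<close> by (intro borel_measurable_times borel_measurable_diff) auto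
    have iZp: "integrable M (\<lambda>w. Z w * (W p w - W c w))"
      by (rule increment_orthogonal(1)[OF \<open>0 \<le> c\<close> \<open>c \<le> p\<close> Z(1) iZ])
    note s = increment_square_factor[OF \<open>0 \<le> c\<close> \<open>c \<le> p\<close> Z(1) iZ]
    note o = increment_orthogonal[OF \<open>0 \<le> p\<close> \<open>p \<le> q\<close> Zp iZp]
    have "expectation (\<lambda>w. Z w * (W p w - W c w) * (W q w - W c w))
      = expectation (\<lambda>w. Z w * (W p w - W c w)^2 + Z w * (W p w - W c w) * (W q w - W p w))"
      by (intro lint_cong) (auto simp: algebra_simps power2_eq_square)
    then show ?thesis
      by (simp only: lint_add s o)
  qed
  show ?thesis
  proof (cases "p \<le> q")
    case True
    with *[OF assms(2) True] show ?thesis by simp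
  next
    case False
    then have "q \<le> p" by simp
    from *[OF assms(3) this] this show ?thesis by (simp add: mult.assoc mult.commute mult.left_commute)
  qed
qed

text \<open>The overlap length is exactly what the product of the two interval indicators integrates
  to, so the formula matches the time integral for any pair of intervals.\<close>

lemma increment_covariance:
  assumes "0 \<le> a" "a \<le> b" "0 \<le> c" "c \<le> d"
    and \<xi>: "\<xi> \<in> borel_measurable (F a)" "\<And>w. w \<in> space M \<Longrightarrow> \<bar>\<xi> w\<bar> \<le> C"
    and \<eta>: "\<eta> \<in> borel_measurable (F c)" "\<And>w. w \<in> space M \<Longrightarrow> \<bar>\<eta> w\<bar> \<le> D"
  shows "expectation (\<lambda>w. \<xi> w * (W b w - W a w) * (\<eta> w * (W d w - W c w)))
    = expectation (\<lambda>w. \<xi> w * \<eta> w) * measure lborel ({a<..b} \<inter> {c<..d})"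
proof -
  \<comment> \<open>By symmetry a \<le> c. Then \<xi> \<eta> is known at time c and can be treated
    as one bounded factor \<open>Z\<close>.\<close>
  have *: "expectation (\<lambda>w. \<xi> w * (W b w - W a w) * (\<eta> w * (W d w - W c w)))
    = expectation (\<lambda>w. \<xi> w * \<eta> w) * measure lborel ({a<..b} \<inter> {c<..d})"
    if "0 \<le> a" "a \<le> b" "a \<le> c" "c \<le> d"
      and \<xi>: "\<xi> \<in> borel_measurable (F a)" "\<And>w. w \<in> space M \<Longrightarrow> \<bar>\<xi> w\<bar> \<le> C"
      and \<eta>: "\<eta> \<in> borel_measurable (F c)" "\<And>w. w \<in> space M \<Longrightarrow> \<bar>\<eta> w\<bar> \<le> D"
    for a b c d \<xi> \<eta> C D
  proof -
    have "0 \<le> c" using that by simp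
    define Z where "Z w = \<xi> w * \<eta> w" for w
    have \<xi>c: "\<xi> \<in> borel_measurable (F c)"
      using F_measurable_mono \<xi>(1) \<open>0 \<le> a\<close> \<open>a \<le> c\<close> by blast
    have Z: "Z \<in> borel_measurable (F c)" "\<And>w. w \<in> space M \<Longrightarrow> \<bar>Z w\<bar> \<le> C * D"
      using \<xi>c \<xi>(2) \<eta> order_trans[OF abs_ge_zero \<xi>(2)]
      by (auto simp: Z_def[abs_def] abs_mult intro!: mult_mono)
    have ZM: "Z \<in> borel_measurable M"
      by (rule F_measurable[OF \<open>0 \<le> c\<close> Z(1)])
    \<comment> \<open>The part of the first increment up to q is known at c and hence orthogonal to
      W d - W c. This is used with q = b when b \<le> c, and with q = c otherwise.\<close>
    have zero: "integrable M (\<lambda>w. Z w * (W q w - W a w) * (W d w - W c w))"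
        "expectation (\<lambda>w. Z w * (W q w - W a w) * (W d w - W c w)) = 0" if "a \<le> q" "q \<le> c" for q
    proof -
      have "(\<lambda>w. Z w * (W q w - W a w)) \<in> borel_measurable (F c)"
        using Z(1) W_measurable_F[of q c] W_measurable_F[of a c] \<open>0 \<le> a\<close> \<open>a \<le> c\<close> that
        by (intro borel_measurable_times borel_measurable_diff) auto
      moreover have "integrable M (\<lambda>w. Z w * (W q w - W a w))"
        by (rule L1_le_L2(1)[OF in_L2_bounded_mult[OF in_L2_increment ZM Z(2)]])
          (use \<open>0 \<le> a\<close> that in auto)
      ultimately show "integrable M (\<lambda>w. Z w * (W q w - W a w) * (W d w - W c w))"
        "expectation (\<lambda>w. Z w * (W q w - W a w) * (W d w - W c w)) = 0"
        using increment_orthogonal[OF \<open>0 \<le> c\<close> \<open>c \<le> d\<close>] by auto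
    qed
    have eq: "expectation (\<lambda>w. \<xi> w * (W b w - W a w) * (\<eta> w * (W d w - W c w)))
      = expectation (\<lambda>w. Z w * (W b w - W a w) * (W d w - W c w))"
      by (simp add: Z_def mult_ac)
    show ?thesis
    proof (cases "b \<le> c")
      case True
      then have "{a<..b} \<inter> {c<..d} = {}" by auto
      then show ?thesis
        unfolding eq zero(2)[OF \<open>a \<le> b\<close> True] by (simp del: Int_greaterThanAtMost)
    next
      case False
      then have "{a<..b} \<inter> {c<..d} = {c<..min b d}" "c \<le> min b d" using \<open>a \<le> c\<close> \<open>c \<le> d\<close> by auto
      then have m: "measure lborel ({a<..b} \<inter> {c<..d}) = min b d - c"
        by (simp del: Int_greaterThanAtMost)
      have "expectation (\<lambda>w. Z w * (W b w - W a w) * (W d w - W c w))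
        = expectation (\<lambda>w. Z w * (W c w - W a w) * (W d w - W c w) + Z w * (W b w - W c w) * (W d w - W c w))"
        by (intro lint_cong) (auto simp: algebra_simps)
      also have "\<dots> = expectation (\<lambda>w. Z w * (W c w - W a w) * (W d w - W c w))
        + expectation (\<lambda>w. Z w * (W b w - W c w) * (W d w - W c w))"
        by (intro lint_add zero(1)[OF \<open>a \<le> c\<close> order_refl]
            bounded_mult_increments_integrable[OF _ _ _ _ ZM Z(2)]) (use \<open>0 \<le> c\<close> False \<open>c \<le> d\<close> in auto)
      also have "\<dots> = expectation Z * (min b d - c)"
        using zero(2)[OF \<open>a \<le> c\<close> order_refl]
          increment_covariance_common_start[OF \<open>0 \<le> c\<close> _ \<open>c \<le> d\<close> Z, of b] False by simp
      finally show ?thesis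
        unfolding eq m by (simp add: Z_def[abs_def])
    qed
  qed
  show ?thesis
  proof (cases "a \<le> c")
    case True
    show ?thesis by (rule *[OF assms(1,2) True assms(4) \<xi> \<eta>])
  next
    case False
    then have "c \<le> a" by simp
    from *[OF assms(3,4) this assms(2) \<eta> \<xi>] show ?thesis
      by (simp add: mult_ac Int_commute)
  qed
qed

section \<open>Elementary processes and their integrals\<close>

lemma elementaryD:
  assumes "0 \<le> s" and e: "elementary F s t n \<tau> \<xi>" and i: "i < n"
  shows "0 \<le> \<tau> i" "s \<le> \<tau> i" "\<tau> i \<le> \<tau> (Suc i)" "\<tau> (Suc i) \<le> t" "\<xi> i \<in> borel_measurable (F (\<tau> i))"
    "\<xi> i \<in> borel_measurable M" "\<exists>C. \<forall>w\<in>space M. \<bar>\<xi> i w\<bar> \<le> C"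
proof -
  have mono: "\<tau> j \<le> \<tau> k" if "j \<le> k" "k \<le> n" for j k
    using that
  proof (induction k)
    case (Suc k)
    show ?case
    proof (cases "j = Suc k")
      case False
      then have "\<tau> j \<le> \<tau> k" using Suc by simp
      also have "\<tau> k \<le> \<tau> (Suc k)" using e Suc by (simp add: elementary_def)
      finally show ?thesis .
    qed simp
  qed simp
  show s: "s \<le> \<tau> i" using mono[of 0 i] e i by (simp add: elementary_def)
  then show 0: "0 \<le> \<tau> i" using \<open>0 \<le> s\<close> by simp
  show "\<tau> i \<le> \<tau> (Suc i)" using e i by (simp add: elementary_def)
  show "\<tau> (Suc i) \<le> t" using mono[of "Suc i" n] e i by (simp add: elementary_def)
  show m: "\<xi> i \<in> borel_measurable (F (\<tau> i))" using e i by (simp add: elementary_def)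
  show "\<xi> i \<in> borel_measurable M" by (rule F_measurable[OF 0 m])
  show "\<exists>C. \<forall>w\<in>space M. \<bar>\<xi> i w\<bar> \<le> C"
    using e i unfolding elementary_def space_F[OF 0, symmetric] by simp
qed

lemma in_L2_sum:
  "(\<And>i. i < (n::nat) \<Longrightarrow> in_L2 N (f i)) \<Longrightarrow> in_L2 N (\<lambda>x. \<Sum>i<n. f i x)"
  by (induction n) (auto intro: in_L2_add simp: in_L2_def[of _ "\<lambda>_. 0"])

lemma in_L2_elementary_integral:
  assumes "0 \<le> s" "elementary F s t n \<tau> \<xi>"
  shows "in_L2 M (elementary_integral W n \<tau> \<xi>)"
  unfolding elementary_integral_def[abs_def]
proof (rule in_L2_sum)
  fix i assume i: "i < n"
  note e = elementaryD[OF assms i]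
  from e(7) obtain C where "\<And>w. w \<in> space M \<Longrightarrow> \<bar>\<xi> i w\<bar> \<le> C" by auto
  with e show "in_L2 M (\<lambda>w. \<xi> i w * (W (\<tau> (Suc i)) w - W (\<tau> i) w))"
    by (intro in_L2_bounded_mult[OF in_L2_increment]) auto
qed

abbreviation time_prod :: "real \<Rightarrow> real \<Rightarrow> (real \<times> 'a) measure" where
  "time_prod s t \<equiv> leb_Icc s t \<Otimes>\<^sub>M M"

lemma finite_measure_time_prod: "finite_measure (time_prod s t)"
  by (intro finite_measure_pair_measure finite_measure_leb_Icc finite_measure_axioms)

lemma in_L2_elementary_term:
  assumes "\<xi> \<in> borel_measurable M" "\<And>w. w \<in> space M \<Longrightarrow> \<bar>\<xi> w\<bar> \<le> C" "A \<in> sets borel"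
  shows "in_L2 (time_prod s t) (\<lambda>(u, w). \<xi> w * indicat_real A u)"
proof (rule in_L2_bounded[OF finite_measure_time_prod])
  have [measurable]: "\<xi> \<in> borel_measurable M" "indicat_real A \<in> borel_measurable (leb_Icc s t)"
    using assms by (auto intro!: measurable_leb_Icc)
  show "(\<lambda>(u, w). \<xi> w * indicat_real A u) \<in> borel_measurable (time_prod s t)"
    by measurable
  \<comment> \<open>\<open>max C 0\<close> covers the points where the indicator vanishes, since no
    sign of \<open>C\<close> is given.\<close>
  show "\<bar>case x of (u, w) \<Rightarrow> \<xi> w * indicat_real A u\<bar> \<le> max C 0" if "x \<in> space (time_prod s t)" for x
    using that assms(2)[of "snd x"]
    by (auto simp: space_pair_measure indicator_def split: prod.splits)
qed

lemma in_L2_elementary_process: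
  assumes "0 \<le> s" "elementary F s t n \<tau> \<xi>"
  shows "in_L2 (time_prod s t) (\<lambda>(u, w). elementary_process n \<tau> \<xi> u w)"
proof -
  have "in_L2 (time_prod s t) (\<lambda>x. \<Sum>i<n. (\<lambda>(u, w). \<xi> i w * indicat_real {\<tau> i<..\<tau> (Suc i)} u) x)"
  proof (rule in_L2_sum)
    fix i assume i: "i < n"
    note e = elementaryD[OF assms i]
    from e(7) obtain C where "\<And>w. w \<in> space M \<Longrightarrow> \<bar>\<xi> i w\<bar> \<le> C" by auto
    then show "in_L2 (time_prod s t) (\<lambda>(u, w). \<xi> i w * indicat_real {\<tau> i<..\<tau> (Suc i)} u)"
      using e by (intro in_L2_elementary_term) auto
  qed
  then show ?thesis
    by (simp add: elementary_process_def split_def)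
qed

text \<open>After Fubini only the length of the overlap is left; (a, b] lies in [s, t], so the
  restriction to [s, t] cuts nothing off.\<close>

lemma elementary_term_isometry:
  assumes "s \<le> a" "b \<le> t" "\<xi> \<in> borel_measurable M" "\<And>w. w \<in> space M \<Longrightarrow> \<bar>\<xi> w\<bar> \<le> C"
    "\<eta> \<in> borel_measurable M" "\<And>w. w \<in> space M \<Longrightarrow> \<bar>\<eta> w\<bar> \<le> D"
  shows "(\<integral>x. (\<lambda>(u, w). \<xi> w * indicat_real {a<..b} u) x * (\<lambda>(u, w). \<eta> w * indicat_real {c<..d} u) x
      \<partial>time_prod s t) = expectation (\<lambda>w. \<xi> w * \<eta> w) * measure lborel ({a<..b} \<inter> {c<..d})"
proof -
  interpret L: finite_measure "leb_Icc s t" by (rule finite_measure_leb_Icc)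
  interpret P: pair_sigma_finite "leb_Icc s t" M ..
  have eq: "(\<lambda>x. (\<lambda>(u, w). \<xi> w * indicat_real {a<..b} u) x * (\<lambda>(u, w). \<eta> w * indicat_real {c<..d} u) x)
    = (\<lambda>(u, w). \<xi> w * \<eta> w * indicat_real ({a<..b} \<inter> {c<..d}) u)"
    by (auto simp: fun_eq_iff indicator_def)
  have "integrable (time_prod s t) (\<lambda>x. (\<lambda>(u, w). \<xi> w * indicat_real {a<..b} u) x * (\<lambda>(u, w). \<eta> w * indicat_real {c<..d} u) x)"
    by (intro in_L2_mult in_L2_elementary_term[OF assms(3,4)] in_L2_elementary_term[OF assms(5,6)]) auto
  then have "integrable (time_prod s t) (\<lambda>(u, w). \<xi> w * \<eta> w * indicat_real ({a<..b} \<inter> {c<..d}) u)"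
    unfolding eq .
  from P.integral_fst[OF this]
  have "(\<integral>x. (\<lambda>(u, w). \<xi> w * \<eta> w * indicat_real ({a<..b} \<inter> {c<..d}) u) x \<partial>time_prod s t)
    = expectation (\<lambda>w. \<xi> w * \<eta> w) * (\<integral>u. indicat_real ({a<..b} \<inter> {c<..d}) u \<partial>leb_Icc s t)"
    by simp
  moreover have "(\<integral>u. indicat_real ({a<..b} \<inter> {c<..d}) u \<partial>leb_Icc s t) = measure lborel ({a<..b} \<inter> {c<..d})"
  proof -
    have "indicator {s..t} u * indicat_real ({a<..b} \<inter> {c<..d}) u = indicat_real ({a<..b} \<inter> {c<..d}) u" for u
      using assms(1,2) by (auto simp: indicator_def)
    then show ?thesis
      by (subst integral_restrict_space) (simp, simp only: real_scaleR_def, simp del: Int_greaterThanAtMost)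
  qed
  ultimately show ?thesis unfolding eq by simp
qed

text \<open>The two double sums agree term by term, because \<open>increment_covariance\<close> and
  \<open>elementary_term_isometry\<close> have the same right-hand side. Hence two different
  partitions need no common refinement.\<close>

lemma elementary_isometry:
  assumes s0: "0 \<le> s" and e: "elementary F s t n \<tau> \<xi>" and e': "elementary F s t n' \<tau>' \<xi>'"
  shows "expectation (\<lambda>w. elementary_integral W n \<tau> \<xi> w * elementary_integral W n' \<tau>' \<xi>' w)
    = (\<integral>x. (\<lambda>(u, w). elementary_process n \<tau> \<xi> u w) x * (\<lambda>(u, w). elementary_process n' \<tau>' \<xi>' u w) x \<partial>time_prod s t)"
proof -
  define p where "p \<tau> \<xi> i = (\<lambda>(u, w). (\<xi> i :: 'a \<Rightarrow> real) w * indicat_real {\<tau> i<..\<tau> (Suc i)} u)"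
    for \<tau> :: "nat \<Rightarrow> real" and \<xi> and i :: nat
  define q where "q \<tau> \<xi> i w = (\<xi> i :: 'a \<Rightarrow> real) w * (W (\<tau> (Suc i)) w - W (\<tau> i) w)"
    for \<tau> :: "nat \<Rightarrow> real" and \<xi> and i :: nat and w
  have pq: "integrable M (\<lambda>w. q \<tau> \<xi> i w * q \<tau>' \<xi>' j w)"
    "integrable (time_prod s t) (\<lambda>x. p \<tau> \<xi> i x * p \<tau>' \<xi>' j x)"
    "expectation (\<lambda>w. q \<tau> \<xi> i w * q \<tau>' \<xi>' j w) = (\<integral>x. p \<tau> \<xi> i x * p \<tau>' \<xi>' j x \<partial>time_prod s t)"
    if "i < n" "j < n'" for i j
  proof -
    note e = elementaryD[OF s0 e \<open>i < n\<close>] and e' = elementaryD[OF s0 e' \<open>j < n'\<close>]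
    from e(7) obtain C where C: "\<And>w. w \<in> space M \<Longrightarrow> \<bar>\<xi> i w\<bar> \<le> C" by auto
    from e'(7) obtain D where D: "\<And>w. w \<in> space M \<Longrightarrow> \<bar>\<xi>' j w\<bar> \<le> D" by auto
    show "integrable M (\<lambda>w. q \<tau> \<xi> i w * q \<tau>' \<xi>' j w)"
      unfolding q_def using e e'
      by (intro in_L2_mult in_L2_bounded_mult[OF in_L2_increment _ C]
          in_L2_bounded_mult[OF in_L2_increment _ D]) auto
    show "integrable (time_prod s t) (\<lambda>x. p \<tau> \<xi> i x * p \<tau>' \<xi>' j x)"
      unfolding p_def
      by (intro in_L2_mult in_L2_elementary_term[OF e(6) C]
          in_L2_elementary_term[OF e'(6) D]) auto
    show "expectation (\<lambda>w. q \<tau> \<xi> i w * q \<tau>' \<xi>' j w) = (\<integral>x. p \<tau> \<xi> i x * p \<tau>' \<xi>' j x \<partial>time_prod s t)"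
      unfolding p_def q_def
      by (rule trans[OF increment_covariance[OF e(1,3) e'(1,3) e(5) C e'(5) D]
            elementary_term_isometry[OF e(2,4) e(6) C e'(6) D, symmetric]])
  qed
  have "expectation (\<lambda>w. elementary_integral W n \<tau> \<xi> w * elementary_integral W n' \<tau>' \<xi>' w)
    = expectation (\<lambda>w. \<Sum>i<n. \<Sum>j<n'. q \<tau> \<xi> i w * q \<tau>' \<xi>' j w)"
    by (simp add: elementary_integral_def q_def sum_product)
  also have "\<dots> = (\<Sum>i<n. \<Sum>j<n'. expectation (\<lambda>w. q \<tau> \<xi> i w * q \<tau>' \<xi>' j w))"
    using pq(1) by (subst lint_sum, (auto)[1], intro sum.cong refl lint_sum) auto
  also have "\<dots> = (\<Sum>i<n. \<Sum>j<n'. (\<integral>x. p \<tau> \<xi> i x * p \<tau>' \<xi>' j x \<partial>time_prod s t))"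
    using pq(3) by (intro sum.cong refl) auto
  also have "\<dots> = (\<integral>x. (\<Sum>i<n. \<Sum>j<n'. p \<tau> \<xi> i x * p \<tau>' \<xi>' j x) \<partial>time_prod s t)"
    using pq(2) by (subst lint_sum, (auto)[1], intro sum.cong refl lint_sum[symmetric]) auto
  also have "\<dots> = (\<integral>x. (\<lambda>(u, w). elementary_process n \<tau> \<xi> u w) x * (\<lambda>(u, w). elementary_process n' \<tau>' \<xi>' u w) x \<partial>time_prod s t)"
    unfolding elementary_process_def p_def split_def sum_product ..
  finally show ?thesis .
qed

end

section \<open>Density of step functions\<close>

definition step_function :: "nat \<Rightarrow> (nat \<Rightarrow> real) \<Rightarrow> (nat \<Rightarrow> real) \<Rightarrow> real \<Rightarrow> real" where
  "step_function n \<tau> c u = (\<Sum>i<n. c i * indicat_real {\<tau> i<..\<tau> (Suc i)} u)"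

lemma step_function_measurable [measurable]: "step_function n \<tau> c \<in> borel_measurable borel"
  unfolding step_function_def[abs_def] by measurable

lemma elementary_process_const: "elementary_process n \<tau> (\<lambda>i _. c i) u w = step_function n \<tau> c u"
  by (simp add: elementary_process_def step_function_def)

lemma in_L2_step_function: "in_L2 (leb_Icc s t) (step_function n \<tau> c)"
proof (rule in_L2_bounded[OF finite_measure_leb_Icc])
  show "step_function n \<tau> c \<in> borel_measurable (leb_Icc s t)"
    by (rule measurable_leb_Icc) simp
  show "\<bar>step_function n \<tau> c x\<bar> \<le> (\<Sum>i<n. \<bar>c i\<bar>)" for x
    unfolding step_function_def
    by (rule order_trans[OF sum_abs]) (auto intro!: sum_mono simp: indicator_def)
qed

text \<open>\<open>Suc k\<close> cells rather than \<open>k\<close>, so that the mesh (t - s) /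
  \<open>Suc k\<close> makes sense for every \<open>k\<close>.\<close>

definition uniform_grid :: "real \<Rightarrow> real \<Rightarrow> nat \<Rightarrow> nat \<Rightarrow> real" where
  "uniform_grid s t k i = s + (t - s) / real (Suc k) * real i"

lemma uniform_grid_cell:
  assumes "s < u" "u \<le> t"
  obtains i where "i < Suc k" "u \<in> {uniform_grid s t k i<..uniform_grid s t k (Suc i)}"
    "\<And>j. u \<in> {uniform_grid s t k j<..uniform_grid s t k (Suc j)} \<longleftrightarrow> j = i"
    "uniform_grid s t k (Suc i) \<le> u + (t - s) / real (Suc k)"
proof -
  define \<delta> where "\<delta> = (t - s) / real (Suc k)"
  define x where "x = (u - s) / \<delta>"
  \<comment> \<open>Cells are open on the left and closed on the right, so the index is the ceiling
    of \<open>x\<close> minus one, not the floor.\<close>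
  define i where "i = nat (\<lceil>x\<rceil> - 1)"
  have "0 < \<delta>" using assms by (simp add: \<delta>_def)
  have x: "0 < x" using assms \<open>0 < \<delta>\<close> by (simp add: x_def)
  have u: "u = s + \<delta> * x" using \<open>0 < \<delta>\<close> by (simp add: x_def)
  have cell: "u \<in> {uniform_grid s t k j<..uniform_grid s t k (Suc j)} \<longleftrightarrow> real j < x \<and> x \<le> real j + 1" for j
    using \<open>0 < \<delta>\<close> unfolding uniform_grid_def \<delta>_def[symmetric] u by (simp add: add.commute)
  have i: "real i < x" "x \<le> real i + 1" using x unfolding i_def by linarith+
  have "x \<le> real (Suc k)"
    using assms \<open>0 < \<delta>\<close> unfolding x_def by (simp add: pos_divide_le_eq \<delta>_def)
  with i have "real i < real (Suc k)" by linarith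
  then have "i < Suc k" unfolding of_nat_less_iff .
  moreover have "real j < x \<and> x \<le> real j + 1 \<longleftrightarrow> j = i" for j
  proof
    assume "real j < x \<and> x \<le> real j + 1"
    with i have "real j < real (Suc i)" "real i < real (Suc j)" by auto
    then show "j = i" unfolding of_nat_less_iff by simp
  qed (use i in auto)
  moreover have "uniform_grid s t k (Suc i) \<le> u + (t - s) / real (Suc k)"
    using i \<open>0 < \<delta>\<close> unfolding uniform_grid_def \<delta>_def[symmetric] u
    by (simp add: algebra_simps)
  ultimately show thesis
    using that[of i] cell by blast
qed

abbreviation uniform_step :: "real \<Rightarrow> real \<Rightarrow> nat \<Rightarrow> (nat \<Rightarrow> real) \<Rightarrow> real \<Rightarrow> real" where
  "uniform_step s t k \<equiv> step_function (Suc k) (uniform_grid s t k)"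

abbreviation L2_dist :: "real \<Rightarrow> real \<Rightarrow> (real \<Rightarrow> real) \<Rightarrow> (real \<Rightarrow> real) \<Rightarrow> ennreal" where
  "L2_dist s t f g \<equiv> \<integral>\<^sup>+u. ennreal ((f u - g u)^2) \<partial>leb_Icc s t"

lemma step_function_uniform_grid:
  assumes "i < Suc k" "\<And>j. u \<in> {uniform_grid s t k j<..uniform_grid s t k (Suc j)} \<longleftrightarrow> j = i"
  shows "uniform_step s t k c u = c i"
proof -
  have "uniform_step s t k c u = (\<Sum>j<Suc k. if j = i then c i else 0)"
    unfolding step_function_def indicator_def using assms(2) by (intro sum.cong) auto
  then show ?thesis using assms(1) by simp
qed

lemma step_function_add: "step_function n \<tau> (\<lambda>i. c i + d i) u = step_function n \<tau> c u + step_function n \<tau> d u"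
  by (simp add: step_function_def sum.distrib distrib_right)

lemma step_function_cmult: "step_function n \<tau> (\<lambda>i. a * c i) u = a * step_function n \<tau> c u"
  unfolding step_function_def sum_distrib_left mult.assoc ..

text \<open>Approximating along all sufficiently fine uniform grids, rather than by arbitrary step
  functions, makes closure under sums immediate: no common refinement is needed.\<close>

definition step_approximable :: "real \<Rightarrow> real \<Rightarrow> (real \<Rightarrow> real) \<Rightarrow> bool" where
  "step_approximable s t f \<longleftrightarrow> f \<in> borel_measurable (leb_Icc s t) \<and>
    (\<forall>e>0. \<exists>K. \<forall>k\<ge>K. \<exists>c. L2_dist s t (uniform_step s t k c) f < ennreal e)"

text \<open>From (f + g)^2 \<le> 2 f^2 + 2 g^2; hence the tolerance e/4 for each part.\<close>

lemma nn_integral_square_add_le: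
  assumes [measurable]: "f \<in> borel_measurable M" "g \<in> borel_measurable M"
    and "(\<integral>\<^sup>+x. ennreal ((f x)^2) \<partial>M) < ennreal (e/4)" "(\<integral>\<^sup>+x. ennreal ((g x)^2) \<partial>M) < ennreal (e/4)"
    and "\<And>x. x \<in> space M \<Longrightarrow> h x = f x + g x"
  shows "(\<integral>\<^sup>+x. ennreal ((h x)^2) \<partial>M) < ennreal e"
proof -
  \<comment> \<open>A strict bound by \<open>ennreal (e/4)\<close> already forces e > 0, since
    \<open>ennreal\<close> is 0 on all other arguments.\<close>
  have e: "0 < e" using assms(3) by (metis ennreal_neg linorder_not_less not_less_zero divide_le_0_iff zero_less_numeral less_le_not_le)
  have "(\<integral>\<^sup>+x. ennreal ((h x)^2) \<partial>M) \<le> (\<integral>\<^sup>+x. 2 * ennreal ((f x)^2) + 2 * ennreal ((g x)^2) \<partial>M)"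
  proof (rule nn_integral_mono)
    fix x assume "x \<in> space M"
    have "(f x + g x)^2 \<le> 2 * (f x)^2 + 2 * (g x)^2"
      using sum_squares_bound[of "f x" "g x"] by (simp add: power2_sum)
    then have "ennreal ((h x)^2) \<le> ennreal (2 * (f x)^2 + 2 * (g x)^2)"
      unfolding assms(5)[OF \<open>x \<in> space M\<close>] by (rule ennreal_leI)
    then show "ennreal ((h x)^2) \<le> 2 * ennreal ((f x)^2) + 2 * ennreal ((g x)^2)"
      by (simp add: ennreal_mult ennreal_plus)
  qed
  also have "\<dots> = 2 * (\<integral>\<^sup>+x. ennreal ((f x)^2) \<partial>M) + 2 * (\<integral>\<^sup>+x. ennreal ((g x)^2) \<partial>M)"
    by (simp add: nn_integral_add nn_integral_cmult)
  also have "\<dots> < 2 * ennreal (e/4) + 2 * ennreal (e/4)"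
    using assms(3,4) by (intro add_strict_mono ennreal_mult_strict_left_mono) auto
  also have "\<dots> = ennreal e"
    using e by (simp add: ennreal_numeral[symmetric] ennreal_mult'[symmetric] ennreal_plus[symmetric] del: ennreal_numeral ennreal_plus)
  finally show ?thesis .
qed

lemma step_approximable_cong:
  assumes "step_approximable s t f" "\<And>u. u \<in> {s..t} \<Longrightarrow> f u = g u"
  shows "step_approximable s t g"
proof -
  have "f \<in> borel_measurable (leb_Icc s t) \<longleftrightarrow> g \<in> borel_measurable (leb_Icc s t)"
    by (rule measurable_cong) (simp add: space_restrict_space assms(2))
  moreover have "L2_dist s t h f = L2_dist s t h g" for h
    by (rule nn_integral_cong) (simp add: space_restrict_space assms(2))
  ultimately show ?thesis
    using assms(1) unfolding step_approximable_def by simp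
qed

text \<open>A fineness \<open>K\<close> that suffices for the approximant \<open>g\<close> at
  tolerance e/4 suffices for \<open>f\<close> at tolerance e.\<close>

lemma step_approximable_limit:
  assumes [measurable]: "f \<in> borel_measurable (leb_Icc s t)"
    and g: "\<And>e. 0 < e \<Longrightarrow> \<exists>g. step_approximable s t g \<and> L2_dist s t g f < ennreal e"
  shows "step_approximable s t f"
  unfolding step_approximable_def
proof (intro conjI allI impI)
  fix e :: real assume "0 < e"
  then obtain g where g: "step_approximable s t g" "L2_dist s t g f < ennreal (e/4)"
    using g[of "e/4"] by auto
  have [measurable]: "g \<in> borel_measurable (leb_Icc s t)"
    using g(1) by (simp add: step_approximable_def)
  obtain K where K: "\<And>k. k \<ge> K \<Longrightarrow> \<exists>c. L2_dist s t (uniform_step s t k c) g < ennreal (e/4)"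
    using g(1) \<open>0 < e\<close> unfolding step_approximable_def by (metis zero_less_divide_iff zero_less_numeral)
  show "\<exists>K. \<forall>k\<ge>K. \<exists>c. L2_dist s t (uniform_step s t k c) f < ennreal e"
  proof (intro exI[of _ K] allI impI)
    fix k assume "K \<le> k"
    from K[OF this] obtain c where c: "L2_dist s t (uniform_step s t k c) g < ennreal (e/4)" by blast
    have "uniform_step s t k c \<in> borel_measurable (leb_Icc s t)"
      by (rule measurable_leb_Icc) simp
    then have "L2_dist s t (uniform_step s t k c) f < ennreal e"
      by (intro nn_integral_square_add_le[OF _ _ c g(2)]) auto
    then show "\<exists>c. L2_dist s t (uniform_step s t k c) f < ennreal e"
      by blast
  qed
qed fact

lemma step_approximable_add:
  assumes "step_approximable s t f" "step_approximable s t g"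
  shows "step_approximable s t (\<lambda>u. f u + g u)"
proof -
  have [measurable]: "f \<in> borel_measurable (leb_Icc s t)" "g \<in> borel_measurable (leb_Icc s t)"
    using assms by (auto simp: step_approximable_def)
  show ?thesis
    unfolding step_approximable_def
  proof (intro conjI allI impI)
    fix e :: real assume "0 < e"
    then have "0 < e/4" by simp
    obtain K where K: "\<And>k. k \<ge> K \<Longrightarrow> \<exists>c. L2_dist s t (uniform_step s t k c) f < ennreal (e/4)"
      using assms(1) \<open>0 < e/4\<close> unfolding step_approximable_def by metis
    obtain K' where K': "\<And>k. k \<ge> K' \<Longrightarrow> \<exists>c. L2_dist s t (uniform_step s t k c) g < ennreal (e/4)"
      using assms(2) \<open>0 < e/4\<close> unfolding step_approximable_def by metis
    show "\<exists>K. \<forall>k\<ge>K. \<exists>c. L2_dist s t (uniform_step s t k c) (\<lambda>u. f u + g u) < ennreal e"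
    proof (intro exI[of _ "max K K'"] allI impI)
      fix k assume "max K K' \<le> k"
      then obtain c d where c: "L2_dist s t (uniform_step s t k c) f < ennreal (e/4)" and d: "L2_dist s t (uniform_step s t k d) g < ennreal (e/4)"
        using K[of k] K'[of k] by auto
      have [measurable]: "uniform_step s t k c \<in> borel_measurable (leb_Icc s t)" for c
        by (rule measurable_leb_Icc) simp
      have "L2_dist s t (uniform_step s t k (\<lambda>i. c i + d i)) (\<lambda>u. f u + g u) < ennreal e"
        by (rule nn_integral_square_add_le[OF _ _ c d]) (simp_all add: step_function_add)
      then show "\<exists>c. L2_dist s t (uniform_step s t k c) (\<lambda>u. f u + g u) < ennreal e"
        by blast
    qed
  qed simp
qed

lemma step_approximable_cmult:
  assumes "step_approximable s t f"
  shows "step_approximable s t (\<lambda>u. a * f u)"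
proof -
  have [measurable]: "f \<in> borel_measurable (leb_Icc s t)"
    using assms by (auto simp: step_approximable_def)
  show ?thesis
    unfolding step_approximable_def
  proof (intro conjI allI impI)
    fix e :: real assume "0 < e"
    \<comment> \<open>The 1 in the denominator covers a = 0 and makes a^2 e' < e strict.\<close>
    define e' where "e' = e / (a^2 + 1)"
    have pos: "0 < a^2 + 1" by (simp add: add_nonneg_pos)
    have "0 < e'" using \<open>0 < e\<close> pos by (simp add: e'_def)
    then obtain K where K: "\<And>k. k \<ge> K \<Longrightarrow> \<exists>c. L2_dist s t (uniform_step s t k c) f < ennreal e'"
      using assms unfolding step_approximable_def by metis
    show "\<exists>K. \<forall>k\<ge>K. \<exists>c. L2_dist s t (uniform_step s t k c) (\<lambda>u. a * f u) < ennreal e"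
    proof (intro exI[of _ K] allI impI)
      fix k assume "K \<le> k"
      then obtain c where c: "L2_dist s t (uniform_step s t k c) f < ennreal e'"
        using K by blast
      have [measurable]: "uniform_step s t k c \<in> borel_measurable (leb_Icc s t)"
        by (rule measurable_leb_Icc) simp
      have "L2_dist s t (uniform_step s t k (\<lambda>i. a * c i)) (\<lambda>u. a * f u)
        = ennreal (a^2) * L2_dist s t (uniform_step s t k c) f"
        by (subst nn_integral_cmult[symmetric])
          (auto simp: step_function_cmult right_diff_distrib[symmetric] power_mult_distrib ennreal_mult)
      also have "\<dots> \<le> ennreal (a^2) * ennreal e'"
        using c by (intro mult_left_mono) auto
      also have "\<dots> = ennreal (a^2 * e')"
        using \<open>0 < e'\<close> by (simp add: ennreal_mult)
      also have "\<dots> < ennreal e"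
        using \<open>0 < e\<close> pos by (intro ennreal_lessI) (auto simp: e'_def field_simps)
      finally show "\<exists>c. L2_dist s t (uniform_step s t k c) (\<lambda>u. a * f u) < ennreal e"
        by blast
    qed
  qed simp
qed

text \<open>Each cell takes the value at its right endpoint. On the cells the step function is then
  wrong at most for u in [b - \<delta>, b), where \<delta> is the mesh, and that interval has length
  \<delta>.\<close>

lemma step_approximable_lessThan: "step_approximable s t (indicat_real {..<b})"
  unfolding step_approximable_def
proof (intro conjI allI impI)
  show "indicat_real {..<b} \<in> borel_measurable (leb_Icc s t)"
    by (rule measurable_leb_Icc) simp
  fix e :: real assume "0 < e"
  obtain K :: nat where K: "(t - s) / e < real K" by (rule reals_Archimedean2[of "(t - s) / e", THEN exE])
  show "\<exists>K. \<forall>k\<ge>K. \<exists>c. L2_dist s t (uniform_step s t k c) (indicat_real {..<b}) < ennreal e"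
  proof (intro exI[of _ K] allI impI)
    fix k assume "K \<le> k"
    define \<delta> where "\<delta> = (t - s) / real (Suc k)"
    have "(t - s) / e < real (Suc k)" using K \<open>K \<le> k\<close> by linarith
    then have \<delta>: "\<delta> < e" using \<open>0 < e\<close> unfolding \<delta>_def by (simp add: field_simps)
    let ?c = "\<lambda>i. indicat_real {..<b} (uniform_grid s t k (Suc i))"
    \<comment> \<open>The point \<open>s\<close> belongs to no cell and is left out; it is a null
      set.\<close>
    have bound: "ennreal ((uniform_step s t k ?c u - indicat_real {..<b} u)^2) * indicator {s..t} u
      \<le> indicator {b - \<delta>..b} u" if "u \<noteq> s" for u
    proof (cases "u \<in> {s..t}")
      case True
      with that have "s < u" "u \<le> t" by auto
      then obtain i where i: "i < Suc k" "u \<in> {uniform_grid s t k i<..uniform_grid s t k (Suc i)}"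
        "\<And>j. u \<in> {uniform_grid s t k j<..uniform_grid s t k (Suc j)} \<longleftrightarrow> j = i"
        "uniform_grid s t k (Suc i) \<le> u + \<delta>"
        unfolding \<delta>_def using uniform_grid_cell[of s u t k] by metis
      show ?thesis
        unfolding step_function_uniform_grid[OF i(1,3)] using i(2,4) by (auto simp: indicator_def)
    qed simp
    have "L2_dist s t (uniform_step s t k ?c) (indicat_real {..<b})
      = (\<integral>\<^sup>+u. ennreal ((uniform_step s t k ?c u - indicat_real {..<b} u)^2) * indicator {s..t} u \<partial>lborel)"
      by (rule nn_integral_restrict_space) simp
    also have "\<dots> \<le> (\<integral>\<^sup>+u. indicator {b - \<delta>..b} u \<partial>lborel)"
      by (rule nn_integral_mono_AE, rule AE_mp[OF AE_lborel_singleton[of s]]) (use bound in auto)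
    \<comment> \<open>A negative \<delta> occurs for t < s; both sides are then 0.\<close>
    also have "\<dots> \<le> ennreal \<delta>"
      by (cases "0 \<le> \<delta>") (auto simp: ennreal_neg)
    also have "\<dots> < ennreal e" using \<delta> \<open>0 < e\<close> by (intro ennreal_lessI)
    finally show "\<exists>c. L2_dist s t (uniform_step s t k c) (indicat_real {..<b}) < ennreal e" by blast
  qed
qed

text \<open>A Dynkin system argument: half-lines generate the Borel sets and are stable under
  intersection, and the approximable sets are closed under complements and countable disjoint
  unions.\<close>

lemma step_approximable_indicator:
  assumes "A \<in> sets borel"
  shows "step_approximable s t (indicat_real A)"
proof -
  have Int: "Int_stable (range (lessThan :: real \<Rightarrow> real set))"
  proof (rule Int_stableI_image)
    show "\<exists>c\<in>UNIV. {..<a} \<inter> {..<b} = {..<c}" for a b :: real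
      by (intro bexI[of _ "min a b"]) auto
  qed
  \<comment> \<open>On [s, t] the constant 1 is the indicator of the half-line below t + 1.\<close>
  have one: "step_approximable s t (\<lambda>_. 1)"
    by (rule step_approximable_cong[OF step_approximable_lessThan[of s t "t + 1"]]) auto
  have A: "A \<in> sigma_sets UNIV (range lessThan)"
    using assms unfolding borel_Iio by simp
  have closed: "range (lessThan :: real \<Rightarrow> real set) \<subseteq> Pow UNIV" by simp
  from Int closed A show ?thesis
  proof (induction rule: sigma_sets_induct_disjoint)
    case (basic A)
    then show ?case using step_approximable_lessThan by auto
  next
    case empty
    show ?case
      by (rule step_approximable_cong[OF step_approximable_cmult[OF one, of 0]]) simp
  next
    case (compl A)
    show ?case
      by (rule step_approximable_cong[OF step_approximable_add[OF one step_approximable_cmult[OF compl(2), of "-1"]]])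
        (auto simp: indicator_def)
  next
    case (union A)
    have A: "A i \<in> sets borel" for i
      using union(2) unfolding borel_Iio by auto
    \<comment> \<open>Finite disjoint unions come first, by adding indicators; the countable union
      is their L2 limit by dominated convergence on a finite measure.\<close>
    have fin: "step_approximable s t (indicat_real (\<Union>i<n. A i))" for n
    proof (induction n)
      case 0
      show ?case
        by (rule step_approximable_cong[OF step_approximable_cmult[OF one, of 0]]) simp
    next
      case (Suc n)
      have "(\<Union>i<n. A i) \<inter> A n = {}"
      proof -
        have "A i \<inter> A n = {}" if "i < n" for i
          using union(1) that unfolding disjoint_family_on_def by (metis UNIV_I less_irrefl_nat)
        then show ?thesis by blast
      qed
      then show ?case
        by (intro step_approximable_cong[OF step_approximable_add[OF Suc union(3)[of n]]])
          (auto simp: indicator_def lessThan_Suc)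
    qed
    show ?case
    proof (rule step_approximable_limit)
      have [measurable]: "indicat_real (\<Union>i. A i) \<in> borel_measurable (leb_Icc s t)"
        "indicat_real (\<Union>i<n. A i) \<in> borel_measurable (leb_Icc s t)" for n
        using A by (auto intro!: measurable_leb_Icc)
      show "indicat_real (\<Union>i. A i) \<in> borel_measurable (leb_Icc s t)" by simp
      have "(\<lambda>n. L2_dist s t (indicat_real (\<Union>i<n. A i)) (indicat_real (\<Union>i. A i)))
        \<longlonglongrightarrow> (\<integral>\<^sup>+u. 0 \<partial>leb_Icc s t)"
      proof (rule nn_integral_dominated_convergence[where w="\<lambda>_. 1"])
        show "(\<integral>\<^sup>+x. 1 \<partial>leb_Icc s t) < \<infinity>"
          using finite_measure.emeasure_finite[OF finite_measure_leb_Icc, of s t "space (leb_Icc s t)"]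
          by (simp add: less_top)
        show "AE u in leb_Icc s t. (\<lambda>n. ennreal ((indicat_real (\<Union>i<n. A i) u - indicat_real (\<Union>i. A i) u)^2)) \<longlonglongrightarrow> 0"
        proof (rule AE_I2)
          fix u
          have "(\<lambda>n. ennreal ((indicat_real (\<Union>i<n. A i) u - indicat_real (\<Union>i. A i) u)^2))
            \<longlonglongrightarrow> ennreal ((indicat_real (\<Union>i. A i) u - indicat_real (\<Union>i. A i) u)^2)"
            by (intro tendsto_intros LIMSEQ_indicator_UN)
          then show "(\<lambda>n. ennreal ((indicat_real (\<Union>i<n. A i) u - indicat_real (\<Union>i. A i) u)^2)) \<longlonglongrightarrow> 0"
            by simp
        qed
        show "AE u in leb_Icc s t. ennreal ((indicat_real (\<Union>i<n. A i) u - indicat_real (\<Union>i. A i) u)^2) \<le> 1" for n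
          by (auto simp: indicator_def intro!: AE_I2)
      qed simp_all
      then have lim: "(\<lambda>n. L2_dist s t (indicat_real (\<Union>i<n. A i)) (indicat_real (\<Union>i. A i))) \<longlonglongrightarrow> 0"
        by simp
      fix e :: real assume "0 < e"
      with order_tendstoD(2)[OF lim, of "ennreal e"] obtain n where
        "L2_dist s t (indicat_real (\<Union>i<n. A i)) (indicat_real (\<Union>i. A i)) < ennreal e"
        by (auto simp: eventually_sequentially)
      with fin show "\<exists>g. step_approximable s t g \<and> L2_dist s t g (indicat_real (\<Union>i. A i)) < ennreal e"
        by blast
    qed
  qed
qed

text \<open>Simple functions are finite combinations of indicators, and suitable ones converge to
  \<open>f\<close> in L2.\<close>

lemma step_approximable_in_L2:
  assumes "in_L2 (leb_Icc s t) f"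
  shows "step_approximable s t f"
proof (rule step_approximable_limit)
  show f[measurable]: "f \<in> borel_measurable (leb_Icc s t)"
    by (rule in_L2_measurable[OF assms])
  obtain g where g: "\<And>i. simple_function (leb_Icc s t) (g i)"
    "\<And>u. u \<in> space (leb_Icc s t) \<Longrightarrow> (\<lambda>i. g i u) \<longlonglongrightarrow> f u"
    "\<And>i u. u \<in> space (leb_Icc s t) \<Longrightarrow> \<bar>g i u\<bar> \<le> 2 * \<bar>f u\<bar>"
    using borel_measurable_implies_sequence_metric[OF f, of 0] unfolding dist_real_def diff_0_right by metis
  have [measurable]: "g i \<in> borel_measurable (leb_Icc s t)" for i
    by (rule borel_measurable_simple_function[OF g(1)])
  have "step_approximable s t (g i)" for i
  proof (rule step_approximable_cong)
    let ?S = "g i ` space (leb_Icc s t)"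
    have sums: "step_approximable s t (\<lambda>u. \<Sum>y\<in>S. y * indicat_real (g i -` {y} \<inter> space (leb_Icc s t)) u)"
      if "finite S" for S
      using that
    proof induction
      case empty
      show ?case
        by (rule step_approximable_cong[OF step_approximable_cmult[where a=0, OF step_approximable_indicator[of "{}"]]]) auto
    next
      case (insert y S)
      have "g i -` {y} \<inter> space (leb_Icc s t) \<in> sets (leb_Icc s t)"
        by measurable
      then have "g i -` {y} \<inter> space (leb_Icc s t) \<in> sets borel"
        by (auto simp: sets_restrict_space)
      from step_approximable_add[OF step_approximable_cmult[OF step_approximable_indicator[OF this], of s t y] insert(3)]
      show ?case unfolding sum.insert[OF insert(1,2)] .
    qed
    show "step_approximable s t (\<lambda>u. \<Sum>y\<in>?S. y * indicat_real (g i -` {y} \<inter> space (leb_Icc s t)) u)"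
      by (rule sums[OF simple_functionD(1)[OF g(1)]])
    show "(\<Sum>y\<in>?S. y * indicat_real (g i -` {y} \<inter> space (leb_Icc s t)) u) = g i u" if "u \<in> {s..t}" for u
      by (rule trans[OF _ simple_function_indicator_representation_banach[OF g(1), symmetric]])
        (use that in \<open>simp_all add: space_restrict_space mult.commute\<close>)
  qed
  moreover have "(\<lambda>n. L2_dist s t (g n) f) \<longlonglongrightarrow> (\<integral>\<^sup>+u. 0 \<partial>leb_Icc s t)"
  \<comment> \<open>From \<bar>g\<bar> \<le> 2 \<bar>f\<bar> the difference is at most 3
    \<bar>f\<bar>, whose square is 9 f^2.\<close>
  proof (rule nn_integral_dominated_convergence[where w="\<lambda>u. ennreal (9 * (f u)^2)"])
    show "(\<integral>\<^sup>+u. ennreal (9 * (f u)^2) \<partial>leb_Icc s t) < \<infinity>"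
      using in_L2_nn_eq[OF assms] by (simp add: ennreal_mult nn_integral_cmult ennreal_mult_less_top)
    show "AE u in leb_Icc s t. ennreal ((g n u - f u)^2) \<le> ennreal (9 * (f u)^2)" for n
    proof (intro AE_I2 ennreal_leI)
      fix u assume "u \<in> space (leb_Icc s t)"
      from g(3)[OF this] have "\<bar>g n u - f u\<bar> \<le> \<bar>3 * f u\<bar>" by (smt (verit, ccfv_threshold))
      then have "\<bar>g n u - f u\<bar>^2 \<le> \<bar>3 * f u\<bar>^2" by (rule power_mono) simp
      then show "(g n u - f u)^2 \<le> 9 * (f u)^2" by (simp add: power_mult_distrib)
    qed
    show "AE u in leb_Icc s t. (\<lambda>n. ennreal ((g n u - f u)^2)) \<longlonglongrightarrow> 0"
    proof (rule AE_I2)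
      fix u assume "u \<in> space (leb_Icc s t)"
      then have "(\<lambda>n. ennreal ((g n u - f u)^2)) \<longlonglongrightarrow> ennreal ((f u - f u)^2)"
        by (intro tendsto_intros g(2))
      then show "(\<lambda>n. ennreal ((g n u - f u)^2)) \<longlonglongrightarrow> 0" by simp
    qed
  qed auto
  moreover fix e :: real assume "0 < e"
  ultimately show "\<exists>g. step_approximable s t g \<and> L2_dist s t g f < ennreal e"
    using order_tendstoD(2)[of "\<lambda>n. L2_dist s t (g n) f" 0 sequentially "ennreal e"]
    by (auto simp: eventually_sequentially)
qed

section \<open>Ito integrals of deterministic functions\<close>

context brownian_motion
begin

text \<open>The classical Wiener integral, except that the approximating elementary processes may be
  random.\<close>

abbreviation wiener :: "real \<Rightarrow> real \<Rightarrow> (real \<Rightarrow> real) \<Rightarrow> ('a \<Rightarrow> real) \<Rightarrow> bool" where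
  "wiener s t f Y \<equiv> has_ito_integral M F W s t (\<lambda>u _. f u) Y"

lemma nn_integral_time_prod:
  assumes [measurable]: "h \<in> borel_measurable (time_prod s t)"
  shows "(\<integral>\<^sup>+w. (\<integral>\<^sup>+u\<in>{s..t}. ennreal (h (u, w)) \<partial>lborel) \<partial>M) = (\<integral>\<^sup>+x. ennreal (h x) \<partial>time_prod s t)"
proof -
  interpret L: finite_measure "leb_Icc s t" by (rule finite_measure_leb_Icc)
  interpret P: pair_sigma_finite "leb_Icc s t" M ..
  have "(\<integral>\<^sup>+x. ennreal (h x) \<partial>time_prod s t) = (\<integral>\<^sup>+w. (\<integral>\<^sup>+u. ennreal (h (u, w)) \<partial>leb_Icc s t) \<partial>M)"
    by (rule P.nn_integral_snd[symmetric]) simp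
  then show ?thesis by (simp add: nn_integral_restrict_space)
qed

lemma
  fixes f :: "real \<Rightarrow> real"
  assumes "f \<in> borel_measurable (leb_Icc s t)"
  shows integrable_time_prod: "integrable (time_prod s t) (\<lambda>x. f (fst x)) \<longleftrightarrow> integrable (leb_Icc s t) f"
    and integral_time_prod: "(\<integral>x. f (fst x) \<partial>time_prod s t) = (\<integral>u. f u \<partial>leb_Icc s t)"
  using integrable_distr_eq[OF measurable_fst assms, of M] integral_distr[OF measurable_fst assms, of M]
  unfolding distr_pair_fst by auto

lemma in_L2_time_prod:
  fixes f :: "real \<Rightarrow> real"
  assumes "f \<in> borel_measurable (leb_Icc s t)"
  shows "in_L2 (time_prod s t) (\<lambda>x. f (fst x)) \<longleftrightarrow> in_L2 (leb_Icc s t) f"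
  using assms integrable_time_prod[of "\<lambda>u. (f u)^2" s t] by (auto simp: in_L2_def)

text \<open>Hides partition and coefficients: the limit arguments only use that an elementary
  integral and its integrand are in L2 and that inner products agree.\<close>

definition elementary_pair :: "real \<Rightarrow> real \<Rightarrow> ('a \<Rightarrow> real) \<Rightarrow> (real \<times> 'a \<Rightarrow> real) \<Rightarrow> bool" where
  "elementary_pair s t I P \<longleftrightarrow> (\<exists>n \<tau> \<xi>. elementary F s t n \<tau> \<xi> \<and>
     I = elementary_integral W n \<tau> \<xi> \<and> P = (\<lambda>(u, w). elementary_process n \<tau> \<xi> u w))"

lemma elementary_pairD:
  assumes "0 \<le> s" "elementary_pair s t I P"
  shows elementary_pair_integral: "in_L2 M I" and elementary_pair_process: "in_L2 (time_prod s t) P"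
  using assms in_L2_elementary_integral in_L2_elementary_process
  unfolding elementary_pair_def by blast+

lemma elementary_pair_isometry:
  assumes "0 \<le> s" "elementary_pair s t I P" "elementary_pair s t J Q"
  shows "expectation (\<lambda>w. I w * J w) = (\<integral>x. P x * Q x \<partial>time_prod s t)"
proof -
  obtain n \<tau> \<xi> where e: "elementary F s t n \<tau> \<xi>"
    and IP: "I = elementary_integral W n \<tau> \<xi>" "P = (\<lambda>(u, w). elementary_process n \<tau> \<xi> u w)"
    using assms(2) unfolding elementary_pair_def by blast
  obtain n' \<tau>' \<xi>' where e': "elementary F s t n' \<tau>' \<xi>'"
    and JQ: "J = elementary_integral W n' \<tau>' \<xi>'" "Q = (\<lambda>(u, w). elementary_process n' \<tau>' \<xi>' u w)"
    using assms(3) unfolding elementary_pair_def by blast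
  show ?thesis unfolding IP JQ by (rule elementary_isometry[OF assms(1) e e'])
qed

lemma ito_integral_approximation:
  assumes s0: "0 \<le> s" and Y: "wiener s t f Y"
  obtains I P where "\<And>k. elementary_pair s t (I k) (P k)"
    "L2_lim (time_prod s t) P (\<lambda>x. f (fst x))"
    "L2_lim M I Y"
    "f \<in> borel_measurable (leb_Icc s t)" "Y \<in> borel_measurable M"
proof -
  from Y obtain n \<tau> \<xi> where e: "\<And>k. elementary F s t (n k) (\<tau> k) (\<xi> k)"
    and p: "(\<lambda>k. \<integral>\<^sup>+w. (\<integral>\<^sup>+u\<in>{s..t}. ennreal ((elementary_process (n k) (\<tau> k) (\<xi> k) u w - f u)^2) \<partial>lborel) \<partial>M) \<longlonglongrightarrow> 0"
    and y: "L2_lim M (\<lambda>k. elementary_integral W (n k) (\<tau> k) (\<xi> k)) Y"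
    and m: "(\<lambda>(u, w). f u) \<in> borel_measurable (time_prod s t)" "Y \<in> borel_measurable M"
    unfolding has_ito_integral_def by blast
  define P where "P k = (\<lambda>(u, w). elementary_process (n k) (\<tau> k) (\<xi> k) u w)" for k
  have pair: "elementary_pair s t (elementary_integral W (n k) (\<tau> k) (\<xi> k)) (P k)" for k
    unfolding elementary_pair_def P_def using e by blast
  \<comment> \<open>The integrand does not depend on \<omega>, so any section of it recovers the
    measurability of \<open>f\<close> in time alone.\<close>
  obtain w0 where "w0 \<in> space M" using not_empty by blast
  then have "(\<lambda>u. (u, w0)) \<in> leb_Icc s t \<rightarrow>\<^sub>M time_prod s t" by simp
  from measurable_compose[OF this m(1)] have f[measurable]: "f \<in> borel_measurable (leb_Icc s t)"
    by simp
  have "(\<integral>\<^sup>+w. (\<integral>\<^sup>+u\<in>{s..t}. ennreal ((elementary_process (n k) (\<tau> k) (\<xi> k) u w - f u)^2) \<partial>lborel) \<partial>M)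
    = (\<integral>\<^sup>+x. ennreal ((P k x - f (fst x))^2) \<partial>time_prod s t)" for k
  proof -
    have [measurable]: "P k \<in> borel_measurable (time_prod s t)"
      by (rule in_L2_measurable[OF elementary_pair_process[OF s0 pair]])
    have "(\<lambda>x. (P k x - f (fst x))^2) \<in> borel_measurable (time_prod s t)" by measurable
    from nn_integral_time_prod[OF this] show ?thesis by (simp add: P_def)
  qed
  then show thesis
    using pair p y f m(2) by (intro that) simp_all
qed

lemma ito_integral_in_L2:
  assumes s0: "0 \<le> s" and Y: "wiener s t f Y"
  shows "in_L2 (leb_Icc s t) f" "in_L2 M Y"
proof -
  from ito_integral_approximation[OF assms] obtain I P where e: "\<And>k. elementary_pair s t (I k) (P k)"
    and p: "L2_lim (time_prod s t) P (\<lambda>x. f (fst x))"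
    and y: "L2_lim M I Y"
    and f[measurable]: "f \<in> borel_measurable (leb_Icc s t)" and Ym: "Y \<in> borel_measurable M"
    by blast
  have "(\<lambda>x. f (fst x)) \<in> borel_measurable (time_prod s t)" by measurable
  from L2_limit_in_L2[OF elementary_pair_process[OF s0 e] this p]
  show "in_L2 (leb_Icc s t) f" unfolding in_L2_time_prod[OF f] .
  show "in_L2 M Y" by (rule L2_limit_in_L2[OF elementary_pair_integral[OF s0 e] Ym y])
qed

text \<open>Inner products of the elementary approximations agree for every k, and
  \<open>L2_limit_mult\<close> identifies the limit on either side.\<close>

lemma ito_isometry:
  assumes s0: "0 \<le> s" and Y: "wiener s t f Y" and Z: "wiener s t g Z"
  shows "expectation (\<lambda>w. Y w * Z w) = (\<integral>u. f u * g u \<partial>leb_Icc s t)"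
proof -
  from ito_integral_approximation[OF s0 Y] obtain I P where e: "\<And>k. elementary_pair s t (I k) (P k)"
    and p: "L2_lim (time_prod s t) P (\<lambda>x. f (fst x))"
    and y: "L2_lim M I Y"
    and f[measurable]: "f \<in> borel_measurable (leb_Icc s t)" and Ym: "Y \<in> borel_measurable M"
    by blast
  from ito_integral_approximation[OF s0 Z] obtain J Q where e': "\<And>k. elementary_pair s t (J k) (Q k)"
    and q: "L2_lim (time_prod s t) Q (\<lambda>x. g (fst x))"
    and z: "L2_lim M J Z"
    and g[measurable]: "g \<in> borel_measurable (leb_Icc s t)" and Zm: "Z \<in> borel_measurable M"
    by blast
  have fm: "(\<lambda>x. f (fst x)) \<in> borel_measurable (time_prod s t)"
    and gm: "(\<lambda>x. g (fst x)) \<in> borel_measurable (time_prod s t)" by measurable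
  have "(\<lambda>k. expectation (\<lambda>w. I k w * J k w)) \<longlonglongrightarrow> expectation (\<lambda>w. Y w * Z w)"
    by (rule L2_limit_mult[OF elementary_pair_integral[OF s0 e] Ym y elementary_pair_integral[OF s0 e'] Zm z])
  moreover have "(\<lambda>k. expectation (\<lambda>w. I k w * J k w)) \<longlonglongrightarrow> (\<integral>x. f (fst x) * g (fst x) \<partial>time_prod s t)"
    unfolding elementary_pair_isometry[OF s0 e e']
    by (rule L2_limit_mult[OF elementary_pair_process[OF s0 e] fm p elementary_pair_process[OF s0 e'] gm q])
  ultimately have "expectation (\<lambda>w. Y w * Z w) = (\<integral>x. f (fst x) * g (fst x) \<partial>time_prod s t)"
    by (rule LIMSEQ_unique)
  then show ?thesis
    using integral_time_prod[of "\<lambda>u. f u * g u" s t] by simp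
qed

text \<open>Breaks a squared norm into six inner products, which the isometry can carry from one
  space to the other; the measure is arbitrary because both sides get expanded.\<close>

lemma square_of_combination:
  fixes X Y Z :: "'b \<Rightarrow> real"
  assumes "in_L2 N X" "in_L2 N Y" "in_L2 N Z"
  shows "(\<integral>x. (X x - (c * Y x + d * Z x))^2 \<partial>N) = (\<integral>x. X x * X x \<partial>N) + c^2 * (\<integral>x. Y x * Y x \<partial>N) + d^2 * (\<integral>x. Z x * Z x \<partial>N)
    - 2 * c * (\<integral>x. X x * Y x \<partial>N) - 2 * d * (\<integral>x. X x * Z x \<partial>N) + 2 * c * d * (\<integral>x. Y x * Z x \<partial>N)"
proof -
  note i = in_L2_mult[OF assms(1) assms(1)] in_L2_mult[OF assms(2) assms(2)]
    in_L2_mult[OF assms(3) assms(3)] in_L2_mult[OF assms(1) assms(2)]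
    in_L2_mult[OF assms(1) assms(3)] in_L2_mult[OF assms(2) assms(3)]
  have "(\<integral>x. (X x - (c * Y x + d * Z x))^2 \<partial>N) = (\<integral>x. X x * X x + c^2 * (Y x * Y x) + d^2 * (Z x * Z x)
    - 2 * c * (X x * Y x) - 2 * d * (X x * Z x) + 2 * c * d * (Y x * Z x) \<partial>N)"
    by (intro lint_cong) (auto simp: power2_eq_square algebra_simps)
  also have "\<dots> = (\<integral>x. X x * X x \<partial>N) + c^2 * (\<integral>x. Y x * Y x \<partial>N) + d^2 * (\<integral>x. Z x * Z x \<partial>N)
    - 2 * c * (\<integral>x. X x * Y x \<partial>N) - 2 * d * (\<integral>x. X x * Z x \<partial>N) + 2 * c * d * (\<integral>x. Y x * Z x \<partial>N)"
    by (simp only: i lint_add lint_diff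
        lintegrable_add lintegrable_diff
        integrable_mult_right integral_mult_right_zero)
  finally show ?thesis .
qed

text \<open>The isometry turns the squared norm of \<open>X - (c Y + d Z)\<close> into that of the integrands, so
  linearity and uniqueness need no manipulation of approximating sequences.\<close>

lemma ito_integral_combination:
  assumes s0: "0 \<le> s" and X: "wiener s t h X"
    and Y: "wiener s t f Y" and Z: "wiener s t g Z"
    and h: "\<And>u. u \<in> {s..t} \<Longrightarrow> h u = c * f u + d * g u"
  shows "AE w in M. X w = c * Y w + d * Z w"
proof -
  note sX = ito_integral_in_L2[OF s0 X] and sY = ito_integral_in_L2[OF s0 Y]
    and sZ = ito_integral_in_L2[OF s0 Z]
  have "expectation (\<lambda>w. (X w - (c * Y w + d * Z w))^2) = (\<integral>u. (h u - (c * f u + d * g u))^2 \<partial>leb_Icc s t)"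
    unfolding square_of_combination[OF sX(2) sY(2) sZ(2)] square_of_combination[OF sX(1) sY(1) sZ(1)]
      ito_isometry[OF s0 X X] ito_isometry[OF s0 Y Y] ito_isometry[OF s0 Z Z]
      ito_isometry[OF s0 X Y] ito_isometry[OF s0 X Z] ito_isometry[OF s0 Y Z] ..
  also have "\<dots> = (\<integral>u. 0 \<partial>leb_Icc s t)"
    by (rule lint_cong) (auto simp: space_restrict_space h)
  finally have "expectation (\<lambda>w. (X w - (c * Y w + d * Z w))^2) = 0" by simp
  moreover have "integrable M (\<lambda>w. (X w - (c * Y w + d * Z w))^2)"
    by (intro in_L2_square in_L2_diff in_L2_add in_L2_cmult sX sY sZ)
  ultimately have "AE w in M. (X w - (c * Y w + d * Z w))^2 = 0"
    by (subst (asm) integral_nonneg_eq_0_iff_AE) auto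
  then show ?thesis by eventually_elim simp
qed

lemma ito_integral_unique:
  assumes "0 \<le> s" "wiener s t f Y" "wiener s t f Z"
  shows "AE w in M. Y w = Z w"
  using ito_integral_combination[OF assms(1,2,3,3), of 1 0] by simp

text \<open>Measurability of \<open>Z\<close> is asked for separately: \<open>M\<close> need not be
  complete, so almost sure equality does not provide it.\<close>

lemma has_ito_integral_cong:
  assumes Y: "wiener s t f Y" and fg: "\<And>u. u \<in> {s..t} \<Longrightarrow> f u = g u"
    and YZ: "AE w in M. Y w = Z w" and [measurable]: "Z \<in> borel_measurable M"
  shows "wiener s t g Z"
proof -
  have "(\<lambda>(u, w). f u) \<in> borel_measurable (time_prod s t) \<longleftrightarrow> (\<lambda>(u, w). g u) \<in> borel_measurable (time_prod s t)"
    by (rule measurable_cong) (auto simp: space_pair_measure space_restrict_space fg)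
  moreover have "(\<integral>\<^sup>+u\<in>{s..t}. ennreal ((h u - f u)^2) \<partial>lborel) = (\<integral>\<^sup>+u\<in>{s..t}. ennreal ((h u - g u)^2) \<partial>lborel)" for h
    by (rule nn_integral_cong) (auto simp: fg indicator_def)
  moreover have "(\<integral>\<^sup>+w. ennreal ((h w - Y w)^2) \<partial>M) = (\<integral>\<^sup>+w. ennreal ((h w - Z w)^2) \<partial>M)" for h
    by (rule nn_integral_cong_AE) (use YZ in eventually_elim, auto)
  ultimately show ?thesis
    using Y unfolding has_ito_integral_def by simp
qed

text \<open>Places the integrals over [s, u], for all u, on the common interval [s, t], where the
  isometry can compare them. The approximations are prolonged by one cell (u, t] with coefficient
  0.\<close>

lemma ito_integral_extend:
  assumes Y: "wiener s u f Y" and s0: "0 \<le> s" and "s \<le> u" "u \<le> t"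
  shows "wiener s t (\<lambda>r. f r * indicat_real {..u} r) Y"
proof -
  from Y obtain n \<tau> \<xi> where e: "\<And>k. elementary F s u (n k) (\<tau> k) (\<xi> k)"
    and p: "(\<lambda>k. \<integral>\<^sup>+w. (\<integral>\<^sup>+r\<in>{s..u}. ennreal ((elementary_process (n k) (\<tau> k) (\<xi> k) r w - f r)^2) \<partial>lborel) \<partial>M) \<longlonglongrightarrow> 0"
    and y: "L2_lim M (\<lambda>k. elementary_integral W (n k) (\<tau> k) (\<xi> k)) Y"
    and Ym: "Y \<in> borel_measurable M"
    unfolding has_ito_integral_def by blast
  have f: "f \<in> borel_measurable (leb_Icc s u)"
    by (rule in_L2_measurable[OF ito_integral_in_L2(1)[OF s0 Y]])
  \<comment> \<open>The last point of the old partition, with index \<open>n k\<close>, is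
    \<open>u\<close>; the new point \<open>t\<close> gets the next index.\<close>
  define \<tau>' where "\<tau>' k = (\<tau> k)(Suc (n k) := t)" for k
  define \<xi>' where "\<xi>' k = (\<xi> k)(n k := (\<lambda>_. 0))" for k
  have \<tau>: "\<tau> k (n k) = u" for k using e by (simp add: elementary_def)
  have e': "elementary F s t (Suc (n k)) (\<tau>' k) (\<xi>' k)" for k
    using e[of k] \<open>u \<le> t\<close> unfolding elementary_def \<tau>'_def \<xi>'_def
    by (auto simp: less_Suc_eq)
  have ei: "elementary_integral W (Suc (n k)) (\<tau>' k) (\<xi>' k) w = elementary_integral W (n k) (\<tau> k) (\<xi> k) w" for k w
    unfolding elementary_integral_def \<tau>'_def \<xi>'_def by (auto intro!: sum.cong)
  have ep: "elementary_process (Suc (n k)) (\<tau>' k) (\<xi>' k) r w = elementary_process (n k) (\<tau> k) (\<xi> k) r w" for k r w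
    unfolding elementary_process_def \<tau>'_def \<xi>'_def by (auto intro!: sum.cong)
  have ep0: "elementary_process (n k) (\<tau> k) (\<xi> k) r w = 0" if "u < r" for k r w
    unfolding elementary_process_def
  proof (intro sum.neutral ballI)
    fix i assume "i \<in> {..<n k}"
    then have "\<tau> k (Suc i) \<le> u" using elementaryD(4)[OF s0 e, of i k] by simp
    with that show "\<xi> k i w * indicat_real {\<tau> k i<..\<tau> k (Suc i)} r = 0" by simp
  qed
  have inner: "(\<integral>\<^sup>+r\<in>{s..t}. ennreal ((elementary_process (Suc (n k)) (\<tau>' k) (\<xi>' k) r w - f r * indicat_real {..u} r)^2) \<partial>lborel)
    = (\<integral>\<^sup>+r\<in>{s..u}. ennreal ((elementary_process (n k) (\<tau> k) (\<xi> k) r w - f r)^2) \<partial>lborel)" for k w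
    unfolding ep by (rule nn_integral_cong) (use ep0[of _ k w] \<open>u \<le> t\<close> in \<open>auto simp: indicator_def\<close>)
  have "(\<lambda>r. f r * indicat_real {..u} r) \<in> borel_measurable (leb_Icc s t)"
  proof -
    \<comment> \<open>\<open>f\<close> is only known to be measurable on [s, u]; extended by 0 it
      becomes Borel measurable on the line.\<close>
    have "(\<lambda>r. f r * indicator {s..u} r) \<in> borel_measurable borel"
      using f by (subst (asm) borel_measurable_restrict_space_iff) (auto simp: mult.commute)
    then have "(\<lambda>r. f r * indicator {s..u} r) \<in> borel_measurable (leb_Icc s t)"
      by (rule measurable_leb_Icc)
    then show ?thesis
      by (subst measurable_cong[where g="\<lambda>r. f r * indicator {s..u} r"]) (auto simp: space_restrict_space indicator_def)
  qed
  then have "(\<lambda>(r, w). f r * indicat_real {..u} r) \<in> borel_measurable (time_prod s t)"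
    by (simp add: split_def)
  with p y Ym e' show ?thesis
    unfolding has_ito_integral_def
    by (intro conjI exI[of _ "\<lambda>k. Suc (n k)"] exI[of _ \<tau>'] exI[of _ \<xi>']) (simp_all add: inner ei)
qed

lemma elementary_deterministic:
  assumes "s \<le> t"
  shows "elementary F s t (Suc k) (uniform_grid s t k) (\<lambda>i _. c i)"
  using assms unfolding elementary_def uniform_grid_def
  by (auto intro!: divide_right_mono mult_left_mono)

lemma elementary_isometry_deterministic:
  assumes "0 \<le> s" and e: "elementary F s t n \<tau> (\<lambda>i _. c i)" and e': "elementary F s t n' \<tau>' (\<lambda>i _. c' i)"
  shows "expectation (\<lambda>w. elementary_integral W n \<tau> (\<lambda>i _. c i) w * elementary_integral W n' \<tau>' (\<lambda>i _. c' i) w)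
    = (\<integral>u. step_function n \<tau> c u * step_function n' \<tau>' c' u \<partial>leb_Icc s t)"
proof -
  have "(\<lambda>u. step_function n \<tau> c u * step_function n' \<tau>' c' u) \<in> borel_measurable (leb_Icc s t)"
    by (rule measurable_leb_Icc) simp
  from integral_time_prod[OF this] show ?thesis
    unfolding elementary_isometry[OF assms] elementary_process_const by (simp add: split_def)
qed

text \<open>Step functions approximate \<open>f\<close>, the isometry makes their integrals a Cauchy
  sequence, and completeness supplies \<open>Y\<close>. The approximations are part of the
  conclusion because the characteristic function is computed on deterministic coefficients.\<close>

lemma ito_integral_exists:
  assumes s0: "0 \<le> s" and "s \<le> t" and f: "in_L2 (leb_Icc s t) f"
  obtains n \<tau> c Y where "\<And>k. elementary F s t (n k) (\<tau> k) (\<lambda>i _. c k i)"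
    "(\<lambda>k. \<integral>\<^sup>+u. ennreal ((step_function (n k) (\<tau> k) (c k) u - f u)^2) \<partial>leb_Icc s t) \<longlonglongrightarrow> 0"
    "L2_lim M (\<lambda>k. elementary_integral W (n k) (\<tau> k) (\<lambda>i _. c k i)) Y"
    "wiener s t f Y"
proof -
  have fm[measurable]: "f \<in> borel_measurable (leb_Icc s t)"
    by (rule in_L2_measurable[OF f])
  have "\<exists>k c. (\<integral>\<^sup>+u. ennreal ((step_function (Suc k) (uniform_grid s t k) c u - f u)^2) \<partial>leb_Icc s t)
    < ennreal (1 / real (Suc j))" for j
    using step_approximable_in_L2[OF f] unfolding step_approximable_def
    by (meson order_refl zero_less_divide_1_iff of_nat_0_less_iff zero_less_Suc)
  then obtain k c where kc: "\<And>j. (\<integral>\<^sup>+u. ennreal ((uniform_step s t (k j) (c j) u - f u)^2) \<partial>leb_Icc s t)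
    < ennreal (1 / real (Suc j))" by metis
  define S where "S j = uniform_step s t (k j) (c j)" for j
  define I where "I j = elementary_integral W (Suc (k j)) (uniform_grid s t (k j)) (\<lambda>i _. c j i)" for j
  have e: "elementary F s t (Suc (k j)) (uniform_grid s t (k j)) (\<lambda>i _. c j i)" for j
    by (rule elementary_deterministic[OF \<open>s \<le> t\<close>])
  have sI: "in_L2 M (I j)" for j
    unfolding I_def by (rule in_L2_elementary_integral[OF s0 e])
  have sS: "in_L2 (leb_Icc s t) (S j)" for j
    unfolding S_def by (rule in_L2_step_function)
  have lim: "(\<lambda>j. L2_dist s t (S j) f) \<longlonglongrightarrow> 0"
  proof (rule tendsto_sandwich[OF always_eventually always_eventually tendsto_const])
    show "(\<lambda>j. ennreal (1 / real (Suc j))) \<longlonglongrightarrow> 0"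
      using tendsto_ennrealI[OF LIMSEQ_Suc[OF lim_1_over_n]] by simp
  qed (use kc in \<open>auto simp: S_def intro: less_imp_le\<close>)
  \<comment> \<open>The instance c = 1, d = 0 of \<open>square_of_combination\<close> on both
    spaces; the isometry matches the inner products.\<close>
  have I2: "expectation (\<lambda>w. (I i w - I j w)^2) = (\<integral>u. (S i u - S j u)^2 \<partial>leb_Icc s t)" for i j
    using square_of_combination[OF sI[of i] sI[of j] sI[of j], of 1 0]
      square_of_combination[OF sS[of i] sS[of j] sS[of j], of 1 0]
    unfolding I_def S_def by (simp add: elementary_isometry_deterministic[OF s0 e e])
  have cau: "\<exists>N. \<forall>i\<ge>N. \<forall>j\<ge>N. expectation (\<lambda>w. (I i w - I j w)^2) \<le> \<epsilon>" if "0 < \<epsilon>" for \<epsilon>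
  proof -
    from order_tendstoD(2)[OF lim, of "ennreal (\<epsilon>/4)"] that obtain N where
      N: "\<And>j. j \<ge> N \<Longrightarrow> L2_dist s t (S j) f < ennreal (\<epsilon>/4)"
      by (auto simp: eventually_sequentially)
    have "expectation (\<lambda>w. (I i w - I j w)^2) \<le> \<epsilon>" if ij: "N \<le> i" "N \<le> j" for i j
    proof -
      have [measurable]: "S j \<in> borel_measurable (leb_Icc s t)" for j
        by (rule in_L2_measurable[OF sS])
      have "L2_dist s t (S i) (S j) < ennreal \<epsilon>"
        by (rule nn_integral_square_add_le[of "\<lambda>u. S i u - f u" _ "\<lambda>u. f u - S j u"])
          (use N[OF ij(1)] N[OF ij(2)] in \<open>simp_all add: power2_commute\<close>)
      then show ?thesis
        unfolding I2 in_L2_nn_eq[OF in_L2_diff[OF sS sS]]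
        using \<open>0 < \<epsilon>\<close> by (subst (asm) ennreal_less_iff) auto
    qed
    then show ?thesis by blast
  qed
  from L2_complete[OF sI cau] obtain Y where Y: "Y \<in> borel_measurable M"
    "L2_lim M I Y" by blast
  have "wiener s t f Y"
    unfolding has_ito_integral_def
  proof (intro conjI exI[of _ "\<lambda>j. Suc (k j)"] exI[of _ "\<lambda>j. uniform_grid s t (k j)"] exI[of _ "\<lambda>j i _. c j i"] allI e Y(1))
    show "(\<lambda>(u, w). f u) \<in> borel_measurable (time_prod s t)"
      by (simp add: split_def)
    show "L2_lim M (\<lambda>j. elementary_integral W (Suc (k j)) (uniform_grid s t (k j)) (\<lambda>i _. c j i)) Y"
      using Y(2) unfolding I_def .
    have eq: "(\<integral>\<^sup>+u\<in>{s..t}. ennreal ((elementary_process (Suc (k j)) (uniform_grid s t (k j)) (\<lambda>i _. c j i) u w - f u)^2) \<partial>lborel)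
      = L2_dist s t (S j) f" for j w
      unfolding elementary_process_const S_def by (rule nn_integral_restrict_space[symmetric]) simp
    show "(\<lambda>j. \<integral>\<^sup>+w. (\<integral>\<^sup>+u\<in>{s..t}. ennreal ((elementary_process (Suc (k j)) (uniform_grid s t (k j)) (\<lambda>i _. c j i) u w - f u)^2) \<partial>lborel) \<partial>M) \<longlonglongrightarrow> 0"
      unfolding eq using lim by (simp add: emeasure_space_1)
  qed
  from that[OF e lim[unfolded S_def] Y(2)[unfolded I_def] this] show thesis .
qed

end

section \<open>The law of the Ito integral\<close>

lemma normal_law_distributed:
  assumes "0 < v"
  shows "prob_space (normal_law 0 v)"
    and "distributed (normal_law 0 v) lborel (\<lambda>x. x) (normal_density 0 (sqrt v))"
proof -
  show "prob_space (normal_law 0 v)"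
    using assms by (simp add: normal_law_def prob_space_normal_density)
  show "distributed (normal_law 0 v) lborel (\<lambda>x. x) (normal_density 0 (sqrt v))"
    using assms by (auto simp: distributed_def normal_law_def distr_id2)
qed

text \<open>Reduces any mean to 0, also in the degenerate case. As the image of a fixed law under a
  shift, the kernel in \<open>cond_law\<close> is seen to be measurable in the mean.\<close>

lemma normal_law_shift: "0 \<le> v \<Longrightarrow> normal_law \<mu> v = distr (normal_law 0 v) borel (\<lambda>y. \<mu> + y)"
proof (cases "v = 0")
  case True
  then show ?thesis by (simp add: normal_law_def distr_return)
next
  case False
  assume "0 \<le> v"
  with False have v: "0 < v" by simp
  interpret prob_space "normal_law 0 v" by (rule normal_law_distributed(1)[OF v])
  have "distributed (normal_law 0 v) lborel (\<lambda>x. \<mu> + 1 * x) (normal_density (\<mu> + 1 * 0) (\<bar>1\<bar> * sqrt v))"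
    by (rule normal_density_affine[OF normal_law_distributed(2)[OF v]]) (use v in auto)
  then have "distr (normal_law 0 v) lborel (\<lambda>x. \<mu> + x) = density lborel (normal_density \<mu> (sqrt v))"
    by (simp add: distributed_distr_eq_density)
  moreover have "distr (normal_law 0 v) lborel (\<lambda>x. \<mu> + x) = distr (normal_law 0 v) borel (\<lambda>x. \<mu> + x)"
    by (rule distr_cong) auto
  ultimately show ?thesis using v by (simp add: normal_law_def)
qed

lemma real_distribution_normal_law: "0 \<le> v \<Longrightarrow> real_distribution (normal_law \<mu> v)"
  by (cases "v = 0")
    (auto simp: real_distribution_def real_distribution_axioms_def normal_law_def prob_space_normal_density prob_space_return)

text \<open>Scaling by sqrt v reduces to the standard normal law; for v = 0 the point mass obeys the
  same formula.\<close>

lemma char_normal_law: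
  assumes "0 \<le> v"
  shows "char (normal_law 0 v) \<theta> = complex_of_real (exp (- (\<theta>^2 * v / 2)))"
proof (cases "v = 0")
  case True
  then show ?thesis by (simp add: char_def normal_law_def integral_return)
next
  case False
  with assms have v: "0 < v" by simp
  interpret prob_space "normal_law 0 v" by (rule normal_law_distributed(1)[OF v])
  have "distributed (normal_law 0 v) lborel (\<lambda>x. (x - 0) / sqrt v) std_normal_density"
    using normal_law_distributed(2)[OF v] v by (subst normal_standard_normal_convert[symmetric]) auto
  then have d: "distr (normal_law 0 v) lborel (\<lambda>x. x / sqrt v) = std_normal_distribution"
    by (simp add: distributed_distr_eq_density)
  have s: "sets (normal_law 0 v) = sets borel"
    using v by (simp add: normal_law_def)
  have m: "(\<lambda>x. x / sqrt v) \<in> normal_law 0 v \<rightarrow>\<^sub>M lborel"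
    unfolding measurable_cong_sets[OF s sets_lborel] by measurable
  have "char std_normal_distribution (\<theta> * sqrt v) = (CLINT x|normal_law 0 v. iexp (\<theta> * sqrt v * (x / sqrt v)))"
    unfolding d[symmetric] char_def by (rule integral_distr[OF m]) measurable
  also have "\<dots> = char (normal_law 0 v) \<theta>"
    using v by (simp add: char_def)
  finally show ?thesis
    using v by (simp add: char_std_normal_distribution power_mult_distrib)
qed

text \<open>Bounds the error in characteristic functions by an L1 distance, hence by an L2
  distance.\<close>

lemma iexp_lipschitz: "cmod (iexp x - iexp y) \<le> \<bar>x - y\<bar>"
proof -
  have "iexp x - iexp y = iexp y * (iexp (x - y) - 1)"
    by (simp add: algebra_simps exp_add[symmetric])
  then have "cmod (iexp x - iexp y) = cmod (iexp (x - y) - 1)"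
    by (simp add: norm_mult)
  also have "\<dots> \<le> \<bar>x - y\<bar>"
    using iexp_approx1[of "x - y" 0] by simp
  finally show ?thesis .
qed

context brownian_motion
begin

lemma increment_char:
  assumes "0 \<le> p" "p \<le> q"
  shows "expectation (\<lambda>w. iexp (\<theta> * (W q w - W p w))) = complex_of_real (exp (- (\<theta>^2 * (q - p) / 2)))"
proof (cases "p = q")
  case True
  then show ?thesis by (simp add: prob_space)
next
  case False
  with assms have lt: "p < q" by simp
  have [measurable]: "(\<lambda>w. W q w - W p w) \<in> borel_measurable M"
    by (rule increment_measurable[OF assms])
  have "distr M lborel (\<lambda>w. W q w - W p w) = normal_law 0 (q - p)"
    using normal_increments[OF assms(1) lt] lt by (simp add: distributed_distr_eq_density normal_law_def)
  then have "char (normal_law 0 (q - p)) \<theta> = (CLINT x|distr M lborel (\<lambda>w. W q w - W p w). iexp (\<theta> * x))"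
    by (simp add: char_def)
  also have "\<dots> = expectation (\<lambda>w. iexp (\<theta> * (W q w - W p w)))"
    by (rule integral_distr) measurable
  finally show ?thesis
    using char_normal_law[of "q - p" \<theta>] lt by simp
qed

text \<open>Induction on the number of increments: each new factor is independent of everything
  known at its left endpoint, and that includes \<open>A\<close>.\<close>

lemma elementary_integral_char:
  assumes s0: "0 \<le> s" and e: "elementary F s t n \<tau> (\<lambda>i _. c i)" and A: "A \<in> sets (F s)"
  shows "expectation (\<lambda>w. indicator A w * iexp (\<theta> * elementary_integral W n \<tau> (\<lambda>i _. c i) w))
    = complex_of_real (prob A * exp (- (\<theta>^2 * (\<Sum>i<n. (c i)^2 * (\<tau> (Suc i) - \<tau> i)) / 2)))"
proof -
  define Z where "Z m w = (indicator A w * iexp (\<theta> * elementary_integral W m \<tau> (\<lambda>i _. c i) w))" for m w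
  have AM: "A \<in> sets M" using A subalgebra_F[OF s0] by (auto simp: subalgebra_def)
  have meas: "m < n \<Longrightarrow> Z m \<in> borel_measurable (F (\<tau> m))" for m
  proof -
    assume m: "m < n"
    note em = elementaryD[OF s0 e m]
    have "elementary_integral W m \<tau> (\<lambda>i _. c i) \<in> borel_measurable (F (\<tau> m))"
      unfolding elementary_integral_def[abs_def]
    proof (intro borel_measurable_sum borel_measurable_times borel_measurable_diff measurable_const)
      fix i assume "i \<in> {..<m}"
      then have i: "i < m" by simp
      with m have "i < n" by simp
      have mono: "\<tau> (Suc i) \<le> \<tau> m"
        using i m
      proof (induction m)
        case (Suc m)
        then show ?case
          using elementaryD(3)[OF s0 e, of m] by (cases "i = m") auto
      qed simp
      note ei = elementaryD[OF s0 e \<open>i < n\<close>]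
      show "W (\<tau> (Suc i)) \<in> borel_measurable (F (\<tau> m))" "W (\<tau> i) \<in> borel_measurable (F (\<tau> m))"
        by (rule W_measurable_F[OF order_trans[OF ei(1,3)] mono] W_measurable_F[OF ei(1) order_trans[OF ei(3) mono]])+
    qed simp
    moreover have "A \<in> sets (F (\<tau> m))"
      using A F_mono[OF s0 em(2)] by (auto simp: subalgebra_def)
    ultimately show ?thesis unfolding Z_def[abs_def] by measurable
  qed
  have "expectation (Z m) = complex_of_real (prob A * exp (- (\<theta>^2 * (\<Sum>i<m. (c i)^2 * (\<tau> (Suc i) - \<tau> i)) / 2)))"
    if "m \<le> n" for m
    using that
  proof (induction m)
    case 0
    have "Z 0 = (\<lambda>w. complex_of_real (indicator A w))"
      by (auto simp: fun_eq_iff Z_def elementary_integral_def indicator_def)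
    then have "expectation (Z 0) = complex_of_real (expectation (indicator A))"
      by (simp del: of_real_indicator)
    then show ?case using AM by simp
  next
    case (Suc m)
    then have m: "m < n" by simp
    note em = elementaryD[OF s0 e m]
    define V where "V w = iexp (\<theta> * c m * (W (\<tau> (Suc m)) w - W (\<tau> m) w))" for w
    have Zm: "Z m \<in> borel_measurable M"
      by (rule F_measurable[OF em(1) meas[OF m]])
    have iZ: "integrable M (Z m)"
      by (rule integrable_const_bound[where B=1, OF _ Zm]) (auto simp: Z_def norm_mult indicator_def)
    have Vm: "V \<in> borel_measurable M"
      unfolding V_def[abs_def] using increment_measurable[OF em(1,3)] by measurable
    have iV: "integrable M V"
      by (rule integrable_const_bound[where B=1, OF _ Vm]) (auto simp: V_def norm_mult)
    have split: "Z (Suc m) = (\<lambda>w. Z m w * V w)"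
      by (auto simp: fun_eq_iff Z_def V_def elementary_integral_def algebra_simps exp_add[symmetric])
    have "expectation (Z (Suc m)) = expectation (Z m) * expectation V"
    proof (cases "\<tau> m = \<tau> (Suc m)")
      case True
      then have "V = (\<lambda>_. 1)" by (simp add: fun_eq_iff V_def)
      then show ?thesis unfolding split by (simp add: prob_space)
    next
      case False
      then have lt: "\<tau> m < \<tau> (Suc m)" using em(3) by simp
      have "indep_var borel (Z m) borel V"
        unfolding V_def[abs_def]
        by (rule indep_var_increment[OF em(1) lt meas[OF m], where g="\<lambda>x. iexp (\<theta> * c m * x)"]) measurable
      from indep_var_lebesgue_integral[OF this iZ iV] show ?thesis
        unfolding split .
    qed
    also have "expectation V = complex_of_real (exp (- ((\<theta> * c m)^2 * (\<tau> (Suc m) - \<tau> m) / 2)))"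
      unfolding V_def by (rule increment_char[OF em(1,3)])
    also have "expectation (Z m) = complex_of_real (prob A * exp (- (\<theta>^2 * (\<Sum>i<m. (c i)^2 * (\<tau> (Suc i) - \<tau> i)) / 2)))"
      using Suc by simp
    finally have *: "expectation (Z (Suc m)) = complex_of_real (prob A * exp (- (\<theta>^2 * (\<Sum>i<m. (c i)^2 * (\<tau> (Suc i) - \<tau> i)) / 2))
      * exp (- ((\<theta> * c m)^2 * (\<tau> (Suc m) - \<tau> m) / 2)))"
      by simp
    have "exp (- (\<theta>^2 * S / 2)) * exp (- ((\<theta> * c m)^2 * x / 2)) = exp (- (\<theta>^2 * (S + (c m)^2 * x) / 2))" for S x
      by (simp add: exp_add[symmetric] power_mult_distrib algebra_simps add_divide_distrib)
    then show ?case unfolding * by (simp add: mult.assoc)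
  qed
  from this[of n] show ?thesis unfolding Z_def by simp
qed

text \<open>The cells are disjoint, so the square of the sum has no mixed terms.\<close>

lemma elementary_integral_variance:
  assumes "0 \<le> s" and e: "elementary F s t n \<tau> (\<lambda>i _. c i)"
  shows "(\<Sum>i<n. (c i)^2 * (\<tau> (Suc i) - \<tau> i)) = (\<integral>u. (step_function n \<tau> c u)^2 \<partial>leb_Icc s t)"
proof -
  note D = elementaryD[OF \<open>0 \<le> s\<close> e]
  have mono: "\<tau> (Suc i) \<le> \<tau> j" if "i < j" "j < n" for i j
    using that
  proof (induction j)
    case (Suc j)
    then show ?case using D(3)[of j] by (cases "i = j") auto
  qed simp
  have sq: "(step_function n \<tau> c u)^2 = (\<Sum>i<n. (c i)^2 * indicat_real {\<tau> i<..\<tau> (Suc i)} u)" for u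
  proof -
    have "(step_function n \<tau> c u)^2 = (\<Sum>i<n. \<Sum>j<n. if j = i then (c i)^2 * indicat_real {\<tau> i<..\<tau> (Suc i)} u else 0)"
      unfolding step_function_def power2_eq_square sum_product
    proof (intro sum.cong refl)
      fix i j assume ij: "i \<in> {..<n}" "j \<in> {..<n}"
      have "\<not> (u \<in> {\<tau> i<..\<tau> (Suc i)} \<and> u \<in> {\<tau> j<..\<tau> (Suc j)})" if "i \<noteq> j"
        using mono[of i j] mono[of j i] ij that by (cases "i < j") auto
      then show "c i * indicat_real {\<tau> i<..\<tau> (Suc i)} u * (c j * indicat_real {\<tau> j<..\<tau> (Suc j)} u) =
           (if j = i then c i * c i * indicat_real {\<tau> i<..\<tau> (Suc i)} u else 0)"
        by (auto simp: indicator_def)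
    qed
    then show ?thesis by simp
  qed
  have "(\<integral>u. indicat_real {\<tau> i<..\<tau> (Suc i)} u \<partial>leb_Icc s t) = \<tau> (Suc i) - \<tau> i"
    and "integrable (leb_Icc s t) (indicat_real {\<tau> i<..\<tau> (Suc i)})" if "i < n" for i
  proof -
    have eq: "indicator {s..t} u *\<^sub>R indicat_real {\<tau> i<..\<tau> (Suc i)} u = indicat_real {\<tau> i<..\<tau> (Suc i)} u" for u
      using D(2,4)[OF that] by (auto simp: indicator_def)
    show "(\<integral>u. indicat_real {\<tau> i<..\<tau> (Suc i)} u \<partial>leb_Icc s t) = \<tau> (Suc i) - \<tau> i"
      by (subst integral_restrict_space) (simp, simp only: eq, use D(3)[OF that] in simp)
    show "integrable (leb_Icc s t) (indicat_real {\<tau> i<..\<tau> (Suc i)})"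
      by (subst integrable_restrict_space) (simp, simp only: eq, use D(3)[OF that] in simp)
  qed
  then show ?thesis
    unfolding sq by (subst lint_sum) auto
qed

text \<open>The witnesses for \<open>Y\<close> may have random coefficients, so the limit is taken
  along a version \<open>X\<close> with deterministic ones, and uniqueness brings the result back to
  \<open>Y\<close>.\<close>

lemma ito_integral_char:
  assumes s0: "0 \<le> s" and "s \<le> t" and Y: "wiener s t f Y" and A: "A \<in> sets (F s)"
  shows "expectation (\<lambda>w. indicator A w * iexp (\<theta> * Y w))
    = complex_of_real (prob A * exp (- (\<theta>^2 * (\<integral>u. (f u)^2 \<partial>leb_Icc s t) / 2)))"
proof -
  note sfY = ito_integral_in_L2[OF s0 Y]
  have fm: "f \<in> borel_measurable (leb_Icc s t)" by (rule in_L2_measurable[OF sfY(1)])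
  from ito_integral_exists[OF assms(1,2) sfY(1)] obtain n \<tau> c X where
    e: "\<And>k. elementary F s t (n k) (\<tau> k) (\<lambda>i _. c k i)" and
    sl: "(\<lambda>k. \<integral>\<^sup>+u. ennreal ((step_function (n k) (\<tau> k) (c k) u - f u)^2) \<partial>leb_Icc s t) \<longlonglongrightarrow> 0" and
    xl: "L2_lim M (\<lambda>k. elementary_integral W (n k) (\<tau> k) (\<lambda>i _. c k i)) X" and
    X: "wiener s t f X" by blast
  define I where "I k = elementary_integral W (n k) (\<tau> k) (\<lambda>i _. c k i)" for k
  note sX = ito_integral_in_L2(2)[OF s0 X]
  have sI: "in_L2 M (I k)" for k
    unfolding I_def by (rule in_L2_elementary_integral[OF s0 e])
  have [measurable]: "X \<in> borel_measurable M" "I k \<in> borel_measurable M" "Y \<in> borel_measurable M" for k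
    using in_L2_measurable[OF sX] in_L2_measurable[OF sI] in_L2_measurable[OF sfY(2)] by auto
  have [measurable]: "A \<in> sets M" using A subalgebra_F[OF s0] by (auto simp: subalgebra_def)
  \<comment> \<open>Norms converge along with the functions: \<open>L2_limit_mult\<close> for two
    copies of the same sequence.\<close>
  have v: "(\<lambda>k. \<integral>u. (step_function (n k) (\<tau> k) (c k) u)^2 \<partial>leb_Icc s t) \<longlonglongrightarrow> (\<integral>u. (f u)^2 \<partial>leb_Icc s t)"
    using L2_limit_mult[OF in_L2_step_function fm sl in_L2_step_function fm sl]
    by (simp add: power2_eq_square)
  have "(\<lambda>k. expectation (\<lambda>w. indicator A w * iexp (\<theta> * I k w)))
    \<longlonglongrightarrow> complex_of_real (prob A * exp (- (\<theta>^2 * (\<integral>u. (f u)^2 \<partial>leb_Icc s t) / 2)))"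
    unfolding I_def elementary_integral_char[OF s0 e A] elementary_integral_variance[OF s0 e]
    by (intro tendsto_intros v) simp
  moreover have "(\<lambda>k. expectation (\<lambda>w. indicator A w * iexp (\<theta> * I k w))) \<longlonglongrightarrow> expectation (\<lambda>w. indicator A w * iexp (\<theta> * X w))"
  proof (rule LIM_zero_cancel, rule Lim_null_comparison[OF always_eventually[OF allI]])
    have "(\<lambda>k. \<integral>w. (I k w - X w)^2 \<partial>M) \<longlonglongrightarrow> 0"
      by (rule L2_limit_tendsto[OF sI]) (use xl in \<open>simp_all add: I_def\<close>)
    from tendsto_mult_right_zero[OF tendsto_real_sqrt[OF this, simplified]]
    show "(\<lambda>k. \<bar>\<theta>\<bar> * sqrt (\<integral>w. (I k w - X w)^2 \<partial>M)) \<longlonglongrightarrow> 0" .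
    have int: "integrable M (\<lambda>w. indicator A w * iexp (\<theta> * h w))" if [measurable]: "h \<in> borel_measurable M" for h
      by (rule integrable_const_bound[where B=1]) (auto simp: norm_mult indicator_def)
    fix k
    note d = in_L2_diff[OF sI[of k] sX]
    have "norm (expectation (\<lambda>w. indicator A w * iexp (\<theta> * I k w)) - expectation (\<lambda>w. indicator A w * iexp (\<theta> * X w)))
      = norm (expectation (\<lambda>w. indicator A w * iexp (\<theta> * I k w) - indicator A w * iexp (\<theta> * X w)))"
      by (subst lint_diff[OF int int]) simp_all
    also have "\<dots> \<le> expectation (\<lambda>w. \<bar>\<theta>\<bar> * \<bar>I k w - X w\<bar>)"
    proof (rule order_trans[OF integral_norm_bound integral_mono])
      show "integrable M (\<lambda>w. norm (indicator A w * iexp (\<theta> * I k w) - indicator A w * iexp (\<theta> * X w)))"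
        by (intro integrable_norm lintegrable_diff int) simp_all
      show "integrable M (\<lambda>w. \<bar>\<theta>\<bar> * \<bar>I k w - X w\<bar>)"
        using L1_le_L2(1)[OF d] by simp
      show "norm (indicator A w * iexp (\<theta> * I k w) - indicator A w * iexp (\<theta> * X w)) \<le> \<bar>\<theta>\<bar> * \<bar>I k w - X w\<bar>" for w
        using iexp_lipschitz[of "\<theta> * I k w" "\<theta> * X w"]
        by (auto simp: indicator_def abs_mult[symmetric] right_diff_distrib)
    qed
    also have "\<dots> \<le> \<bar>\<theta>\<bar> * sqrt (\<integral>w. (I k w - X w)^2 \<partial>M)"
      using L1_le_L2(2)[OF d] by (simp add: mult_left_mono)
    finally show "norm (expectation (\<lambda>w. indicator A w * iexp (\<theta> * I k w)) - expectation (\<lambda>w. indicator A w * iexp (\<theta> * X w)))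
      \<le> \<bar>\<theta>\<bar> * sqrt (\<integral>w. (I k w - X w)^2 \<partial>M)" .
  qed
  ultimately have "expectation (\<lambda>w. indicator A w * iexp (\<theta> * X w))
    = complex_of_real (prob A * exp (- (\<theta>^2 * (\<integral>u. (f u)^2 \<partial>leb_Icc s t) / 2)))"
    using LIMSEQ_unique by blast
  moreover have "expectation (\<lambda>w. indicator A w * iexp (\<theta> * X w)) = expectation (\<lambda>w. indicator A w * iexp (\<theta> * Y w))"
    by (rule integral_cong_AE) (use ito_integral_unique[OF s0 X Y] in \<open>auto elim: eventually_mono\<close>)
  ultimately show ?thesis by simp
qed

text \<open>The characteristic function is computed under the conditioned measure for each event of
  \<open>F s\<close>, which yields normality and independence at once.\<close>

lemma ito_integral_law:
  assumes s0: "0 \<le> s" and "s \<le> t" and Y: "wiener s t f Y"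
    and A: "A \<in> sets (F s)" and B: "B \<in> sets borel"
  shows "prob (A \<inter> (Y -` B \<inter> space M)) = prob A * measure (normal_law 0 (\<integral>u. (f u)^2 \<partial>leb_Icc s t)) B"
proof (cases "prob A = 0")
  case True
  have "A \<in> sets M" using A subalgebra_F[OF s0] by (auto simp: subalgebra_def)
  then have "prob (A \<inter> (Y -` B \<inter> space M)) \<le> prob A"
    by (intro finite_measure_mono) auto
  with True show ?thesis by (simp add: measure_le_0_iff)
next
  case False
  define v where "v = (\<integral>u. (f u)^2 \<partial>leb_Icc s t)"
  have "0 \<le> v" by (simp add: v_def)
  have AM[measurable]: "A \<in> sets M" using A subalgebra_F[OF s0] by (auto simp: subalgebra_def)
  have [measurable]: "Y \<in> borel_measurable M"
    by (rule in_L2_measurable[OF ito_integral_in_L2(2)[OF s0 Y]])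
  let ?U = "uniform_measure M A"
  have eA: "emeasure M A \<noteq> 0" using False by (simp add: emeasure_eq_measure)
  have U: "prob_space ?U"
    by (rule prob_space_uniform_measure[OF eA]) simp
  \<comment> \<open>Writing the conditioned measure as a density turns its characteristic function
    into an expectation restricted to \<open>A\<close>.\<close>
  have "1 / ennreal (prob A) = ennreal (1 / prob A)"
    using False divide_ennreal[of 1 "prob A"] by (simp add: zero_less_measure_iff)
  then have U': "?U = density M (\<lambda>w. ennreal (indicator A w / prob A))"
    unfolding uniform_measure_def
    by (intro arg_cong2[where f=density] refl ext) (auto simp: emeasure_eq_measure indicator_def)
  have "distr ?U borel Y = normal_law 0 v"
  proof (rule Levy_uniqueness)
    show "real_distribution (distr ?U borel Y)"
      by (intro prob_space.real_distribution_distr[OF U]) simp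
    show "real_distribution (normal_law 0 v)"
      by (rule real_distribution_normal_law) fact
    show "char (distr ?U borel Y) = char (normal_law 0 v)"
    proof
      fix \<theta>
      have "char (distr ?U borel Y) \<theta> = (CLINT w|?U. iexp (\<theta> * Y w))"
        unfolding char_def by (rule integral_distr) measurable
      also have "\<dots> = expectation (\<lambda>w. (indicator A w / prob A) *\<^sub>R iexp (\<theta> * Y w))"
        unfolding U' by (rule integral_density) auto
      also have "\<dots> = expectation (\<lambda>w. indicator A w * iexp (\<theta> * Y w) / complex_of_real (prob A))"
        by (intro lint_cong) (auto simp: indicator_def scaleR_conv_of_real)
      also have "\<dots> = expectation (\<lambda>w. indicator A w * iexp (\<theta> * Y w)) / complex_of_real (prob A)"
        by simp
      also have "\<dots> = char (normal_law 0 v) \<theta>"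
        unfolding ito_integral_char[OF assms(1,2) Y A] v_def[symmetric] char_normal_law[OF \<open>0 \<le> v\<close>]
        using False by simp
      finally show "char (distr ?U borel Y) \<theta> = char (normal_law 0 v) \<theta>" .
    qed
  qed
  then have "measure (normal_law 0 v) B = measure (distr ?U borel Y) B" by simp
  also have "\<dots> = measure ?U (Y -` B \<inter> space M)"
    using B by (subst measure_distr) auto
  also have "\<dots> = prob (A \<inter> (Y -` B \<inter> space M)) / prob A"
    using B eA by (subst measure_uniform_measure) auto
  finally show ?thesis using False by (simp add: v_def)
qed

end

section \<open>The conditional law of a shifted normal variable\<close>

text \<open>With C the whole line, \<open>indep\<close> yields the law of \<open>Y\<close>, and so
  it says that \<open>X\<close> and \<open>Y\<close> are independent. The joint law is then a
  product, and integrating out the second factor at X = x leaves the centred normal law shifted by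
  \<open>a x\<close>.\<close>

lemma (in prob_space) cond_law_shift_normal:
  fixes X Y Z :: "'a \<Rightarrow> real"
  assumes X[measurable]: "X \<in> borel_measurable M" and Y[measurable]: "Y \<in> borel_measurable M"
    and Z[measurable]: "Z \<in> borel_measurable M" and a[measurable]: "a \<in> borel_measurable borel" and v0: "0 \<le> v"
    and ZY: "AE w in M. Z w = a (X w) + Y w"
    and indep: "\<And>C B. C \<in> sets borel \<Longrightarrow> B \<in> sets borel \<Longrightarrow>
      prob ((X -` C \<inter> space M) \<inter> (Y -` B \<inter> space M)) = prob (X -` C \<inter> space M) * measure (normal_law 0 v) B"
  shows "cond_law M X Z (\<lambda>x. normal_law (a x) v)"
proof -
  let ?N = "normal_law 0 v"
  interpret N: real_distribution ?N by (rule real_distribution_normal_law) fact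
  have Np: "?N \<in> space (prob_algebra borel)"
    by (simp add: space_prob_algebra N.prob_space_axioms)
  \<comment> \<open>Measurability of the kernel: a fixed law is pushed forward by a map that depends
    measurably on x.\<close>
  have "(\<lambda>x. distr ?N borel (\<lambda>y. a x + y)) \<in> borel \<rightarrow>\<^sub>M prob_algebra borel"
    by (rule measurable_distr_prob_space2[where M=borel]) (use Np in auto)
  then have kernel: "(\<lambda>x. normal_law (a x) v) \<in> borel \<rightarrow>\<^sub>M prob_algebra borel"
    unfolding normal_law_shift[OF v0, symmetric] .
  have distrY: "distr M borel Y = ?N"
  proof (rule measure_eqI)
    fix B assume "B \<in> sets (distr M borel Y)"
    then have B: "B \<in> sets borel" by simp
    from indep[OF _ B, of UNIV] have "prob (Y -` B \<inter> space M) = measure ?N B"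
      by (simp add: prob_space Int_absorb1)
    with B show "emeasure (distr M borel Y) B = emeasure ?N B"
      by (simp add: emeasure_distr emeasure_eq_measure N.emeasure_eq_measure)
  qed simp
  have "indep_var borel X borel Y"
    unfolding indep_var_eq
  proof (intro conjI indep_set_sigma_sets Int_stable_vimage X Y)
    show "indep_set {X -` A \<inter> space M |A. A \<in> sets borel} {Y -` A \<inter> space M |A. A \<in> sets borel}"
    proof (rule indep_setI)
      fix A B assume "A \<in> {X -` A \<inter> space M |A. A \<in> sets borel}" "B \<in> {Y -` A \<inter> space M |A. A \<in> sets borel}"
      then obtain C D where A: "A = X -` C \<inter> space M" "C \<in> sets borel" and B: "B = Y -` D \<inter> space M" "D \<in> sets borel"
        by auto
      have "prob (Y -` D \<inter> space M) = measure ?N D"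
        unfolding distrY[symmetric] using B(2) by (simp add: measure_distr)
      then show "prob (A \<inter> B) = prob A * prob B"
        unfolding A(1) B(1) indep[OF A(2) B(2)] by simp
    qed auto
  qed
  then have joint: "distr M (borel \<Otimes>\<^sub>M borel) (\<lambda>w. (X w, Y w)) = distr M borel X \<Otimes>\<^sub>M ?N"
    unfolding indep_var_distribution_eq distrY by simp
  let ?G = "vimage_algebra (space M) X borel"
  have sub: "subalgebra M ?G"
    unfolding subalgebra_def sets_vimage_algebra using X
    by (auto intro!: sets.sigma_sets_subset)
  interpret G: finite_measure_subalgebra M ?G
    by unfold_locales (rule sub)
  have "AE w in M. real_cond_exp M ?G (indicat_real (Z -` B \<inter> space M)) w = measure (normal_law (a (X w)) v) B"
    if B[measurable]: "B \<in> sets borel" for B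
  proof (rule G.real_cond_exp_charact)
    have km: "(\<lambda>x. measure (normal_law (a x) v) B) \<in> borel_measurable borel"
      by (rule measurable_compose[OF kernel measurable_measure_prob_algebra[OF B]])
    have XG: "X \<in> borel_measurable ?G"
      by (rule measurable_vimage_algebra1) simp
    show g: "(\<lambda>w. measure (normal_law (a (X w)) v) B) \<in> borel_measurable ?G"
      by (rule measurable_compose[OF XG km])
    have gM: "(\<lambda>w. measure (normal_law (a (X w)) v) B) \<in> borel_measurable M"
      by (rule measurable_compose[OF X km])
    have le1: "measure (normal_law (a x) v) B \<le> 1" for x
      using prob_space.prob_le_1[of "normal_law (a x) v" B] real_distribution_normal_law[OF v0, of "a x"]
      by (auto simp: real_distribution_def)
    show "integrable M (\<lambda>w. measure (normal_law (a (X w)) v) B)"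
      by (rule integrable_const_bound[where B=1, OF _ gM]) (use le1 in auto)
    show "integrable M (indicat_real (Z -` B \<inter> space M))"
      by (simp add: emeasure_eq_measure)
    fix A assume "A \<in> sets ?G"
    then obtain C where A: "A = X -` C \<inter> space M" and C[measurable]: "C \<in> sets borel"
      using sets_vimage_algebra2[of X "space M" borel] by auto
    have "{p \<in> space (borel \<Otimes>\<^sub>M borel). fst p \<in> C \<and> a (fst p) + snd p \<in> B} \<in> sets (borel \<Otimes>\<^sub>M borel)"
      by measurable
    also have "{p \<in> space (borel \<Otimes>\<^sub>M borel). fst p \<in> C \<and> a (fst p) + snd p \<in> B} = {(x, y). x \<in> C \<and> a x + y \<in> B}"
      by (auto simp: space_pair_measure)
    finally have Q[measurable]: "{(x, y). x \<in> C \<and> a x + y \<in> B} \<in> sets (borel \<Otimes>\<^sub>M borel)" .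
    \<comment> \<open>Up to a null set the event says that the pair of \<open>X\<close> and
      \<open>Y\<close> lies in a Borel subset of the plane.\<close>
    have "emeasure M (A \<inter> (Z -` B \<inter> space M)) = emeasure M ((\<lambda>w. (X w, Y w)) -` {(x, y). x \<in> C \<and> a x + y \<in> B} \<inter> space M)"
      by (rule emeasure_eq_AE) (use ZY in \<open>auto simp: A elim!: eventually_mono\<close>)
    also have "\<dots> = emeasure (distr M borel X \<Otimes>\<^sub>M ?N) {(x, y). x \<in> C \<and> a x + y \<in> B}"
      unfolding joint[symmetric] by (rule emeasure_distr[symmetric]) auto
    also have "\<dots> = (\<integral>\<^sup>+x. emeasure ?N (Pair x -` {(x, y). x \<in> C \<and> a x + y \<in> B}) \<partial>distr M borel X)"
      by (rule N.emeasure_pair_measure_alt) (use Q in \<open>simp cong: sets_pair_measure_cong\<close>)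
    also have "\<dots> = (\<integral>\<^sup>+x. ennreal (indicator C x * measure (normal_law (a x) v) B) \<partial>distr M borel X)"
    proof (rule nn_integral_cong)
      fix x
      have "measure (normal_law (a x) v) B = measure ?N ((\<lambda>y. a x + y) -` B)"
        unfolding normal_law_shift[OF v0, of "a x"] by (subst measure_distr) auto
      then show "emeasure ?N (Pair x -` {(x, y). x \<in> C \<and> a x + y \<in> B}) = ennreal (indicator C x * measure (normal_law (a x) v) B)"
        by (cases "x \<in> C") (auto simp: N.emeasure_eq_measure vimage_def)
    qed
    also have "\<dots> = (\<integral>\<^sup>+w. ennreal (indicator C (X w) * measure (normal_law (a (X w)) v) B) \<partial>M)"
      by (rule nn_integral_distr) (use km in auto)
    also have "\<dots> = ennreal (expectation (\<lambda>w. indicator C (X w) * measure (normal_law (a (X w)) v) B))"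
    proof (rule nn_integral_eq_integral)
      show "integrable M (\<lambda>w. indicator C (X w) * measure (normal_law (a (X w)) v) B)"
        by (rule integrable_const_bound[where B=1]) (use le1 gM in \<open>auto simp: indicator_def\<close>)
    qed auto
    finally have "prob (A \<inter> (Z -` B \<inter> space M)) = expectation (\<lambda>w. indicator C (X w) * measure (normal_law (a (X w)) v) B)"
      by (simp add: emeasure_eq_measure)
    also have "\<dots> = (\<integral>w\<in>A. measure (normal_law (a (X w)) v) B \<partial>M)"
      unfolding set_lebesgue_integral_def A
      by (intro lint_cong) (auto simp: indicator_def)
    finally show "(\<integral>w\<in>A. indicat_real (Z -` B \<inter> space M) w \<partial>M) = (\<integral>w\<in>A. measure (normal_law (a (X w)) v) B \<partial>M)"
      unfolding set_lebesgue_integral_def by (simp add: indicator_inter_arith[symmetric] A)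
  qed
  with kernel show ?thesis
    unfolding cond_law_def by simp
qed

section \<open>Absolutely continuous functions and stochastic Fubini\<close>

lemma measurable_leb_Icc_iff: "borel_measurable (leb_Icc s t) = borel_measurable (restrict_space borel {s..t})"
  by (rule measurable_cong_sets[OF sets_restrict_space_cong[OF sets_lborel] refl])

lemma integrable_leb_Icc: "integrable (leb_Icc s t) f \<longleftrightarrow> set_integrable lborel {s..t} f"
  for f :: "real \<Rightarrow> real"
  unfolding set_integrable_def by (rule integrable_restrict_space) simp

lemma integral_leb_Icc: "s \<le> t \<Longrightarrow> (LBINT u=s..t. f u) = (\<integral>u. f u \<partial>leb_Icc s t)"
  for f :: "real \<Rightarrow> real"
  by (simp add: interval_integral_Icc set_lebesgue_integral_def integral_restrict_space)

lemma integral_leb_Icc_upto: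
  fixes f :: "real \<Rightarrow> real"
  assumes "s \<le> u" "u \<le> t"
  shows "(LBINT v=s..u. f v) = (\<integral>v. f v * indicat_real {..u} v \<partial>leb_Icc s t)"
  unfolding interval_integral_Icc[OF assms(1)] set_lebesgue_integral_def
  by (subst integral_restrict_space, simp, intro lint_cong) (use assms in \<open>auto simp: indicator_def\<close>)

lemma integrable_upto:
  assumes "integrable (leb_Icc s t) (f :: real \<Rightarrow> real)"
  shows "integrable (leb_Icc s t) (\<lambda>v. f v * indicat_real {..u} v)"
proof (rule lintegrable_bound[OF assms])
  have [measurable]: "f \<in> borel_measurable (leb_Icc s t)" "indicat_real {..u} \<in> borel_measurable (leb_Icc s t)"
    using assms by (auto intro!: measurable_leb_Icc)
  show "(\<lambda>v. f v * indicat_real {..u} v) \<in> borel_measurable (leb_Icc s t)" by simp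
qed (auto simp: indicator_def)

text \<open>\<open>A\<close> is absolutely continuous with density \<open>a\<close>. The upper limit
  sits in an indicator, so that the measure space stays fixed and Fubini applies to \<open>u\<close>
  as well.\<close>

definition ac_on :: "real \<Rightarrow> real \<Rightarrow> (real \<Rightarrow> real) \<Rightarrow> (real \<Rightarrow> real) \<Rightarrow> bool" where
  "ac_on s t A a \<longleftrightarrow> integrable (leb_Icc s t) a \<and>
     (\<forall>u\<in>{s..t}. A u = A s + (\<integral>v. a v * indicat_real {..u} v \<partial>leb_Icc s t))"

lemma ac_on_integrable: "ac_on s t A a \<Longrightarrow> integrable (leb_Icc s t) a"
  by (simp add: ac_on_def)

lemma ac_on_eq:
  "ac_on s t A a \<Longrightarrow> u \<in> {s..t} \<Longrightarrow> A u = A s + (\<integral>v. a v * indicat_real {..u} v \<partial>leb_Icc s t)"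
  unfolding ac_on_def by blast

lemma ac_onI':
  assumes "integrable (leb_Icc s t) a"
    and "\<And>u. u \<in> {s..t} \<Longrightarrow> A u = A s + (\<integral>v. a v * indicat_real {..u} v \<partial>leb_Icc s t)"
  shows "ac_on s t A a"
  using assms unfolding ac_on_def by blast

lemma ac_on_eq_LBINT:
  assumes "ac_on s t A a" "s \<le> u" "u \<le> t"
  shows "A u = A s + (LBINT v=s..u. a v)"
  unfolding integral_leb_Icc_upto[OF assms(2,3)] by (rule ac_on_eq) (use assms in auto)

lemma ac_onI:
  assumes "integrable (leb_Icc s t) a" "\<And>u. s \<le> u \<Longrightarrow> u \<le> t \<Longrightarrow> A u = A s + (LBINT v=s..u. a v)"
  shows "ac_on s t A a"
proof (rule ac_onI'[OF assms(1)])
  fix u assume "u \<in> {s..t}"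
  then have u: "s \<le> u" "u \<le> t" by auto
  show "A u = A s + (\<integral>v. a v * indicat_real {..u} v \<partial>leb_Icc s t)"
    unfolding integral_leb_Icc_upto[OF u, symmetric] by (rule assms(2)[OF u])
qed

lemma ac_on_const: "ac_on s t (\<lambda>_. c) (\<lambda>_. 0)"
  by (rule ac_onI) auto

lemma ac_on_cong:
  assumes "ac_on s t A a" "\<And>u. s \<le> u \<Longrightarrow> u \<le> t \<Longrightarrow> A u = B u" "\<And>u. s \<le> u \<Longrightarrow> u \<le> t \<Longrightarrow> a u = b u"
  shows "ac_on s t B b"
proof -
  have "integrable (leb_Icc s t) a = integrable (leb_Icc s t) b"
    by (rule lintegrable_cong) (auto simp: space_restrict_space assms(3))
  moreover have "(\<integral>v. a v * indicat_real {..u} v \<partial>leb_Icc s t) = (\<integral>v. b v * indicat_real {..u} v \<partial>leb_Icc s t)" for u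
    by (rule lint_cong) (auto simp: space_restrict_space assms(3))
  ultimately show ?thesis
    using ac_on_integrable[OF assms(1)]
  proof (intro ac_onI')
    fix u assume u: "u \<in> {s..t}"
    then have "B u = A u" "B s = A s" using assms(2)[of u] assms(2)[of s] by auto
    with ac_on_eq[OF assms(1) u] show "B u = B s + (\<integral>v. b v * indicat_real {..u} v \<partial>leb_Icc s t)"
      using \<open>\<And>u. (\<integral>v. a v * indicat_real {..u} v \<partial>leb_Icc s t) = (\<integral>v. b v * indicat_real {..u} v \<partial>leb_Icc s t)\<close>[of u]
      by simp
  qed simp
qed

lemma ac_on_add:
  assumes "ac_on s t A a" "ac_on s t B b"
  shows "ac_on s t (\<lambda>u. A u + B u) (\<lambda>u. a u + b u)"
proof -
  have i: "integrable (leb_Icc s t) a" "integrable (leb_Icc s t) b"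
    using assms by (auto simp: ac_on_def)
  have sum: "(\<integral>v. (a v + b v) * indicat_real {..u} v \<partial>leb_Icc s t)
    = (\<integral>v. a v * indicat_real {..u} v \<partial>leb_Icc s t) + (\<integral>v. b v * indicat_real {..u} v \<partial>leb_Icc s t)" for u
    unfolding distrib_right by (rule lint_add[OF integrable_upto[OF i(1)] integrable_upto[OF i(2)]])
  show ?thesis
    using i
  proof (intro ac_onI')
    fix u assume u: "u \<in> {s..t}"
    show "A u + B u = A s + B s + (\<integral>v. (a v + b v) * indicat_real {..u} v \<partial>leb_Icc s t)"
      unfolding sum[of u] ac_on_eq[OF assms(1) u] ac_on_eq[OF assms(2) u] by simp
  qed simp
qed

lemma ac_on_continuous:
  assumes "ac_on s t A a"
  shows "continuous_on {s..t} A"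
proof -
  have i: "set_integrable lborel {s..t} a"
    using assms by (simp add: ac_on_def integrable_leb_Icc)
  have eq: "A u = A s + integral {s..u} a" if "u \<in> {s..t}" for u
  proof -
    have "set_integrable lborel {s..u} a"
      by (rule set_integrable_subset[OF i]) (use that in auto)
    then show ?thesis
      using ac_on_eq_LBINT[OF assms, of u] that interval_integral_eq_integral[of s u a] by simp
  qed
  have "continuous_on {s..t} (\<lambda>u. A s + integral {s..u} a)"
    by (intro continuous_intros indefinite_integral_continuous_1 set_borel_integral_eq_integral(1)[OF i])
  from this show ?thesis
    by (rule continuous_on_eq) (rule eq[symmetric])
qed

lemma continuous_on_Icc_bounded:
  fixes B :: "real \<Rightarrow> real"
  assumes "continuous_on {s..t} B"
  obtains C where "\<And>u. u \<in> {s..t} \<Longrightarrow> \<bar>B u\<bar> \<le> C"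
proof -
  have "bounded (B ` {s..t})"
    by (intro compact_imp_bounded compact_continuous_image assms compact_Icc)
  then obtain C where "\<forall>x\<in>B ` {s..t}. norm x \<le> C" unfolding bounded_iff by blast
  then show thesis by (intro that[of C]) auto
qed

lemma (in pair_sigma_finite) integrable_product_mult:
  fixes f :: "'a \<Rightarrow> real" and g :: "'b \<Rightarrow> real"
  assumes "integrable M1 f" "integrable M2 g"
  shows "integrable (M1 \<Otimes>\<^sub>M M2) (\<lambda>(x, y). f x * g y)"
proof -
  have [measurable]: "f \<in> borel_measurable M1" "g \<in> borel_measurable M2" using assms by auto
  show ?thesis
    by (rule Fubini_integrable) (use assms in \<open>auto simp: abs_mult\<close>)
qed

lemma integrable_mult_continuous:
  fixes a B :: "real \<Rightarrow> real"
  assumes a: "integrable (leb_Icc s t) a" and B: "continuous_on {s..t} B"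
  shows "integrable (leb_Icc s t) (\<lambda>u. a u * B u)"
proof -
  from continuous_on_Icc_bounded[OF B] obtain C where C: "\<And>u. u \<in> {s..t} \<Longrightarrow> \<bar>B u\<bar> \<le> C" by blast
  have [measurable]: "B \<in> borel_measurable (leb_Icc s t)"
    unfolding measurable_leb_Icc_iff by (rule borel_measurable_continuous_on_restrict[OF B])
  have [measurable]: "a \<in> borel_measurable (leb_Icc s t)" using a by auto
  show ?thesis
  proof (rule lintegrable_bound)
    show "integrable (leb_Icc s t) (\<lambda>u. C * \<bar>a u\<bar>)" using a by simp
    show "AE u in leb_Icc s t. norm (a u * B u) \<le> norm (C * \<bar>a u\<bar>)"
    proof (rule AE_I2)
      fix u assume "u \<in> space (leb_Icc s t)"
      then have "\<bar>B u\<bar> \<le> C" using C by (simp add: space_restrict_space)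
      then have "\<bar>a u\<bar> * \<bar>B u\<bar> \<le> \<bar>a u\<bar> * \<bar>C\<bar>" by (intro mult_left_mono) auto
      then show "norm (a u * B u) \<le> norm (C * \<bar>a u\<bar>)" by (simp add: abs_mult mult.commute)
    qed
  qed simp
qed

text \<open>Fubini on the square \<open>[s, t]\<^sup>2\<close>, split along its diagonal.\<close>

lemma ac_on_mult:
  assumes A: "ac_on s t A a" and B: "ac_on s t B b"
  shows "ac_on s t (\<lambda>u. A u * B u) (\<lambda>u. a u * B u + b u * A u)"
proof -
  let ?L = "leb_Icc s t"
  interpret L: finite_measure ?L by (rule finite_measure_leb_Icc)
  interpret LL: pair_sigma_finite ?L ?L ..
  note ia = ac_on_integrable[OF A] and ib = ac_on_integrable[OF B]
  have [measurable]: "a \<in> borel_measurable ?L" "b \<in> borel_measurable ?L" using ia ib by auto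
  have iaB: "integrable ?L (\<lambda>u. a u * B u)" and ibA: "integrable ?L (\<lambda>u. b u * A u)"
    using integrable_mult_continuous[OF ia ac_on_continuous[OF B]] integrable_mult_continuous[OF ib ac_on_continuous[OF A]] .
  have [measurable]: "(\<lambda>u::real. u) \<in> borel_measurable ?L"
    by (rule measurable_leb_Icc) simp
  have "A w * B w = A s * B s + (\<integral>u. (a u * B u + b u * A u) * indicat_real {..w} u \<partial>?L)" if w: "w \<in> {s..t}" for w
  proof -
    let ?a = "\<lambda>u. a u * indicat_real {..w} u" and ?b = "\<lambda>u. b u * indicat_real {..w} u"
    have ia': "integrable ?L ?a" and ib': "integrable ?L ?b"
      by (rule integrable_upto[OF ia], rule integrable_upto[OF ib])
    have [measurable]: "?a \<in> borel_measurable ?L" "?b \<in> borel_measurable ?L" using ia' ib' by auto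
    have Aw: "(\<integral>u. ?a u \<partial>?L) = A w - A s" and Bw: "(\<integral>u. ?b u \<partial>?L) = B w - B s"
      using ac_on_eq[OF A w] ac_on_eq[OF B w] by simp_all
    have iprod: "integrable (?L \<Otimes>\<^sub>M ?L) (\<lambda>(u, v). ?a u * ?b v)"
      by (rule LL.integrable_product_mult[OF ia' ib'])
    have i1: "integrable (?L \<Otimes>\<^sub>M ?L) (\<lambda>(u, v). ?a u * ?b v * of_bool (v \<le> u))"
      by (rule lintegrable_bound[OF iprod]) (auto intro!: AE_I2)
    have i2: "integrable (?L \<Otimes>\<^sub>M ?L) (\<lambda>(u, v). ?a u * ?b v * of_bool (u < v))"
      by (rule lintegrable_bound[OF iprod]) (auto intro!: AE_I2)
    have "(A w - A s) * (B w - B s) = (\<integral>u. (\<integral>v. ?a u * ?b v \<partial>?L) \<partial>?L)"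
      by (simp add: Aw Bw)
    also have "\<dots> = (\<integral>p. (\<lambda>(u, v). ?a u * ?b v * of_bool (v \<le> u)) p + (\<lambda>(u, v). ?a u * ?b v * of_bool (u < v)) p \<partial>(?L \<Otimes>\<^sub>M ?L))"
      unfolding LL.integral_fst[OF iprod] by (intro lint_cong) (auto simp: not_le)
    also have "\<dots> = (\<integral>u. (\<integral>v. ?a u * ?b v * of_bool (v \<le> u) \<partial>?L) \<partial>?L) + (\<integral>v. (\<integral>u. ?a u * ?b v * of_bool (u < v) \<partial>?L) \<partial>?L)"
      unfolding LL.integral_fst[OF i1] LL.integral_snd[OF i2]
      by (rule lint_add[OF i1 i2])
    also have "(\<integral>u. (\<integral>v. ?a u * ?b v * of_bool (v \<le> u) \<partial>?L) \<partial>?L) = (\<integral>u. ?a u * (B u - B s) \<partial>?L)"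
    proof (rule lint_cong[OF refl])
      fix u assume u: "u \<in> space ?L"
      have "(\<integral>v. ?a u * ?b v * of_bool (v \<le> u) \<partial>?L) = (\<integral>v. ?a u * (b v * indicat_real {..u} v) \<partial>?L)"
        by (intro lint_cong) (auto simp: indicator_def)
      then show "(\<integral>v. ?a u * ?b v * of_bool (v \<le> u) \<partial>?L) = ?a u * (B u - B s)"
        using ac_on_eq[OF B, of u] u by (simp add: space_restrict_space)
    qed
    also have "(\<integral>v. (\<integral>u. ?a u * ?b v * of_bool (u < v) \<partial>?L) \<partial>?L) = (\<integral>v. ?b v * (A v - A s) \<partial>?L)"
    proof (rule lint_cong[OF refl])
      fix v assume v: "v \<in> space ?L"
      \<comment> \<open>The strict inequality differs from the indicator of \<open>{..v}\<close> on
        the diagonal only.\<close>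
      have "AE u in ?L. u \<noteq> v"
        by (subst AE_restrict_space_iff) (use AE_lborel_singleton[of v] in \<open>auto elim: eventually_mono\<close>)
      then have "(\<integral>u. ?a u * ?b v * of_bool (u < v) \<partial>?L) = (\<integral>u. ?b v * (a u * indicat_real {..v} u) \<partial>?L)"
        by (intro integral_cong_AE) (auto elim!: eventually_mono simp: indicator_def)
      then show "(\<integral>u. ?a u * ?b v * of_bool (u < v) \<partial>?L) = ?b v * (A v - A s)"
        using ac_on_eq[OF A, of v] v by (simp add: space_restrict_space)
    qed
    also have "(\<integral>u. ?a u * (B u - B s) \<partial>?L) = (\<integral>u. a u * B u * indicat_real {..w} u \<partial>?L) - (A w - A s) * B s"
    proof -
      have "(\<integral>u. ?a u * (B u - B s) \<partial>?L) = (\<integral>u. a u * B u * indicat_real {..w} u - ?a u * B s \<partial>?L)"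
        by (intro lint_cong) (auto simp: algebra_simps)
      also have "\<dots> = (\<integral>u. a u * B u * indicat_real {..w} u \<partial>?L) - (\<integral>u. ?a u * B s \<partial>?L)"
        by (rule lint_diff[OF integrable_upto[OF iaB] integrable_mult_left[OF ia']])
      finally show ?thesis by (simp add: Aw)
    qed
    also have "(\<integral>u. ?b u * (A u - A s) \<partial>?L) = (\<integral>u. b u * A u * indicat_real {..w} u \<partial>?L) - (B w - B s) * A s"
    proof -
      have "(\<integral>u. ?b u * (A u - A s) \<partial>?L) = (\<integral>u. b u * A u * indicat_real {..w} u - ?b u * A s \<partial>?L)"
        by (intro lint_cong) (auto simp: algebra_simps)
      also have "\<dots> = (\<integral>u. b u * A u * indicat_real {..w} u \<partial>?L) - (\<integral>u. ?b u * A s \<partial>?L)"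
        by (rule lint_diff[OF integrable_upto[OF ibA] integrable_mult_left[OF ib']])
      finally show ?thesis by (simp add: Bw)
    qed
    moreover have "(\<integral>u. (a u * B u + b u * A u) * indicat_real {..w} u \<partial>?L)
      = (\<integral>u. a u * B u * indicat_real {..w} u \<partial>?L) + (\<integral>u. b u * A u * indicat_real {..w} u \<partial>?L)"
      unfolding distrib_right by (rule lint_add[OF integrable_upto[OF iaB] integrable_upto[OF ibA]])
    ultimately show ?thesis by (simp add: algebra_simps)
  qed
  with iaB ibA show ?thesis by (intro ac_onI' lintegrable_add)
qed

text \<open>Indexed by \<open>Suc n\<close>, so that the density contains \<open>B u ^ n\<close>
  without a predecessor.\<close>

lemma ac_on_power:
  assumes "ac_on s t B b"
  shows "ac_on s t (\<lambda>u. B u ^ Suc n) (\<lambda>u. real (Suc n) * (b u * B u ^ n))"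
proof (induction n)
  case 0
  show ?case using assms by (rule ac_on_cong) auto
next
  case (Suc n)
  show ?case
    using ac_on_mult[OF assms Suc] by (rule ac_on_cong) (auto simp: algebra_simps)
qed

text \<open>Since \<open>b\<close> is merely integrable, a pointwise chain rule is not at hand. The
  exponential series is integrated term by term instead, dominated by \<bar>b\<bar> C^n /
  n!.\<close>

lemma ac_on_exp:
  assumes B: "ac_on s t B b" and "s \<le> t"
  shows "ac_on s t (\<lambda>u. exp (B u)) (\<lambda>u. b u * exp (B u))"
proof -
  let ?L = "leb_Icc s t"
  have cont: "continuous_on {s..t} B" by (rule ac_on_continuous[OF B])
  have ib: "integrable ?L b" using B by (simp add: ac_on_def)
  have ibe: "integrable ?L (\<lambda>u. b u * exp (B u))"
    by (intro integrable_mult_continuous[OF ib] continuous_intros cont)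
  from continuous_on_Icc_bounded[OF cont] obtain C where C: "\<And>u. u \<in> {s..t} \<Longrightarrow> \<bar>B u\<bar> \<le> C" by blast
  have "0 \<le> C" using C[of s] \<open>s \<le> t\<close> by simp
  have "exp (B w) = exp (B s) + (\<integral>u. b u * exp (B u) * indicat_real {..w} u \<partial>?L)" if w: "w \<in> {s..t}" for w
  proof -
    let ?f = "\<lambda>n u. b u * (B u ^ n / fact n) * indicat_real {..w} u"
    have fi: "integrable ?L (?f n)" for n
      by (intro integrable_upto integrable_mult_continuous[OF ib] continuous_intros cont) simp
    have bound: "norm (?f n u) \<le> \<bar>b u\<bar> * (C ^ n / fact n)" if "u \<in> {s..t}" for n u
    proof -
      have "norm (?f n u) = \<bar>b u\<bar> * (\<bar>B u\<bar> ^ n / fact n) * indicat_real {..w} u"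
        by (simp add: abs_mult power_abs indicator_def)
      also have "\<dots> \<le> \<bar>b u\<bar> * (C ^ n / fact n) * 1"
        by (intro mult_mono divide_right_mono power_mono C[OF that]) (use \<open>0 \<le> C\<close> in \<open>auto simp: indicator_def\<close>)
      finally show ?thesis by simp
    qed
    have sC: "summable (\<lambda>n. C ^ n / fact n)"
      using summable_exp[of C] by (simp add: divide_inverse mult.commute)
    have sum1: "summable (\<lambda>n. norm (?f n u))" if "u \<in> {s..t}" for u
      by (rule summable_comparison_test[OF _ summable_mult[OF sC, of "\<bar>b u\<bar>"]]) (use bound[OF that] in auto)
    have sum2: "summable (\<lambda>n. \<integral>u. norm (?f n u) \<partial>?L)"
    proof (rule summable_comparison_test[OF _ summable_mult[OF sC, of "\<integral>u. \<bar>b u\<bar> \<partial>?L"]], intro exI allI impI)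
      fix n
      have "(\<integral>u. norm (?f n u) \<partial>?L) \<le> (\<integral>u. \<bar>b u\<bar> * (C ^ n / fact n) \<partial>?L)"
      proof (rule integral_mono)
        show "integrable ?L (\<lambda>u. norm (?f n u))" by (rule integrable_norm[OF fi])
        show "integrable ?L (\<lambda>u. \<bar>b u\<bar> * (C ^ n / fact n))" by (rule integrable_mult_left[OF integrable_abs[OF ib]])
        show "norm (?f n u) \<le> \<bar>b u\<bar> * (C ^ n / fact n)" if "u \<in> space ?L" for u
          by (rule bound) (use that in \<open>simp add: space_restrict_space\<close>)
      qed
      then show "norm (\<integral>u. norm (?f n u) \<partial>?L) \<le> (\<integral>u. \<bar>b u\<bar> \<partial>?L) * (C ^ n / fact n)"
        by simp
    qed
    have s1: "(\<lambda>n. \<integral>u. ?f n u \<partial>?L) sums (\<integral>u. (\<Sum>n. ?f n u) \<partial>?L)"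
      by (rule sums_integral[OF fi _ sum2]) (use sum1 in \<open>auto intro!: AE_I2 simp: space_restrict_space\<close>)
    have "(\<Sum>n. ?f n u) = b u * exp (B u) * indicat_real {..w} u" for u
    proof -
      have "(\<lambda>n. B u ^ n / fact n) sums exp (B u)"
        using exp_converges[of "B u"] by (simp add: divide_inverse mult.commute)
      from sums_mult2[OF sums_mult[OF this, of "b u"], of "indicat_real {..w} u"]
      show ?thesis by (rule sums_unique[symmetric])
    qed
    with s1 have s1: "(\<lambda>n. \<integral>u. ?f n u \<partial>?L) sums (\<integral>u. b u * exp (B u) * indicat_real {..w} u \<partial>?L)" by simp
    \<comment> \<open>Term \<open>n\<close> is the density of B^(n+1) / (n+1)!, so its integral is
      the increment of that function.\<close>
    have "(\<integral>u. ?f n u \<partial>?L) = (B w ^ Suc n - B s ^ Suc n) / fact (Suc n)" for n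
    proof -
      have "B w ^ Suc n = B s ^ Suc n + (\<integral>u. real (Suc n) * (b u * B u ^ n) * indicat_real {..w} u \<partial>?L)"
        by (rule ac_on_eq[OF ac_on_power[OF B] w])
      also have "(\<integral>u. real (Suc n) * (b u * B u ^ n) * indicat_real {..w} u \<partial>?L) = (\<integral>u. fact (Suc n) * ?f n u \<partial>?L)"
        by (intro lint_cong) auto
      finally show ?thesis by (simp del: power_Suc fact_Suc)
    qed
    then have s2: "(\<lambda>n. (B w ^ Suc n - B s ^ Suc n) / fact (Suc n)) sums (\<integral>u. b u * exp (B u) * indicat_real {..w} u \<partial>?L)"
      using s1 by simp
    \<comment> \<open>The shifted index drops the constant term 1, which cancels in the
      difference.\<close>
    have e: "(\<lambda>n. x ^ Suc n / fact (Suc n)) sums (exp x - 1)" for x :: real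
    proof -
      have "(\<lambda>n. x ^ n / fact n) sums exp x"
        using exp_converges[of x] by (simp add: divide_inverse mult.commute)
      then have "(\<lambda>n. x ^ Suc n / fact (Suc n)) sums (exp x - x ^ 0 / fact 0)"
        by (subst sums_Suc_iff) (simp del: power_Suc fact_Suc)
      then show ?thesis by simp
    qed
    have "(\<lambda>n. (B w ^ Suc n - B s ^ Suc n) / fact (Suc n)) sums ((exp (B w) - 1) - (exp (B s) - 1))"
      unfolding diff_divide_distrib by (rule sums_diff[OF e e])
    from sums_unique2[OF this s2] show ?thesis by simp
  qed
  with ibe show ?thesis by (rule ac_onI')
qed

section \<open>Interchanging a time integral with an L2 inner product\<close>

text \<open>Used with \<open>K\<close> the probability space and with \<open>K\<close> Lebesgue
  measure on [s, t]. The uniform bound \<open>C\<close> on the squared norms of the \<psi> u allows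
  a weight \<open>g\<close> that is only integrable.\<close>

lemma L2_Fubini:
  fixes g :: "'b \<Rightarrow> real" and \<psi> :: "'b \<Rightarrow> 'c \<Rightarrow> real"
  assumes "sigma_finite_measure L" "sigma_finite_measure K" and g: "integrable L g"
    and \<psi>[measurable]: "(\<lambda>(u, x). \<psi> u x) \<in> borel_measurable (L \<Otimes>\<^sub>M K)"
    and s: "\<And>u. u \<in> space L \<Longrightarrow> in_L2 K (\<psi> u)"
    and C: "\<And>u. u \<in> space L \<Longrightarrow> (\<integral>x. (\<psi> u x)^2 \<partial>K) \<le> C"
  shows L2_Fubini_inner: "in_L2 K \<eta> \<Longrightarrow>
      (\<integral>u. g u * (\<integral>x. \<psi> u x * \<eta> x \<partial>K) \<partial>L) = (\<integral>x. (\<integral>u. g u * \<psi> u x \<partial>L) * \<eta> x \<partial>K)"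
    and L2_Fubini_in_L2: "in_L2 K (\<lambda>x. \<integral>u. g u * \<psi> u x \<partial>L)"
proof -
  interpret L: sigma_finite_measure L by fact
  interpret K: sigma_finite_measure K by fact
  interpret P: pair_sigma_finite L K ..
  have [measurable]: "g \<in> borel_measurable L" using g by auto
  have nn: "(\<integral>\<^sup>+x. (\<integral>\<^sup>+u. ennreal (\<bar>g u\<bar> * (\<psi> u x)^2) \<partial>L) \<partial>K) \<le> ennreal (C * (\<integral>u. \<bar>g u\<bar> \<partial>L))"
  proof -
    have "(\<integral>\<^sup>+x. (\<integral>\<^sup>+u. ennreal (\<bar>g u\<bar> * (\<psi> u x)^2) \<partial>L) \<partial>K) = (\<integral>\<^sup>+u. (\<integral>\<^sup>+x. ennreal (\<bar>g u\<bar> * (\<psi> u x)^2) \<partial>K) \<partial>L)"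
      by (rule P.Fubini') measurable
    also have "\<dots> \<le> (\<integral>\<^sup>+u. ennreal (C * \<bar>g u\<bar>) \<partial>L)"
    proof (rule nn_integral_mono)
      fix u assume u: "u \<in> space L"
      have "(\<integral>\<^sup>+x. ennreal (\<bar>g u\<bar> * (\<psi> u x)^2) \<partial>K) = ennreal \<bar>g u\<bar> * ennreal (\<integral>x. (\<psi> u x)^2 \<partial>K)"
        using in_L2_measurable[OF s[OF u]]
        by (simp add: ennreal_mult nn_integral_cmult in_L2_nn_eq[OF s[OF u]])
      also have "\<dots> \<le> ennreal \<bar>g u\<bar> * ennreal C"
        using C[OF u] by (intro mult_left_mono ennreal_leI) auto
      also have "\<dots> = ennreal (C * \<bar>g u\<bar>)"
        by (simp add: ennreal_mult'' mult.commute ennreal_mult')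
      finally show "(\<integral>\<^sup>+x. ennreal (\<bar>g u\<bar> * (\<psi> u x)^2) \<partial>K) \<le> ennreal (C * \<bar>g u\<bar>)" .
    qed
    also have "\<dots> = ennreal (C * (\<integral>u. \<bar>g u\<bar> \<partial>L))"
    \<comment> \<open>Some point of \<open>L\<close> is needed to conclude 0 \<le> C.\<close>
    proof (cases "space L = {}")
      case True
      then have "(\<integral>u. \<bar>g u\<bar> \<partial>L) = (\<integral>u. 0 \<partial>L)"
        by (intro lint_cong) auto
      with True show ?thesis by (simp add: nn_integral_empty)
    next
      case False
      then obtain u where "u \<in> space L" by auto
      from order_trans[OF _ C[OF this]] have "0 \<le> C" by simp
      then show ?thesis using g by (subst nn_integral_eq_integral) auto
    qed
    finally show ?thesis .
  qed
  show "in_L2 K (\<lambda>x. \<integral>u. g u * \<psi> u x \<partial>L)"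
  proof (rule in_L2_nn_finite)
    show "(\<lambda>x. \<integral>u. g u * \<psi> u x \<partial>L) \<in> borel_measurable K" by measurable
    have "ennreal ((\<integral>u. g u * \<psi> u x \<partial>L)^2) \<le> ennreal (\<integral>u. \<bar>g u\<bar> \<partial>L) * (\<integral>\<^sup>+u. ennreal (\<bar>g u\<bar> * (\<psi> u x)^2) \<partial>L)"
      if x: "x \<in> space K" for x
    proof -
      have [measurable]: "(\<lambda>u. \<psi> u x) \<in> borel_measurable L"
        using x by measurable
      have "ennreal \<bar>\<integral>u. g u * \<psi> u x \<partial>L\<bar> \<le> (\<integral>\<^sup>+u. ennreal \<bar>g u * \<psi> u x\<bar> \<partial>L)"
      proof (cases "integrable L (\<lambda>u. g u * \<psi> u x)")
        case True
        then show ?thesis using integral_norm_bound_ennreal[OF True] by simp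
      qed (simp add: not_integrable_integral_eq)
      \<comment> \<open>The weight \<bar>g\<bar> is shared between both factors, so that
        Cauchy-Schwarz leaves the L1 norm of \<open>g\<close> and the integral of \<bar>g\<bar>
        \<psi>^2.\<close>
      also have "\<dots> = (\<integral>\<^sup>+u. ennreal (sqrt \<bar>g u\<bar>) * ennreal (sqrt \<bar>g u\<bar> * \<bar>\<psi> u x\<bar>) \<partial>L)"
        by (intro nn_integral_cong) (simp add: ennreal_mult[symmetric] abs_mult mult.assoc[symmetric])
      finally have "(ennreal \<bar>\<integral>u. g u * \<psi> u x \<partial>L\<bar>)^2 \<le> (\<integral>\<^sup>+u. ennreal (sqrt \<bar>g u\<bar>) * ennreal (sqrt \<bar>g u\<bar> * \<bar>\<psi> u x\<bar>) \<partial>L)^2"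
        by (intro power_mono) auto
      also have "\<dots> \<le> (\<integral>\<^sup>+u. (ennreal (sqrt \<bar>g u\<bar>))^2 \<partial>L) * (\<integral>\<^sup>+u. (ennreal (sqrt \<bar>g u\<bar> * \<bar>\<psi> u x\<bar>))^2 \<partial>L)"
        by (rule Cauchy_Schwarz_nn_integral) measurable
      also have "(\<integral>\<^sup>+u. (ennreal (sqrt \<bar>g u\<bar>))^2 \<partial>L) = ennreal (\<integral>u. \<bar>g u\<bar> \<partial>L)"
        using g by (simp add: ennreal_power nn_integral_eq_integral)
      also have "(\<integral>\<^sup>+u. (ennreal (sqrt \<bar>g u\<bar> * \<bar>\<psi> u x\<bar>))^2 \<partial>L) = (\<integral>\<^sup>+u. ennreal (\<bar>g u\<bar> * (\<psi> u x)^2) \<partial>L)"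
        by (simp add: ennreal_power power_mult_distrib)
      finally show ?thesis by (simp add: ennreal_power)
    qed
    then have "(\<integral>\<^sup>+x. ennreal ((\<integral>u. g u * \<psi> u x \<partial>L)^2) \<partial>K) \<le> (\<integral>\<^sup>+x. ennreal (\<integral>u. \<bar>g u\<bar> \<partial>L) * (\<integral>\<^sup>+u. ennreal (\<bar>g u\<bar> * (\<psi> u x)^2) \<partial>L) \<partial>K)"
      by (rule nn_integral_mono)
    also have "\<dots> = ennreal (\<integral>u. \<bar>g u\<bar> \<partial>L) * (\<integral>\<^sup>+x. (\<integral>\<^sup>+u. ennreal (\<bar>g u\<bar> * (\<psi> u x)^2) \<partial>L) \<partial>K)"
      by (rule nn_integral_cmult) measurable
    also have "\<dots> \<le> ennreal (\<integral>u. \<bar>g u\<bar> \<partial>L) * ennreal (C * (\<integral>u. \<bar>g u\<bar> \<partial>L))"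
      by (rule mult_left_mono[OF nn]) simp
    also have "\<dots> < \<infinity>" by (simp add: ennreal_mult_less_top)
    finally show "(\<integral>\<^sup>+x. ennreal ((\<integral>u. g u * \<psi> u x \<partial>L)^2) \<partial>K) < \<infinity>" .
  qed
  assume \<eta>: "in_L2 K \<eta>"
  have [measurable]: "\<eta> \<in> borel_measurable K" by (rule in_L2_measurable[OF \<eta>])
  have i: "integrable (L \<Otimes>\<^sub>M K) (\<lambda>(u, x). g u * (\<psi> u x * \<eta> x))"
  proof (rule P.Fubini_integrable)
    show "(\<lambda>(u, x). g u * (\<psi> u x * \<eta> x)) \<in> borel_measurable (L \<Otimes>\<^sub>M K)" by measurable
    show "AE u in L. integrable K (\<lambda>x. case (u, x) of (u, x) \<Rightarrow> g u * (\<psi> u x * \<eta> x))"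
      using in_L2_mult[OF s \<eta>] by (auto intro!: AE_I2)
    show "integrable L (\<lambda>u. \<integral>x. norm (case (u, x) of (u, x) \<Rightarrow> g u * (\<psi> u x * \<eta> x)) \<partial>K)"
    proof (rule lintegrable_bound)
      show "integrable L (\<lambda>u. (C + (\<integral>x. (\<eta> x)^2 \<partial>K)) * \<bar>g u\<bar>)" using g by simp
      show "(\<lambda>u. \<integral>x. norm (case (u, x) of (u, x) \<Rightarrow> g u * (\<psi> u x * \<eta> x)) \<partial>K) \<in> borel_measurable L" by measurable
      show "AE u in L. norm (\<integral>x. norm (case (u, x) of (u, x) \<Rightarrow> g u * (\<psi> u x * \<eta> x)) \<partial>K) \<le> norm ((C + (\<integral>x. (\<eta> x)^2 \<partial>K)) * \<bar>g u\<bar>)"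
      proof (rule AE_I2)
        fix u assume u: "u \<in> space L"
        have "(\<integral>x. \<bar>\<psi> u x * \<eta> x\<bar> \<partial>K) \<le> (\<integral>x. (\<psi> u x)^2 + (\<eta> x)^2 \<partial>K)"
          using in_L2_mult[OF s[OF u] \<eta>] in_L2_square[OF s[OF u]] in_L2_square[OF \<eta>]
          by (intro integral_mono) (auto intro: abs_mult_le_sum_squares)
        also have "\<dots> = (\<integral>x. (\<psi> u x)^2 \<partial>K) + (\<integral>x. (\<eta> x)^2 \<partial>K)"
          by (rule lint_add[OF in_L2_square[OF s[OF u]] in_L2_square[OF \<eta>]])
        also have "\<dots> \<le> C + (\<integral>x. (\<eta> x)^2 \<partial>K)" using C[OF u] by simp
        finally have *: "(\<integral>x. \<bar>\<psi> u x * \<eta> x\<bar> \<partial>K) \<le> C + (\<integral>x. (\<eta> x)^2 \<partial>K)" .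
        have "norm (\<integral>x. norm (case (u, x) of (u, x) \<Rightarrow> g u * (\<psi> u x * \<eta> x)) \<partial>K) = \<bar>g u\<bar> * (\<integral>x. \<bar>\<psi> u x * \<eta> x\<bar> \<partial>K)"
          unfolding prod.case real_norm_def abs_mult[of "g u"] by simp
        also have "\<dots> \<le> \<bar>g u\<bar> * (C + (\<integral>x. (\<eta> x)^2 \<partial>K))" by (rule mult_left_mono[OF *]) simp
        finally show "norm (\<integral>x. norm (case (u, x) of (u, x) \<Rightarrow> g u * (\<psi> u x * \<eta> x)) \<partial>K) \<le> norm ((C + (\<integral>x. (\<eta> x)^2 \<partial>K)) * \<bar>g u\<bar>)"
          by (simp add: mult.commute)
      qed
    qed
  qed
  have "(\<integral>u. g u * (\<integral>x. \<psi> u x * \<eta> x \<partial>K) \<partial>L) = (\<integral>u. (\<integral>x. g u * (\<psi> u x * \<eta> x) \<partial>K) \<partial>L)" by simp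
  also have "\<dots> = (\<integral>x. (\<integral>u. g u * (\<psi> u x * \<eta> x) \<partial>L) \<partial>K)"
    by (rule P.Fubini_integral[OF i, symmetric])
  also have "\<dots> = (\<integral>x. (\<integral>u. g u * \<psi> u x \<partial>L) * \<eta> x \<partial>K)"
    by (simp add: mult.assoc[symmetric])
  finally show "(\<integral>u. g u * (\<integral>x. \<psi> u x * \<eta> x \<partial>K) \<partial>L) = (\<integral>x. (\<integral>u. g u * \<psi> u x \<partial>L) * \<eta> x \<partial>K)" .
qed

context brownian_motion
begin

text \<open>Both sides have the same inner product with every Ito integral of a deterministic function,
  and each \<open>N u\<close> as well as \<open>Y\<close> is such an integral; hence \<open>\<integral> g N - Y\<close> is orthogonal to itself.\<close>

lemma stochastic_Fubini:
  fixes g :: "real \<Rightarrow> real" and \<phi> :: "real \<Rightarrow> real \<Rightarrow> real" and N :: "real \<Rightarrow> 'a \<Rightarrow> real"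
  assumes s0: "0 \<le> s" and g: "integrable (leb_Icc s t) g"
    and \<phi>: "(\<lambda>(u, r). \<phi> u r) \<in> borel_measurable (leb_Icc s t \<Otimes>\<^sub>M leb_Icc s t)"
    and C: "\<And>u. u \<in> {s..t} \<Longrightarrow> (\<integral>r. (\<phi> u r)^2 \<partial>leb_Icc s t) \<le> C"
    and N: "(\<lambda>(u, w). N u w) \<in> borel_measurable (time_prod s t)"
    and Nito: "\<And>u. u \<in> {s..t} \<Longrightarrow> wiener s t (\<lambda>r. \<phi> u r) (N u)"
    and Y: "wiener s t (\<lambda>r. \<integral>u. g u * \<phi> u r \<partial>leb_Icc s t) Y"
  shows "AE w in M. (\<integral>u. g u * N u w \<partial>leb_Icc s t) = Y w"
proof -
  let ?L = "leb_Icc s t"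
  define Z where "Z w = (\<integral>u. g u * N u w \<partial>?L)" for w
  interpret L: finite_measure ?L by (rule finite_measure_leb_Icc)
  have sp: "space ?L = {s..t}" by (simp add: space_restrict_space)
  note isq = ito_integral_in_L2[OF s0]
  have sN: "in_L2 M (N u)" and s\<phi>: "in_L2 ?L (\<phi> u)" if "u \<in> space ?L" for u
    using isq[OF Nito] that sp by auto
  have CN: "expectation (\<lambda>w. (N u w)^2) \<le> C" if "u \<in> space ?L" for u
    using ito_isometry[OF s0 Nito Nito, of u u] C[of u] that sp by (simp add: power2_eq_square)
  have C': "\<And>u. u \<in> space ?L \<Longrightarrow> (\<integral>r. (\<phi> u r)^2 \<partial>?L) \<le> C" using C sp by simp
  have fubM: "(\<integral>u. g u * expectation (\<lambda>w. N u w * \<eta> w) \<partial>?L) = expectation (\<lambda>w. (\<integral>u. g u * N u w \<partial>?L) * \<eta> w)"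
    if "in_L2 M \<eta>" for \<eta>
    by (rule L2_Fubini_inner[OF L.sigma_finite_measure_axioms sigma_finite_measure_axioms g N]) (use sN CN that in auto)
  have fubL: "(\<integral>u. g u * (\<integral>r. \<phi> u r * f r \<partial>?L) \<partial>?L) = (\<integral>r. (\<integral>u. g u * \<phi> u r \<partial>?L) * f r \<partial>?L)"
    if "in_L2 ?L f" for f
    by (rule L2_Fubini_inner[OF L.sigma_finite_measure_axioms L.sigma_finite_measure_axioms g \<phi>]) (use s\<phi> C' that in auto)
  have sZ: "in_L2 M Z"
    unfolding Z_def[abs_def]
    by (rule L2_Fubini_in_L2[OF L.sigma_finite_measure_axioms sigma_finite_measure_axioms g N]) (use sN CN in auto)
  note sY = isq[OF Y]
  have ZX: "expectation (\<lambda>w. Z w * X w) = expectation (\<lambda>w. Y w * X w)"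
    if X: "wiener s t f X" for f X
  proof -
    have "expectation (\<lambda>w. Z w * X w) = (\<integral>u. g u * expectation (\<lambda>w. N u w * X w) \<partial>?L)"
      unfolding Z_def by (rule fubM[symmetric, OF isq(2)[OF X]])
    also have "\<dots> = (\<integral>u. g u * (\<integral>r. \<phi> u r * f r \<partial>?L) \<partial>?L)"
      by (intro lint_cong refl) (use ito_isometry[OF s0 Nito X] sp in simp)
    also have "\<dots> = (\<integral>r. (\<integral>u. g u * \<phi> u r \<partial>?L) * f r \<partial>?L)"
      by (rule fubL[OF isq(1)[OF X]])
    also have "\<dots> = expectation (\<lambda>w. Y w * X w)"
      by (rule ito_isometry[OF s0 Y X, symmetric])
    finally show ?thesis .
  qed
  \<comment> \<open>\<open>Z\<close> is not yet known to be an Ito integral, so \<open>ZX\<close>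
    cannot be applied to \<open>Z\<close> itself. Unfolding one factor puts the \<open>N u\<close>
    in its place, and these are Ito integrals.\<close>
  have "expectation (\<lambda>w. Z w * Z w) = (\<integral>u. g u * expectation (\<lambda>w. N u w * Z w) \<partial>?L)"
    using fubM[OF sZ] by (simp add: Z_def)
  also have "\<dots> = (\<integral>u. g u * expectation (\<lambda>w. N u w * Y w) \<partial>?L)"
    by (intro lint_cong refl) (use ZX[OF Nito] sp in \<open>simp add: mult.commute\<close>)
  also have "\<dots> = expectation (\<lambda>w. Z w * Y w)"
    unfolding Z_def by (rule fubM[OF sY(2)])
  finally have ZZ: "expectation (\<lambda>w. Z w * Z w) = expectation (\<lambda>w. Z w * Y w)" .
  have "expectation (\<lambda>w. (Z w - Y w)^2) = 0"
    using square_of_combination[OF sZ sY(2) sY(2), of 1 0] ZZ ZX[OF Y] by simp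
  moreover have "integrable M (\<lambda>w. (Z w - Y w)^2)"
    by (rule in_L2_square[OF in_L2_diff[OF sZ sY(2)]])
  ultimately have "AE w in M. (Z w - Y w)^2 = 0"
    by (subst (asm) integral_nonneg_eq_0_iff_AE) auto
  then show ?thesis
    unfolding Z_def by eventually_elim simp
qed

end

section \<open>The linear equation\<close>

lemma LBINT_additive:
  fixes f :: "real \<Rightarrow> real"
  assumes "integrable (leb_Icc s t) f" "s \<le> a" "a \<le> b" "b \<le> c" "c \<le> t"
  shows "(LBINT v=a..b. f v) + (LBINT v=b..c. f v) = (LBINT v=a..c. f v)"
proof (rule interval_integral_sum)
  have "set_integrable lborel {s..t} f" using assms(1) by (simp add: integrable_leb_Icc)
  then have "set_integrable lborel {a<..<c} f"
    by (rule set_integrable_subset) (use assms in auto)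
  then show "interval_lebesgue_integrable lborel (min (ereal a) (min (ereal b) (ereal c))) (max (ereal a) (max (ereal b) (ereal c))) f"
    using assms by (simp add: interval_lebesgue_integrable_def min_def max_def)
qed

text \<open>With r fixed, the indicator of \<open>{..u}\<close> at r says r \<le> u, so the integral
  runs over [r, t]. This is the inner integral in \<open>stochastic_Fubini\<close> for a kernel that
  stops at time u.\<close>

lemma ac_on_tail:
  assumes A: "ac_on s t A a" and r: "r \<in> {s..t}"
  shows "(\<integral>u. a u * indicat_real {..u} r \<partial>leb_Icc s t) = A t - A r"
proof -
  let ?L = "leb_Icc s t"
  note ia = ac_on_integrable[OF A]
  have [measurable]: "a \<in> borel_measurable ?L" using ia by auto
  have [measurable]: "(\<lambda>u::real. u) \<in> borel_measurable ?L" "indicat_real {..r} \<in> borel_measurable ?L"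
    by (rule measurable_leb_Icc, simp)+
  have "indicat_real {..u} r = of_bool (r \<le> u)" for u by (simp add: indicator_def)
  then have [measurable]: "(\<lambda>u. indicat_real {..u} r) \<in> borel_measurable ?L" by simp
  have "AE u in ?L. u \<noteq> r"
    by (subst AE_restrict_space_iff) (use AE_lborel_singleton[of r] in \<open>auto elim: eventually_mono\<close>)
  then have "(\<integral>u. a u * indicat_real {..u} r \<partial>?L) = (\<integral>u. a u - a u * indicat_real {..r} u \<partial>?L)"
    by (intro integral_cong_AE) (auto elim!: eventually_mono simp: indicator_def)
  also have "\<dots> = (\<integral>u. a u \<partial>?L) - (\<integral>u. a u * indicat_real {..r} u \<partial>?L)"
    by (rule lint_diff[OF ia integrable_upto[OF ia]])
  also have "(\<integral>u. a u \<partial>?L) = (\<integral>u. a u * indicat_real {..t} u \<partial>?L)"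
    by (rule lint_cong) (auto simp: space_restrict_space indicator_def)
  finally show ?thesis
    using ac_on_eq[OF A r] ac_on_eq[OF A, of t] r by simp
qed

lemma integrable_continuous_Icc:
  "continuous_on {s..t} f \<Longrightarrow> integrable (leb_Icc s t) f" for f :: "real \<Rightarrow> real"
  using integrable_mult_continuous[of s t "\<lambda>_. 1" f]
    finite_measure.integrable_const[OF finite_measure_leb_Icc, of s t "1 :: real"] by simp

lemma ac_on_LBINT: "integrable (leb_Icc s t) a \<Longrightarrow> ac_on s t (\<lambda>u. LBINT v=s..u. a v) a"
  by (rule ac_onI) auto

lemma ac_on_shift: "ac_on s t A a \<Longrightarrow> ac_on s t (\<lambda>u. c + A u) a"
  by (rule ac_on_cong[OF ac_on_add[OF ac_on_const[of s t c]]]) auto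

lemma ac_on_integral:
  assumes "ac_on s t A a" "s \<le> t"
  shows "A t = A s + (\<integral>u. a u \<partial>leb_Icc s t)"
  using ac_on_eq_LBINT[OF assms(1), of t] assms(2) by (simp add: integral_leb_Icc)

lemma sde_G_swap: "sde_G \<beta> u s = exp (LBINT v=s..u. \<beta> v)"
  unfolding sde_G_def by (subst interval_integral_endpoints_reverse) simp

lemma sde_G_refl: "sde_G \<beta> s s = 1"
  by (simp add: sde_G_def)

lemma sde_G_inverse: "sde_G \<beta> s u * sde_G \<beta> u s = 1"
  unfolding sde_G_swap[of \<beta> u s] by (simp add: sde_G_def exp_add[symmetric])

lemma sde_G_factor:
  assumes "integrable (leb_Icc s t) \<beta>" "s \<le> u" "u \<le> w" "w \<le> t"
  shows "sde_G \<beta> u w = sde_G \<beta> u s * sde_G \<beta> s w"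
  unfolding sde_G_swap[of \<beta> u s] using LBINT_additive[OF assms(1) order_refl assms(2-4)]
  by (simp add: sde_G_def exp_add[symmetric])

lemma ac_on_sde_G_swap:
  assumes "integrable (leb_Icc s t) \<beta>" "s \<le> t"
  shows "ac_on s t (\<lambda>u. sde_G \<beta> u s) (\<lambda>u. \<beta> u * sde_G \<beta> u s)"
  unfolding sde_G_swap by (rule ac_on_exp[OF ac_on_LBINT[OF assms(1)] assms(2)])

lemma ac_on_sde_G:
  assumes "integrable (leb_Icc s t) \<beta>" "s \<le> t"
  shows "ac_on s t (sde_G \<beta> s) (\<lambda>u. - \<beta> u * sde_G \<beta> s u)"
proof -
  have "integrable (leb_Icc s t) (\<lambda>u. - \<beta> u)" using assms by simp
  from ac_on_exp[OF ac_on_LBINT[OF this] assms(2)] show ?thesis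
    by (simp add: sde_G_def[abs_def] interval_lebesgue_integral_uminus)
qed

lemma integrable_sde_I:
  assumes "integrable (leb_Icc s t) \<alpha>" "integrable (leb_Icc s t) \<beta>" "s \<le> t"
  shows "integrable (leb_Icc s t) (\<lambda>u. \<alpha> u * sde_G \<beta> u s)"
  by (rule integrable_mult_continuous[OF assms(1) ac_on_continuous[OF ac_on_sde_G_swap[OF assms(2,3)]]])

text \<open>The mean solves the equation without noise: product rule for G(s, u) times x + I(s, u),
  where the factor G(u, s) in the density of I cancels.\<close>

lemma ac_on_sde_m:
  assumes \<alpha>: "integrable (leb_Icc s t) \<alpha>" and \<beta>: "integrable (leb_Icc s t) \<beta>" and "s \<le> t"
  shows "ac_on s t (\<lambda>u. sde_m \<alpha> \<beta> s u x) (\<lambda>u. \<alpha> u - \<beta> u * sde_m \<alpha> \<beta> s u x)"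
proof -
  have I: "ac_on s t (\<lambda>u. x + sde_I \<alpha> \<beta> s u) (\<lambda>u. \<alpha> u * sde_G \<beta> u s)"
    unfolding sde_I_def by (intro ac_on_shift ac_on_LBINT integrable_sde_I assms)
  have "\<alpha> u * sde_G \<beta> u s * sde_G \<beta> s u = \<alpha> u" for u
    using sde_G_inverse[of \<beta> s u] by (simp add: mult_ac)
  then show ?thesis
    by (intro ac_on_cong[OF ac_on_mult[OF ac_on_sde_G[OF \<beta> \<open>s \<le> t\<close>] I]]) (simp_all add: sde_m_def mult_ac)
qed

text \<open>Integration by parts against t - u, which vanishes at the upper end and has derivative
  -1.\<close>

lemma integral_sde_m:
  assumes \<alpha>: "integrable (leb_Icc s t) \<alpha>" and \<beta>: "integrable (leb_Icc s t) \<beta>" and st: "s \<le> t"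
  shows "(\<integral>u. sde_m \<alpha> \<beta> s u x \<partial>leb_Icc s t) = sde_M \<alpha> \<beta> s t x"
proof -
  let ?L = "leb_Icc s t"
  note m = ac_on_sde_m[OF assms, of x]
  have "ac_on s t (\<lambda>u. t - u) (\<lambda>_. -1)"
  proof (rule ac_onI)
    show "integrable ?L (\<lambda>_. -1 :: real)" by (rule integrable_continuous_Icc) simp
    fix u assume "s \<le> u"
    then show "t - u = t - s + (LBINT v=s..u. -1)" by (simp add: interval_integral_Icc)
  qed
  from ac_on_mult[OF this m]
  have p: "ac_on s t (\<lambda>u. (t - u) * sde_m \<alpha> \<beta> s u x) (\<lambda>u. (t - u) * (\<alpha> u - \<beta> u * sde_m \<alpha> \<beta> s u x) - sde_m \<alpha> \<beta> s u x)"
    by (rule ac_on_cong) (simp_all add: mult_ac)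
  have im: "integrable ?L (\<lambda>u. sde_m \<alpha> \<beta> s u x)"
    by (rule integrable_continuous_Icc[OF ac_on_continuous[OF m]])
  have id: "integrable ?L (\<lambda>u. (t - u) * (\<alpha> u - \<beta> u * sde_m \<alpha> \<beta> s u x))"
    using lintegrable_add[OF ac_on_integrable[OF p] im] by simp
  have "0 = (t - s) * sde_m \<alpha> \<beta> s s x + ((\<integral>u. (t - u) * (\<alpha> u - \<beta> u * sde_m \<alpha> \<beta> s u x) \<partial>?L) - (\<integral>u. sde_m \<alpha> \<beta> s u x \<partial>?L))"
    using ac_on_integral[OF p st] by (simp add: lint_diff[OF id im])
  moreover have "sde_m \<alpha> \<beta> s s x = x" by (simp add: sde_m_def sde_G_refl sde_I_def)
  moreover have "(LBINT u=s..t. (t - u) * (\<alpha> u - \<beta> u * sde_G \<beta> s u * (x + sde_I \<alpha> \<beta> s u)))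
    = (\<integral>u. (t - u) * (\<alpha> u - \<beta> u * sde_m \<alpha> \<beta> s u x) \<partial>?L)"
    by (simp add: integral_leb_Icc[OF st] sde_m_def mult.assoc)
  ultimately show ?thesis by (simp add: sde_M_def)
qed

text \<open>The paths of the noise \<open>N\<close> need not have bounded variation, so the integrating factor is
  applied to \<open>l - N\<close> only.\<close>

lemma variation_of_constants:
  fixes l :: "real \<Rightarrow> real"
  assumes \<alpha>: "integrable (leb_Icc s t) \<alpha>" and \<beta>: "integrable (leb_Icc s t) \<beta>" and st: "s \<le> t"
    and l: "continuous_on {s..t} l"
  defines "N \<equiv> \<lambda>u. l u - l s - (LBINT v=s..u. \<alpha> v - \<beta> v * l v)"
  shows "l t = sde_m \<alpha> \<beta> s t (l s) + N t - sde_G \<beta> s t * (\<integral>u. \<beta> u * sde_G \<beta> u s * N u \<partial>leb_Icc s t)"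
proof -
  let ?L = "leb_Icc s t"
  let ?D = "\<lambda>u. l s + (LBINT v=s..u. \<alpha> v - \<beta> v * l v)" and ?H = "\<lambda>u. sde_G \<beta> u s"
  have i: "integrable ?L (\<lambda>v. \<alpha> v - \<beta> v * l v)"
    by (intro lintegrable_diff \<alpha> integrable_mult_continuous[OF \<beta> l])
  have D: "ac_on s t ?D (\<lambda>v. \<alpha> v - \<beta> v * l v)"
    by (intro ac_on_shift ac_on_LBINT i)
  note H = ac_on_sde_G_swap[OF \<beta> st]
  have iI: "integrable ?L (\<lambda>u. \<alpha> u * ?H u)" by (rule integrable_sde_I[OF \<alpha> \<beta> st])
  have N: "N u = l u - ?D u" for u by (simp add: N_def)
  have iN: "integrable ?L (\<lambda>u. \<beta> u * ?H u * N u)"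
    unfolding N by (intro integrable_mult_continuous[OF ac_on_integrable[OF H]] continuous_on_diff l ac_on_continuous[OF D])
  \<comment> \<open>With l = D + N the terms in D cancel: (\<alpha> - \<beta> l) H + \<beta> H D =
    \<alpha> H - \<beta> H N.\<close>
  have "ac_on s t (\<lambda>u. ?D u * ?H u) (\<lambda>u. \<alpha> u * ?H u - \<beta> u * ?H u * N u)"
    by (rule ac_on_cong[OF ac_on_mult[OF D H]]) (simp_all add: N algebra_simps)
  from ac_on_integral[OF this st]
  have DH: "?D t * ?H t = l s + ((\<integral>u. \<alpha> u * ?H u \<partial>?L) - (\<integral>u. \<beta> u * ?H u * N u \<partial>?L))"
    by (simp add: sde_G_refl lint_diff[OF iI iN])
  \<comment> \<open>The inserted factor G(s, t) / G(s, t) = 1 brings in the product computed in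
    \<open>DH\<close>.\<close>
  have "?D t = sde_G \<beta> s t * ?H t * ?D t" by (simp only: sde_G_inverse mult_1)
  also have "\<dots> = sde_G \<beta> s t * (?D t * ?H t)" by (simp only: mult.assoc mult.commute)
  finally have "?D t = sde_m \<alpha> \<beta> s t (l s) - sde_G \<beta> s t * (\<integral>u. \<beta> u * ?H u * N u \<partial>?L)"
    unfolding DH
    unfolding sde_m_def sde_I_def integral_leb_Icc[OF st] by (simp add: algebra_simps)
  then show ?thesis using N[of t] by simp
qed

section \<open>Joint measurability in time and \<omega>\<close>

text \<open>Time is rounded down to a grid starting at \<open>s\<close>. The rounded process
  involves countably many times only, and continuity of the paths gives pointwise
  convergence.\<close>

lemma continuous_process_measurable:
  fixes X :: "real \<Rightarrow> 'a \<Rightarrow> real"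
  assumes "s \<le> t" and meas: "\<And>u. u \<in> {s..t} \<Longrightarrow> X u \<in> borel_measurable M"
    and cont: "\<And>w. w \<in> space M \<Longrightarrow> continuous_on {s..t} (\<lambda>u. X u w)"
  shows "(\<lambda>(u, w). X u w) \<in> borel_measurable (leb_Icc s t \<Otimes>\<^sub>M M)"
proof -
  define \<rho> where "\<rho> k u = s + real_of_int \<lfloor>(u - s) * real (Suc k)\<rfloor> / real (Suc k)" for k u
  have \<rho>: "s \<le> \<rho> k u" "\<rho> k u \<le> u" "u - 1 / real (Suc k) \<le> \<rho> k u" if "s \<le> u" for k u
  proof -
    have "0 \<le> (u - s) * real (Suc k)" using that by simp
    then show "s \<le> \<rho> k u" by (simp add: \<rho>_def)
    have "real_of_int \<lfloor>(u - s) * real (Suc k)\<rfloor> / real (Suc k) \<le> (u - s) * real (Suc k) / real (Suc k)"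
      by (intro divide_right_mono) auto
    then show "\<rho> k u \<le> u" by (simp add: \<rho>_def)
    have "((u - s) * real (Suc k) - 1) / real (Suc k) \<le> real_of_int \<lfloor>(u - s) * real (Suc k)\<rfloor> / real (Suc k)"
      by (intro divide_right_mono) linarith+
    then show "u - 1 / real (Suc k) \<le> \<rho> k u" by (simp add: \<rho>_def diff_divide_distrib)
  qed
  show ?thesis
  \<comment> \<open>\<open>measurable_compose_countable\<close> asks for every integer index, also
    for grid points outside [s, t]; clamping keeps the time where \<open>X\<close> is
    measurable.\<close>
  proof (rule borel_measurable_LIMSEQ_real[where u="\<lambda>k (u, w). X (max s (min t (\<rho> k u))) w"])
    fix k
    have "(\<lambda>u. \<lfloor>(u - s) * real (Suc k)\<rfloor>) \<in> measurable borel (count_space UNIV)" by measurable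
    then have "(\<lambda>u. \<lfloor>(u - s) * real (Suc k)\<rfloor>) \<in> measurable (leb_Icc s t) (count_space UNIV)"
      by (intro measurable_restrict_space1) simp
    then have 1: "(\<lambda>p. \<lfloor>(fst p - s) * real (Suc k)\<rfloor>) \<in> measurable (leb_Icc s t \<Otimes>\<^sub>M M) (count_space UNIV)"
      by (rule measurable_compose[OF measurable_fst])
    have 2: "(\<lambda>p. X (max s (min t (s + real_of_int i / real (Suc k)))) (snd p)) \<in> borel_measurable (leb_Icc s t \<Otimes>\<^sub>M M)" for i :: int
      by (rule measurable_compose[OF measurable_snd meas]) (use \<open>s \<le> t\<close> in auto)
    show "(\<lambda>(u, w). X (max s (min t (\<rho> k u))) w) \<in> borel_measurable (leb_Icc s t \<Otimes>\<^sub>M M)"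
      using measurable_compose_countable[OF 2 1] by (simp add: split_def \<rho>_def)
  next
    fix p assume "p \<in> space (leb_Icc s t \<Otimes>\<^sub>M M)"
    then obtain u w where p: "p = (u, w)" "u \<in> {s..t}" "w \<in> space M"
      by (auto simp: space_pair_measure space_restrict_space)
    have "(\<lambda>k. \<rho> k u) \<longlonglongrightarrow> u"
    proof (rule tendsto_sandwich[where h="\<lambda>_. u", OF always_eventually always_eventually])
      have "(\<lambda>k. u - 1 / real (Suc k)) \<longlonglongrightarrow> u - 0"
        by (intro tendsto_intros LIMSEQ_Suc[OF lim_1_over_n])
      then show "(\<lambda>k. u - 1 / real (Suc k)) \<longlonglongrightarrow> u" by simp
    qed (use \<rho> p(2) in auto)
    then have "(\<lambda>k. X (\<rho> k u) w) \<longlonglongrightarrow> X u w"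
      by (rule continuous_on_tendsto_compose[OF cont[OF p(3)]])
        (use p(2) \<rho>[of u] in \<open>auto intro!: always_eventually intro: order_trans\<close>)
    moreover have "max s (min t (\<rho> k u)) = \<rho> k u" for k
      using \<rho>[of u k] p(2) by auto
    ultimately show "(\<lambda>k. (\<lambda>(u, w). X (max s (min t (\<rho> k u))) w) p) \<longlonglongrightarrow> (\<lambda>(u, w). X u w) p"
      by (simp add: p(1))
  qed
qed

lemma continuous_leb_Icc_measurable:
  "continuous_on {s..t} (f :: real \<Rightarrow> real) \<Longrightarrow> f \<in> borel_measurable (leb_Icc s t)"
  unfolding measurable_leb_Icc_iff by (rule borel_measurable_continuous_on_restrict)

lemma in_L2_continuous_mult:
  assumes "in_L2 (leb_Icc s t) f" "continuous_on {s..t} g"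
  shows "in_L2 (leb_Icc s t) (\<lambda>u. g u * f u)"
proof -
  from continuous_on_Icc_bounded[OF assms(2)] obtain C where "\<And>u. u \<in> {s..t} \<Longrightarrow> \<bar>g u\<bar> \<le> C" by blast
  then show ?thesis
    by (intro in_L2_bounded_mult[OF assms(1) continuous_leb_Icc_measurable[OF assms(2)], of C])
      (auto simp: space_restrict_space)
qed

lemma indicator_atMost_measurable:
  "(\<lambda>(u, r). indicat_real {..u} r) \<in> borel_measurable (leb_Icc s t \<Otimes>\<^sub>M leb_Icc s t)"
proof -
  have [measurable]: "(\<lambda>u::real. u) \<in> borel_measurable (leb_Icc s t)"
    by (rule measurable_leb_Icc) simp
  have "(\<lambda>(u::real, r). indicat_real {..u} r) = (\<lambda>(u, r). of_bool (r \<le> u))"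
    by (auto simp: fun_eq_iff indicator_def)
  then show ?thesis by simp
qed

text \<open>Moving the variable upper limit into an indicator leaves a parameter integral over a
  fixed measure space.\<close>

lemma indefinite_integral_measurable:
  fixes \<phi> :: "real \<Rightarrow> 'b \<Rightarrow> real"
  assumes \<phi>[measurable]: "(\<lambda>(v, w). \<phi> v w) \<in> borel_measurable (leb_Icc s t \<Otimes>\<^sub>M M)"
  shows "(\<lambda>(u, w). LBINT v=s..u. \<phi> v w) \<in> borel_measurable (leb_Icc s t \<Otimes>\<^sub>M M)"
proof -
  interpret L: finite_measure "leb_Icc s t" by (rule finite_measure_leb_Icc)
  note [measurable] = indicator_atMost_measurable[of s t]
  have "(\<lambda>(p, v). (\<lambda>(v, w). \<phi> v w) (v, snd p) * (\<lambda>(u, r). indicat_real {..u} r) (fst p, v))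
    \<in> borel_measurable ((leb_Icc s t \<Otimes>\<^sub>M M) \<Otimes>\<^sub>M leb_Icc s t)"
    by measurable
  then have "(\<lambda>p. \<integral>v. \<phi> v (snd p) * indicat_real {..fst p} v \<partial>leb_Icc s t) \<in> borel_measurable (leb_Icc s t \<Otimes>\<^sub>M M)"
    by (intro L.borel_measurable_lebesgue_integral) simp
  then show ?thesis
    by (subst measurable_cong[where g="\<lambda>p. \<integral>v. \<phi> v (snd p) * indicat_real {..fst p} v \<partial>leb_Icc s t"])
      (auto simp: space_pair_measure space_restrict_space integral_leb_Icc_upto)
qed

section \<open>The solution and its time integral as Ito integrals\<close>

context brownian_motion
begin

lemma has_ito_integral_ito_integral:
  "ito_integrable M F W s t X \<Longrightarrow> has_ito_integral M F W s t X (ito_integral M F W s t X)"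
  unfolding ito_integrable_def ito_integral_def by (rule someI_ex[where P="has_ito_integral M F W s t X"])

lemma ito_integral_exists':
  assumes "0 \<le> s" "s \<le> t" "in_L2 (leb_Icc s t) f"
  obtains Y where "wiener s t f Y"
  using ito_integral_exists[OF assms] by metis

context
  fixes \<alpha> \<beta> \<sigma> :: "real \<Rightarrow> real" and s :: real and lam :: "real \<Rightarrow> 'a \<Rightarrow> real"
  assumes s: "0 \<le> s" and sol: "strong_solution M F W \<alpha> \<beta> \<sigma> s lam"
    and \<alpha>: "\<And>t. integrable (leb_Icc s t) \<alpha>" and \<beta>: "\<And>t. integrable (leb_Icc s t) \<beta>"
begin

lemma lam_measurable: "s \<le> u \<Longrightarrow> lam u \<in> borel_measurable M"
  using sol s F_measurable[of u] by (auto simp: strong_solution_def)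

lemma lam_continuous: "w \<in> space M \<Longrightarrow> continuous_on {s..t} (\<lambda>u. lam u w)"
  using sol by (auto simp: strong_solution_def intro: continuous_on_subset)

lemma lam_joint_measurable: "s \<le> t \<Longrightarrow> (\<lambda>(u, w). lam u w) \<in> borel_measurable (time_prod s t)"
  by (rule continuous_process_measurable) (auto intro: lam_measurable lam_continuous)

text \<open>\<open>strong_solution\<close> includes that \<sigma> has an Ito integral on [s, t], and
  this forces square integrability.\<close>

lemma \<sigma>_in_L2: "s \<le> t \<Longrightarrow> in_L2 (leb_Icc s t) \<sigma>"
  using sol s ito_integral_in_L2(1)[OF s has_ito_integral_ito_integral, of t \<sigma>]
  by (auto simp: strong_solution_def)

lemma drift_joint_measurable:
  assumes "s \<le> t"
  shows "(\<lambda>(u :: real, w). LBINT v=s..u. \<alpha> v - \<beta> v * lam v w) \<in> borel_measurable (time_prod s t)"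
proof -
  have [measurable]: "\<alpha> \<in> borel_measurable (leb_Icc s t)" "\<beta> \<in> borel_measurable (leb_Icc s t)"
    using \<alpha>[of t] \<beta>[of t] by auto
  note lam_joint_measurable[OF assms, measurable]
  have "(\<lambda>(v, w). \<alpha> v - \<beta> v * (\<lambda>(v, w). lam v w) (v, w)) \<in> borel_measurable (time_prod s t)"
    by measurable
  then show ?thesis by (intro indefinite_integral_measurable) simp
qed

text \<open>Replaces the arbitrary version \<open>ito_integral\<close> by one that is read off the
  paths of \<open>lam\<close> and is therefore jointly measurable in time and \<omega>.\<close>

lemma noise_ito:
  assumes "s \<le> u"
  shows "wiener s u \<sigma> (\<lambda>w. lam u w - lam s w - (LBINT v=s..u. \<alpha> v - \<beta> v * lam v w))"
proof -
  from measurable_compose_Pair1[OF _ drift_joint_measurable[OF assms], of u]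
  have m: "(\<lambda>w. LBINT v=s..u. \<alpha> v - \<beta> v * lam v w) \<in> borel_measurable M"
    using assms by (simp add: space_restrict_space)
  have ii: "ito_integrable M F W s u (\<lambda>u _. \<sigma> u)"
    and ae: "AE w in M. lam u w = lam s w + (LBINT u=s..u. \<alpha> u - \<beta> u * lam u w) + ito_integral M F W s u (\<lambda>u _. \<sigma> u) w"
    using sol assms by (auto simp: strong_solution_def elim: eventually_mono)
  show ?thesis
  proof (rule has_ito_integral_cong[OF has_ito_integral_ito_integral[OF ii]])
    show "AE w in M. ito_integral M F W s u (\<lambda>u _. \<sigma> u) w = lam u w - lam s w - (LBINT v=s..u. \<alpha> v - \<beta> v * lam v w)"
      using ae by eventually_elim simp
    show "(\<lambda>w. lam u w - lam s w - (LBINT v=s..u. \<alpha> v - \<beta> v * lam v w)) \<in> borel_measurable M"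
      using m lam_measurable[OF assms] lam_measurable[of s] by simp
  qed simp
qed

text \<open>With H r = 1 / G(s, r), Fubini makes \<integral> \<beta> H N du the Ito integral of (H t
  - H r) \<sigma> r. Subtracting G(s, t) times this from \<sigma> r leaves G(s, t) H r \<sigma> r,
  since G(s, t) H t = 1.\<close>

lemma solution_ito:
  assumes st: "s \<le> t"
  shows "wiener s t (\<lambda>r. sde_G \<beta> s t * (\<sigma> r * sde_G \<beta> r s))
    (\<lambda>w. lam t w - sde_m \<alpha> \<beta> s t (lam s w))"
proof -
  let ?L = "leb_Icc s t"
  let ?H = "\<lambda>u. sde_G \<beta> u s"
  define N where "N u w = lam u w - lam s w - (LBINT v=s..u. \<alpha> v - \<beta> v * lam v w)" for u w
  \<comment> \<open>The kernel that writes \<open>N u\<close>, for every u, as an integral over all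
    of [s, t].\<close>
  define \<phi> where "\<phi> u r = \<sigma> r * indicat_real {..u} r" for u r :: real
  note H = ac_on_sde_G_swap[OF \<beta>[of t] st]
  note cH = ac_on_continuous[OF H]
  note s\<sigma> = \<sigma>_in_L2[OF st]
  have [measurable]: "\<sigma> \<in> borel_measurable ?L" by (rule in_L2_measurable[OF s\<sigma>])
  note indicator_atMost_measurable[of s t, measurable]
  have Nito: "wiener s t (\<lambda>r. \<phi> u r) (N u)" if "u \<in> {s..t}" for u
    unfolding \<phi>_def N_def using that s by (intro ito_integral_extend[OF noise_ito]) auto
  have \<phi>: "(\<lambda>(u, r). \<phi> u r) \<in> borel_measurable (?L \<Otimes>\<^sub>M ?L)"
  proof -
    have "(\<lambda>(u, r). \<sigma> r * (\<lambda>(u, r). indicat_real {..u} r) (u, r)) \<in> borel_measurable (?L \<Otimes>\<^sub>M ?L)" by measurable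
    then show ?thesis by (simp add: \<phi>_def)
  qed
  have C: "(\<integral>r. (\<phi> u r)^2 \<partial>?L) \<le> (\<integral>r. (\<sigma> r)^2 \<partial>?L)" if "u \<in> {s..t}" for u
  proof (rule integral_mono)
    show "integrable ?L (\<lambda>r. (\<phi> u r)^2)"
      by (rule in_L2_square[OF ito_integral_in_L2(1)[OF s Nito[OF that]]])
    show "integrable ?L (\<lambda>r. (\<sigma> r)^2)" by (rule in_L2_square[OF s\<sigma>])
  qed (auto simp: \<phi>_def indicator_def)
  have N: "(\<lambda>(u, w). N u w) \<in> borel_measurable (?L \<Otimes>\<^sub>M M)"
  proof -
    have lams: "lam s \<in> borel_measurable M" by (rule lam_measurable) simp
    have "(\<lambda>p. (\<lambda>(u, w). lam u w) p - lam s (snd p) - (\<lambda>(u :: real, w). LBINT v=s..u. \<alpha> v - \<beta> v * lam v w) p) \<in> borel_measurable (?L \<Otimes>\<^sub>M M)"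
      by (intro borel_measurable_diff lam_joint_measurable[OF st] measurable_compose[OF measurable_snd lams]
          drift_joint_measurable[OF st])
    then show ?thesis by (simp add: N_def split_def)
  qed
  have h: "(\<integral>u. \<beta> u * ?H u * \<phi> u r \<partial>?L) = (?H t - ?H r) * \<sigma> r" if "r \<in> {s..t}" for r
  proof -
    have "(\<integral>u. \<beta> u * ?H u * \<phi> u r \<partial>?L) = (\<integral>u. \<sigma> r * (\<beta> u * ?H u * indicat_real {..u} r) \<partial>?L)"
      by (intro lint_cong) (auto simp: \<phi>_def)
    then show ?thesis using ac_on_tail[OF H that] by simp
  qed
  have "in_L2 ?L (\<lambda>r. (?H t - ?H r) * \<sigma> r)"
    by (intro in_L2_continuous_mult[OF s\<sigma>] continuous_intros cH)
  then obtain Y where Y: "wiener s t (\<lambda>r. (?H t - ?H r) * \<sigma> r) Y"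
    by (rule ito_integral_exists'[OF s st])
  have Ym: "Y \<in> borel_measurable M"
    by (rule in_L2_measurable[OF ito_integral_in_L2(2)[OF s Y]])
  have Y': "wiener s t (\<lambda>r. \<integral>u. \<beta> u * ?H u * \<phi> u r \<partial>?L) Y"
    by (rule has_ito_integral_cong[OF Y _ _ Ym]) (simp_all add: h)
  have fub: "AE w in M. (\<integral>u. \<beta> u * ?H u * N u w \<partial>?L) = Y w"
    by (rule stochastic_Fubini[OF s ac_on_integrable[OF H] \<phi> C N Nito Y'])
  have "in_L2 ?L (\<lambda>r. (sde_G \<beta> s t * ?H r) * \<sigma> r)"
    by (intro in_L2_continuous_mult[OF s\<sigma>] continuous_intros cH)
  then have "in_L2 ?L (\<lambda>r. sde_G \<beta> s t * (\<sigma> r * ?H r))"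
    by (simp add: mult_ac)
  then obtain X where X: "wiener s t (\<lambda>r. sde_G \<beta> s t * (\<sigma> r * ?H r)) X"
    by (rule ito_integral_exists'[OF s st])
  have Nt: "wiener s t \<sigma> (N t)"
    unfolding N_def by (rule noise_ito[OF st])
  have "AE w in M. X w = 1 * N t w + (- sde_G \<beta> s t) * Y w"
  proof (rule ito_integral_combination[OF s X Nt Y])
    fix r
    have "sde_G \<beta> s t * (\<sigma> r * ?H r) = sde_G \<beta> s t * ?H t * \<sigma> r - sde_G \<beta> s t * ((?H t - ?H r) * \<sigma> r)"
      by (simp add: algebra_simps)
    then show "sde_G \<beta> s t * (\<sigma> r * ?H r) = 1 * \<sigma> r + - sde_G \<beta> s t * ((?H t - ?H r) * \<sigma> r)"
      by (simp add: sde_G_inverse)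
  qed
  \<comment> \<open>Pathwise, \<open>variation_of_constants\<close> turns the combination of
    \<open>N t\<close> and the time integral into \<open>lam t\<close> minus the mean started at
    \<open>lam s\<close>.\<close>
  with fub have ae: "AE w in M. X w = lam t w - sde_m \<alpha> \<beta> s t (lam s w)"
    using AE_space
  proof eventually_elim
    case (elim w)
    show ?case
      using variation_of_constants[OF \<alpha> \<beta> st lam_continuous[OF elim(3)]] elim(1,2)
      by (simp add: N_def)
  qed
  show ?thesis
  proof (rule has_ito_integral_cong[OF X _ ae])
    have [measurable]: "lam s \<in> borel_measurable M" "lam t \<in> borel_measurable M"
      using st by (auto intro: lam_measurable)
    show "(\<lambda>w. lam t w - sde_m \<alpha> \<beta> s t (lam s w)) \<in> borel_measurable M"
      unfolding sde_m_def by measurable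
  qed simp
qed

text \<open>Isolates the dependence on r as a continuous function times \<sigma> r / G(s, r), which
  is visibly square integrable and is the form that \<open>ac_on_tail\<close> produces.\<close>

lemma sde_K_eq:
  assumes "r \<in> {s..t}"
  shows "sde_K \<beta> \<sigma> r t = ((LBINT u=s..t. sde_G \<beta> s u) - (LBINT u=s..r. sde_G \<beta> s u)) * (\<sigma> r * sde_G \<beta> r s)"
proof -
  have r: "s \<le> r" "r \<le> t" "s \<le> t" using assms by auto
  have i: "integrable (leb_Icc s t) (sde_G \<beta> s)"
    by (rule integrable_continuous_Icc[OF ac_on_continuous[OF ac_on_sde_G[OF \<beta> r(3)]]])
  have "sde_K \<beta> \<sigma> r t = (LBINT u=r..t. \<sigma> r * sde_G \<beta> r s * sde_G \<beta> s u)"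
    unfolding sde_K_def
  proof (rule interval_integral_cong)
    fix u assume "u \<in> einterval (min (ereal r) (ereal t)) (max (ereal r) (ereal t))"
    then have "r \<le> u" "u \<le> t" using r by (auto simp: einterval_iff min_def max_def split: if_splits)
    then show "\<sigma> r * sde_G \<beta> r u = \<sigma> r * sde_G \<beta> r s * sde_G \<beta> s u"
      using sde_G_factor[OF \<beta>[of t] r(1), of u] by simp
  qed
  also have "\<dots> = \<sigma> r * sde_G \<beta> r s * (LBINT u=r..t. sde_G \<beta> s u)" by simp
  also have "(LBINT u=r..t. sde_G \<beta> s u) = (LBINT u=s..t. sde_G \<beta> s u) - (LBINT u=s..r. sde_G \<beta> s u)"
    using LBINT_additive[OF i order_refl r(1,2) order_refl] by simp
  finally show ?thesis by (simp add: mult_ac)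
qed

text \<open>Stochastic Fubini for the deviations \<open>R u\<close> from the mean: integrating the
  kernel G(s, u) \<sigma> r / G(s, r) over u from r to t gives K(r, t). The mean itself integrates
  to \<open>sde_M\<close> by \<open>integral_sde_m\<close>.\<close>

lemma solution_integral_ito:
  assumes st: "s \<le> t"
  shows "wiener s t (\<lambda>r. sde_K \<beta> \<sigma> r t)
    (\<lambda>w. (LBINT u=s..t. lam u w) - sde_M \<alpha> \<beta> s t (lam s w))"
proof -
  let ?L = "leb_Icc s t"
  let ?H = "\<lambda>u. sde_G \<beta> u s" and ?G = "sde_G \<beta> s"
  define R where "R u w = lam u w - sde_m \<alpha> \<beta> s u (lam s w)" for u w
  define \<phi> where "\<phi> u r = ?G u * (\<sigma> r * ?H r) * indicat_real {..u} r" for u r :: real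
  interpret L: finite_measure ?L by (rule finite_measure_leb_Icc)
  note cH = ac_on_continuous[OF ac_on_sde_G_swap[OF \<beta>[of t] st]]
  note cG = ac_on_continuous[OF ac_on_sde_G[OF \<beta>[of t] st]]
  have Q: "ac_on s t (\<lambda>u. LBINT v=s..u. ?G v) ?G"
    by (rule ac_on_LBINT[OF integrable_continuous_Icc[OF cG]])
  have sf: "in_L2 ?L (\<lambda>r. \<sigma> r * ?H r)"
    using in_L2_continuous_mult[OF \<sigma>_in_L2[OF st] cH] by (simp add: mult.commute)
  have [measurable]: "(\<lambda>r. \<sigma> r * ?H r) \<in> borel_measurable ?L" by (rule in_L2_measurable[OF sf])
  have Gm[measurable]: "?G \<in> borel_measurable ?L" by (rule continuous_leb_Icc_measurable[OF cG])
  have Im: "sde_I \<alpha> \<beta> s \<in> borel_measurable ?L"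
    unfolding sde_I_def[abs_def]
    by (rule continuous_leb_Icc_measurable[OF ac_on_continuous[OF ac_on_LBINT[OF integrable_sde_I[OF \<alpha> \<beta> st]]]])
  have lams: "lam s \<in> borel_measurable M" by (rule lam_measurable) simp
  note indicator_atMost_measurable[of s t, measurable]
  have Rito: "wiener s t (\<lambda>r. \<phi> u r) (R u)" if "u \<in> {s..t}" for u
    unfolding \<phi>_def R_def using that s by (intro ito_integral_extend[OF solution_ito]) auto
  have \<phi>: "(\<lambda>(u, r). \<phi> u r) \<in> borel_measurable (?L \<Otimes>\<^sub>M ?L)"
  proof -
    have "(\<lambda>p. ?G (fst p) * (\<lambda>r. \<sigma> r * ?H r) (snd p) * (\<lambda>(u, r). indicat_real {..u} r) p) \<in> borel_measurable (?L \<Otimes>\<^sub>M ?L)"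
      by measurable
    then show ?thesis by (simp add: \<phi>_def split_def)
  qed
  have R: "(\<lambda>(u, w). R u w) \<in> borel_measurable (?L \<Otimes>\<^sub>M M)"
  proof -
    have "(\<lambda>p. (\<lambda>(u, w). lam u w) p - ?G (fst p) * (lam s (snd p) + sde_I \<alpha> \<beta> s (fst p))) \<in> borel_measurable (?L \<Otimes>\<^sub>M M)"
      by (intro borel_measurable_diff borel_measurable_times borel_measurable_add lam_joint_measurable[OF st]
          measurable_compose[OF measurable_fst Gm] measurable_compose[OF measurable_fst Im] measurable_compose[OF measurable_snd lams])
    then show ?thesis by (simp add: R_def sde_m_def split_def)
  qed
  \<comment> \<open>Continuity bounds G(s, u) on [s, t], which yields the uniform bound on the norms
    of the \<phi> u.\<close>
  from continuous_on_Icc_bounded[OF cG] obtain B where B: "\<And>u. u \<in> {s..t} \<Longrightarrow> \<bar>?G u\<bar> \<le> B" by blast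
  have C: "(\<integral>r. (\<phi> u r)^2 \<partial>?L) \<le> (\<integral>r. B^2 * (\<sigma> r * ?H r)^2 \<partial>?L)" if u: "u \<in> {s..t}" for u
  proof (rule integral_mono)
    show "integrable ?L (\<lambda>r. (\<phi> u r)^2)"
      by (rule in_L2_square[OF ito_integral_in_L2(1)[OF s Rito[OF u]]])
    show "integrable ?L (\<lambda>r. B^2 * (\<sigma> r * ?H r)^2)" using in_L2_square[OF sf] by simp
    fix r
    have "\<bar>?G u\<bar>^2 \<le> B^2" by (rule power_mono[OF B[OF u]]) simp
    then have "(?G u)^2 * (\<sigma> r * ?H r)^2 \<le> B^2 * (\<sigma> r * ?H r)^2" by (intro mult_right_mono) auto
    moreover have "(\<phi> u r)^2 \<le> (?G u)^2 * (\<sigma> r * ?H r)^2"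
      unfolding \<phi>_def by (simp add: power_mult_distrib indicator_def)
    ultimately show "(\<phi> u r)^2 \<le> B^2 * (\<sigma> r * ?H r)^2" by linarith
  qed
  let ?K = "\<lambda>r. ((LBINT u=s..t. ?G u) - (LBINT u=s..r. ?G u)) * (\<sigma> r * ?H r)"
  have h: "(\<integral>u. 1 * \<phi> u r \<partial>?L) = ?K r" if "r \<in> {s..t}" for r
  proof -
    have "(\<integral>u. 1 * \<phi> u r \<partial>?L) = (\<integral>u. (\<sigma> r * ?H r) * (?G u * indicat_real {..u} r) \<partial>?L)"
      by (intro lint_cong) (auto simp: \<phi>_def)
    then show ?thesis using ac_on_tail[OF Q that] by simp
  qed
  have "in_L2 ?L ?K"
    by (intro in_L2_continuous_mult[OF sf] continuous_on_diff continuous_on_const ac_on_continuous[OF Q])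
  then obtain Y where Y: "wiener s t (\<lambda>r. ?K r) Y"
    by (rule ito_integral_exists'[OF s st])
  have Ym: "Y \<in> borel_measurable M"
    by (rule in_L2_measurable[OF ito_integral_in_L2(2)[OF s Y]])
  have Y': "wiener s t (\<lambda>r. \<integral>u. 1 * \<phi> u r \<partial>?L) Y"
    by (rule has_ito_integral_cong[OF Y _ _ Ym]) (simp_all add: h[simplified])
  have fub: "AE w in M. (\<integral>u. 1 * R u w \<partial>?L) = Y w"
    by (rule stochastic_Fubini[OF s _ \<phi> C R Rito Y']) simp
  have int: "(\<integral>u. 1 * R u w \<partial>?L) = (LBINT u=s..t. lam u w) - sde_M \<alpha> \<beta> s t (lam s w)" if "w \<in> space M" for w
    unfolding R_def mult_1 integral_sde_m[OF \<alpha> \<beta> st, symmetric] integral_leb_Icc[OF st]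
    by (intro lint_diff integrable_continuous_Icc lam_continuous[OF that]
        ac_on_continuous[OF ac_on_sde_m[OF \<alpha> \<beta> st]])
  show ?thesis
  proof (rule has_ito_integral_cong[OF Y])
    show "?K r = sde_K \<beta> \<sigma> r t" if "r \<in> {s..t}" for r
      by (rule sde_K_eq[OF that, symmetric])
    show "AE w in M. Y w = (LBINT u=s..t. lam u w) - sde_M \<alpha> \<beta> s t (lam s w)"
      using fub AE_space by eventually_elim (simp only: int)
    have "(\<lambda>w. \<integral>u. 1 * R u w \<partial>?L) \<in> borel_measurable M"
    proof (rule L.borel_measurable_lebesgue_integral)
      show "(\<lambda>(w, u). 1 * R u w) \<in> borel_measurable (M \<Otimes>\<^sub>M ?L)"
        using measurable_pair_swap[OF R] by (simp add: split_def)
    qed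
    then show "(\<lambda>w. (LBINT u=s..t. lam u w) - sde_M \<alpha> \<beta> s t (lam s w)) \<in> borel_measurable M"
      by (subst (asm) measurable_cong[OF int])
  qed
qed

text \<open>\<open>lam s\<close> is measurable for \<open>F s\<close>, so its preimages are among
  the events for which \<open>ito_integral_law\<close> gives independence.\<close>

lemma cond_law_ito:
  assumes st: "s \<le> t" and Y: "wiener s t f Y" and a: "a \<in> borel_measurable borel"
  shows "cond_law M (lam s) (\<lambda>w. a (lam s w) + Y w) (\<lambda>x. normal_law (a x) (LBINT r=s..t. (f r)^2))"
proof -
  have Ym[measurable]: "Y \<in> borel_measurable M"
    by (rule in_L2_measurable[OF ito_integral_in_L2(2)[OF s Y]])
  have lams[measurable]: "lam s \<in> borel_measurable M" by (rule lam_measurable) simp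
  have v: "(LBINT r=s..t. (f r)^2) = (\<integral>r. (f r)^2 \<partial>leb_Icc s t)"
    by (rule integral_leb_Icc[OF st])
  note a[measurable]
  show ?thesis
    unfolding v
  proof (rule cond_law_shift_normal[OF lams Ym _ a])
    fix C B :: "real set" assume "C \<in> sets borel" and B: "B \<in> sets borel"
    have "lam s \<in> borel_measurable (F s)" using sol by (auto simp: strong_solution_def)
    from measurable_sets[OF this \<open>C \<in> sets borel\<close>] have A: "lam s -` C \<inter> space M \<in> sets (F s)"
      by (simp add: space_F[OF s])
    show "prob (lam s -` C \<inter> space M \<inter> (Y -` B \<inter> space M))
      = prob (lam s -` C \<inter> space M) * measure (normal_law 0 (\<integral>r. (f r)^2 \<partial>leb_Icc s t)) B"
      by (rule ito_integral_law[OF s st Y A B])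
  qed simp_all
qed

end

end

theorem proposition1:
  fixes M :: "'a measure" and F :: "real \<Rightarrow> 'a measure" and W :: "real \<Rightarrow> 'a \<Rightarrow> real"
    and \<alpha> \<beta> \<sigma> :: "real \<Rightarrow> real" and s t :: real and lam :: "real \<Rightarrow> 'a \<Rightarrow> real"
  assumes "brownian_motion M F W"
    and "\<And>T. set_integrable lborel {0..T} \<alpha>"
    and "\<And>T. set_integrable lborel {0..T} \<beta>"
    and "\<And>T. set_integrable lborel {0..T} \<sigma>"
    and "0 \<le> s"
    and "strong_solution M F W \<alpha> \<beta> \<sigma> s lam"
    and "s \<le> t"
  shows "(ito_integrable M F W s t (\<lambda>u _. \<sigma> u * sde_G \<beta> u s) \<and>
      (AE \<omega> in M. lam t \<omega> = sde_m \<alpha> \<beta> s t (lam s \<omega>) + sde_G \<beta> s t * sde_J M F W \<beta> \<sigma> s t \<omega>) \<and>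
      cond_law M (lam s) (lam t) (\<lambda>x. normal_law (sde_m \<alpha> \<beta> s t x) (sde_v \<beta> \<sigma> s t)) \<and>
      sde_v \<beta> \<sigma> s t = (LBINT u=s..t. (\<sigma> u)\<^sup>2 * (sde_G \<beta> u t)\<^sup>2)) \<and>
    (ito_integrable M F W s t (\<lambda>u _. sde_K \<beta> \<sigma> u t) \<and>
      (AE \<omega> in M. (LBINT u=s..t. lam u \<omega>) =
        sde_M \<alpha> \<beta> s t (lam s \<omega>) + ito_integral M F W s t (\<lambda>u _. sde_K \<beta> \<sigma> u t) \<omega>) \<and>
      cond_law M (lam s) (\<lambda>\<omega>. LBINT u=s..t. lam u \<omega>)
        (\<lambda>x. normal_law (sde_M \<alpha> \<beta> s t x) (sde_V \<beta> \<sigma> s t)))"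
proof -
  interpret brownian_motion M F W by fact
  have \<alpha>: "integrable (leb_Icc s T) \<alpha>" for T
    unfolding integrable_leb_Icc by (rule set_integrable_subset[OF assms(2)[of T]]) (use \<open>0 \<le> s\<close> in auto)
  have \<beta>: "integrable (leb_Icc s T) \<beta>" for T
    unfolding integrable_leb_Icc by (rule set_integrable_subset[OF assms(3)[of T]]) (use \<open>0 \<le> s\<close> in auto)
  note hyps = \<open>0 \<le> s\<close> \<open>strong_solution M F W \<alpha> \<beta> \<sigma> s lam\<close> \<alpha> \<beta>
  let ?f = "\<lambda>u. \<sigma> u * sde_G \<beta> u s"
  have "in_L2 (leb_Icc s t) (\<lambda>u. sde_G \<beta> u s * \<sigma> u)"
    by (rule in_L2_continuous_mult[OF \<sigma>_in_L2[OF hyps \<open>s \<le> t\<close>]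
          ac_on_continuous[OF ac_on_sde_G_swap[OF \<beta> \<open>s \<le> t\<close>]]])
  then have "in_L2 (leb_Icc s t) ?f" by (simp add: mult.commute)
  then have J: "ito_integrable M F W s t (\<lambda>u _. ?f u)"
    using ito_integral_exists'[OF \<open>0 \<le> s\<close> \<open>s \<le> t\<close>] unfolding ito_integrable_def by metis
  note X = solution_ito[OF hyps \<open>s \<le> t\<close>]
  note Y = solution_integral_ito[OF hyps \<open>s \<le> t\<close>]
  have K: "ito_integrable M F W s t (\<lambda>u _. sde_K \<beta> \<sigma> u t)"
    using Y unfolding ito_integrable_def by blast
  \<comment> \<open>The second summand has coefficient 0 and only serves to match the two-term form
    of \<open>ito_integral_combination\<close>.\<close>
  have "AE \<omega> in M. lam t \<omega> - sde_m \<alpha> \<beta> s t (lam s \<omega>) = sde_G \<beta> s t * sde_J M F W \<beta> \<sigma> s t \<omega> + 0 * sde_J M F W \<beta> \<sigma> s t \<omega>"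
    unfolding sde_J_def
    by (rule ito_integral_combination[OF \<open>0 \<le> s\<close> X has_ito_integral_ito_integral[OF J] has_ito_integral_ito_integral[OF J]]) simp
  then have i: "AE \<omega> in M. lam t \<omega> = sde_m \<alpha> \<beta> s t (lam s \<omega>) + sde_G \<beta> s t * sde_J M F W \<beta> \<sigma> s t \<omega>"
    by eventually_elim simp
  have "AE \<omega> in M. (LBINT u=s..t. lam u \<omega>) - sde_M \<alpha> \<beta> s t (lam s \<omega>) = ito_integral M F W s t (\<lambda>u _. sde_K \<beta> \<sigma> u t) \<omega>"
    by (rule ito_integral_unique[OF \<open>0 \<le> s\<close> Y has_ito_integral_ito_integral[OF K]])
  then have ii: "AE \<omega> in M. (LBINT u=s..t. lam u \<omega>) = sde_M \<alpha> \<beta> s t (lam s \<omega>) + ito_integral M F W s t (\<lambda>u _. sde_K \<beta> \<sigma> u t) \<omega>"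
    by eventually_elim simp
  \<comment> \<open>G(s, t)^2 moves under the integral, because \<open>cond_law_ito\<close> delivers
    the variance as the integral of the squared integrand.\<close>
  have v1: "sde_v \<beta> \<sigma> s t = (LBINT u=s..t. (sde_G \<beta> s t * ?f u)^2)"
    by (simp add: sde_v_def power_mult_distrib)
  also have "\<dots> = (LBINT u=s..t. (\<sigma> u)^2 * (sde_G \<beta> u t)^2)"
  proof (rule interval_integral_cong)
    fix u assume "u \<in> einterval (min (ereal s) (ereal t)) (max (ereal s) (ereal t))"
    then have "s \<le> u" "u \<le> t" using \<open>s \<le> t\<close> by (auto simp: einterval_iff min_def max_def split: if_splits)
    then have "sde_G \<beta> u t = sde_G \<beta> u s * sde_G \<beta> s t"
      by (intro sde_G_factor[OF \<beta>]) auto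
    then show "(sde_G \<beta> s t * ?f u)^2 = (\<sigma> u)^2 * (sde_G \<beta> u t)^2"
      by (simp add: power_mult_distrib)
  qed
  finally have v2: "sde_v \<beta> \<sigma> s t = (LBINT u=s..t. (\<sigma> u)^2 * (sde_G \<beta> u t)^2)" .
  have m: "sde_m \<alpha> \<beta> s t \<in> borel_measurable borel"
    unfolding sde_m_def[abs_def] by measurable
  \<comment> \<open>Rewriting the mean as the time integral of \<open>sde_m\<close> makes it a
    parameter integral, measurable in x.\<close>
  have Mm: "sde_M \<alpha> \<beta> s t \<in> borel_measurable borel"
  proof -
    interpret L: finite_measure "leb_Icc s t" by (rule finite_measure_leb_Icc)
    have [measurable]: "sde_G \<beta> s \<in> borel_measurable (leb_Icc s t)" "sde_I \<alpha> \<beta> s \<in> borel_measurable (leb_Icc s t)"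
      unfolding sde_I_def[abs_def]
      by (intro continuous_leb_Icc_measurable ac_on_continuous[OF ac_on_sde_G[OF \<beta> \<open>s \<le> t\<close>]]
          ac_on_continuous[OF ac_on_LBINT[OF integrable_sde_I[OF \<alpha> \<beta> \<open>s \<le> t\<close>]]])+
    show ?thesis
      unfolding integral_sde_m[OF \<alpha> \<beta> \<open>s \<le> t\<close>, symmetric, abs_def] sde_m_def by measurable
  qed
  \<comment> \<open>The Ito integral in \<open>X\<close> is \<open>lam t\<close> minus its mean, so
    adding the mean back gives \<open>lam t\<close> itself.\<close>
  have "cond_law M (lam s) (lam t) (\<lambda>x. normal_law (sde_m \<alpha> \<beta> s t x) (sde_v \<beta> \<sigma> s t))"
    using cond_law_ito[OF hyps \<open>s \<le> t\<close> X m] unfolding v1 by simp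
  moreover have "cond_law M (lam s) (\<lambda>\<omega>. LBINT u=s..t. lam u \<omega>) (\<lambda>x. normal_law (sde_M \<alpha> \<beta> s t x) (sde_V \<beta> \<sigma> s t))"
    using cond_law_ito[OF hyps \<open>s \<le> t\<close> Y Mm] unfolding sde_V_def by simp
  ultimately show ?thesis
    using J K i ii v2 by blast
qed

end
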